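(* For each partition $\lambda$, we have $\Psi([P_\lambda])=s_\lambda$.
   Context: $\mathcal{P}_n$ is the set of partitions of $n$; it labels the irreducible complex representations $L_\lambda$ of $\mathfrak{S}_n$, with $L_{(n)}$ trivial and $L_{(1^n)}$ sign. $A_n=\mathbb{C}\mathfrak{S}_n\ltimes\mathbb{C}[X_1,\dots,X_n]$ with $wX_i=X_{w(i)}w$, $\deg w=0$, $\deg X_i=1$. For $\lambda\in\mathcal{P}_n$, $P_\lambda=A_ne_\lambda$ where $e_\lambda\in\mathbb{C}\mathfrak{S}_n$ is an idempotent with $L_\lambda\cong\mathbb{C}\mathfrak{S}_ne_\lambda$. For a finitely generated graded $A_n$-module $M$, $[M:L_\mu]_q=\sum_iq^i\dim\mathrm{Hom}_{\mathfrak{S}_n}(L_\mu,M_i)\in\mathbb{Z}(\!(q)\!)$. $\Lambda_q$ is the ring of symmetric functions over $\mathbb{Q}(\!(q)\!)$ with Schur functions $s_\lambda$; the big Schur function is $S_\lambda=\det(q_{\lambda_i-i+j})$ with $\sum_rq_ru^r=\prod_i\frac{1-qx_iu}{1-x_iu}$ (equivalently, $\{S_\lambda\}$ is the basis dual to $\{s_\lambda\}$ under the Hall inner product for which $\langle P_\lambda(x;q),Q_\mu(x;q)\rangle=\delta_{\lambda,\mu}$, with $P_\lambda(x;q),Q_\lambda(x;q)$ the Hall–Littlewood functions). The twisted Frobenius characteristic is $\Psi([M])=\sum_{\mu\in\mathcal{P}_n}[M:L_\mu]_q\,S_\mu\in\Lambda_q$. *)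

theory Defs
  imports Complex_Main
    "HOL-Library.Poly_Mapping"
    "HOL-Library.Function_Algebras"
    "HOL-Library.FuncSet"
    "HOL-Combinatorics.Perm"
    "HOL-Combinatorics.Permutations"
    "HOL-Computational_Algebra.Formal_Power_Series"
    "HOL-Computational_Algebra.Formal_Laurent_Series"
    "Jordan_Normal_Form.Determinant"
begin

unbundle permutation_syntax

section \<open>Partitions\<close>

definition partitions :: "nat \<Rightarrow> nat list set" where
  "partitions n = {la. sorted_wrt (\<ge>) la \<and> 0 \<notin> set la \<and> sum_list la = n}"

lemma finite_partitions: "finite (partitions n)"
proof (rule finite_subset)
  have "length la \<le> sum_list la" if "0 \<notin> set la" for la :: "nat list"
    using that by (induction la) auto
  then show "partitions n \<subseteq> {la. set la \<subseteq> {..n} \<and> length la \<le> n}"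
    by (force simp: partitions_def dest: member_le_sum_list)
qed (rule finite_lists_length_le, simp)

section \<open>The algebra $A_n$\<close>

type_synonym mon = "nat \<Rightarrow>\<^sub>0 nat"

definition mdeg :: "mon \<Rightarrow> nat" where
  "mdeg m = (\<Sum>i \<in> Poly_Mapping.keys m. Poly_Mapping.lookup m i)"

text \<open>
  \<^term>\<open>mact w m\<close> is the exponent vector of $w X^m w^{-1}$: its entry at \<open>w i\<close> is the entry
  of \<open>m\<close> at \<open>i\<close>.
\<close>
definition mact :: "nat perm \<Rightarrow> mon \<Rightarrow> mon" where
  "mact w m = Poly_Mapping.map_key (\<lambda>i. inverse w \<langle>$\<rangle> i) m"

text \<open>
  \<open>XW m w\<close> stands for the basis element $X^m w$. These elements form the semidirect product of
  the finitary permutations of the natural numbers with the monomials. The elements of \<open>alg\<close> below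
  are the finite complex combinations of them, and the product of finitely supported functions in
  \<open>Poly_Mapping\<close> is convolution along \<open>+\<close>; for this reason the (non-commutative) monoid operation
  is written \<open>+\<close> and its unit \<open>0\<close>. The variables $X_1,\dots,X_n$ are indexed by \<open>0, \<dots>, n - 1\<close>.
\<close>
datatype xw = XW (expo: mon) (wpart: "nat perm")

lemma inj_inverse_perm: "inj (\<lambda>i. inverse w \<langle>$\<rangle> i)"
  by (simp add: apply_inj inj_def)

lemma lookup_mact [simp]:
  "Poly_Mapping.lookup (mact w m) i = Poly_Mapping.lookup m (inverse w \<langle>$\<rangle> i)"
  by (simp add: mact_def map_key.rep_eq inj_inverse_perm)

lemma mact_one [simp]: "mact 1 m = m"
  by (rule poly_mapping_eqI) simp

lemma mact_zero [simp]: "mact w 0 = 0"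
  by (rule poly_mapping_eqI) simp

lemma mact_add: "mact w (a + b) = mact w a + mact w b"
  by (rule poly_mapping_eqI) (simp add: lookup_add)

lemma mact_mult: "mact (v * w) a = mact v (mact w a)"
  by (rule poly_mapping_eqI) (simp add: perm.inverse_distrib_swap apply_times)

lemma mdeg_superset:
  assumes "finite I" "Poly_Mapping.keys m \<subseteq> I"
  shows "mdeg m = (\<Sum>i \<in> I. Poly_Mapping.lookup m i)"
  unfolding mdeg_def using assms by (intro sum.mono_neutral_left) (auto simp: in_keys_iff)

lemma mdeg_add: "mdeg (a + b) = mdeg a + mdeg b"
proof -
  let ?I = "Poly_Mapping.keys a \<union> Poly_Mapping.keys b"
  have "Poly_Mapping.keys (a + b) \<subseteq> ?I" by (rule Poly_Mapping.keys_add)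
  then have "mdeg (a + b) = (\<Sum>i \<in> ?I. Poly_Mapping.lookup (a + b) i)"
    by (intro mdeg_superset) auto
  then show ?thesis
    by (simp add: lookup_add sum.distrib mdeg_superset[of ?I a] mdeg_superset[of ?I b])
qed

lemma inverse_apply_iff: "inverse w \<langle>$\<rangle> k = i \<longleftrightarrow> k = w \<langle>$\<rangle> i"
  by (metis apply_inverse bij_apply bij_inv_eq_iff)

lemma inverse_apply [simp]: "inverse w \<langle>$\<rangle> (w \<langle>$\<rangle> i) = i"
  by (subst inverse_apply_iff) (rule refl)

lemma apply_inverse_perm [simp]: "w \<langle>$\<rangle> (inverse w \<langle>$\<rangle> i) = i"
  by (rule inverse_apply_iff[THEN iffD1, OF refl, symmetric])

lemma keys_mact: "Poly_Mapping.keys (mact w m) = apply w ` Poly_Mapping.keys m"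
proof (rule Set.set_eqI)
  fix k
  have "k = w \<langle>$\<rangle> (inverse w \<langle>$\<rangle> k)" by simp
  then show "k \<in> Poly_Mapping.keys (mact w m) \<longleftrightarrow> k \<in> apply w ` Poly_Mapping.keys m"
    by (auto simp: in_keys_iff intro!: image_eqI[of k _ "inverse w \<langle>$\<rangle> k"])
qed

lemma mdeg_mact [simp]: "mdeg (mact w m) = mdeg m"
proof -
  have "mdeg (mact w m) = (\<Sum>i \<in> Poly_Mapping.keys m. Poly_Mapping.lookup (mact w m) (w \<langle>$\<rangle> i))"
    unfolding mdeg_def keys_mact by (rule sum.reindex_cong[of "apply w"])
      (auto intro: inj_onI simp: apply_inj)
  also have "\<dots> = mdeg m"
    unfolding mdeg_def by (rule sum.cong) auto
  finally show ?thesis .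
qed

instantiation xw :: monoid_add
begin

definition zero_xw :: xw where "0 = XW 0 1"

definition plus_xw :: "xw \<Rightarrow> xw \<Rightarrow> xw" where
  "a + b = XW (expo a + mact (wpart a) (expo b)) (wpart a * wpart b)"

instance
  by standard
    (auto simp: zero_xw_def plus_xw_def mact_add mact_mult add.assoc mult.assoc)

end

type_synonym alg = "xw \<Rightarrow>\<^sub>0 complex"

definition scal :: "complex \<Rightarrow> alg" where
  "scal c = Poly_Mapping.single 0 c"

definition gperm :: "nat perm \<Rightarrow> alg" where
  "gperm w = Poly_Mapping.single (XW 0 w) 1"

definition Xv :: "nat \<Rightarrow> alg" where
  "Xv i = Poly_Mapping.single (XW (Poly_Mapping.single i 1) 1) 1"

definition Sym :: "nat \<Rightarrow> nat perm set" where
  "Sym n = {w. affected w \<subseteq> {..<n}}"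

lemma finite_Sym: "finite (Sym n)"
proof (rule finite_imageD)
  have "apply ` Sym n \<subseteq> {p. p permutes {..<n}}"
    by (auto simp: Sym_def permutes_def in_affected subset_iff
      intro: bij_pointE[OF bij_apply] bij_is_inj dest: apply_inj[THEN iffD1])
      (metis apply_inj bij_apply bij_pointE)+
  then show "finite (apply ` Sym n)"
    by (rule finite_subset) (simp add: finite_permutations)
  show "inj_on apply (Sym n)"
    by (rule inj_onI) (rule perm_eqI, simp)
qed

lemma Sym_mult: "v \<in> Sym n \<Longrightarrow> w \<in> Sym n \<Longrightarrow> v * w \<in> Sym n"
  using affected_times[of v w] unfolding Sym_def by blast

definition An :: "nat \<Rightarrow> alg set" where
  "An n = {f. \<forall>b \<in> Poly_Mapping.keys f. Poly_Mapping.keys (expo b) \<subseteq> {..<n} \<and> wpart b \<in> Sym n}"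

definition An_deg :: "nat \<Rightarrow> int \<Rightarrow> alg set" where
  "An_deg n d = {f \<in> An n. \<forall>b \<in> Poly_Mapping.keys f. int (mdeg (expo b)) = d}"

text \<open>The group algebra of the symmetric group, as a subalgebra of $A_n$.\<close>
definition CSn :: "nat \<Rightarrow> alg set" where
  "CSn n = {f. \<forall>b \<in> Poly_Mapping.keys f. expo b = 0 \<and> wpart b \<in> Sym n}"

lemma gperm_mult: "gperm v * gperm w = gperm (v * w)"
  by (simp add: gperm_def mult_single plus_xw_def)

lemma gperm_Xv: "gperm w * Xv i = Xv (w \<langle>$\<rangle> i) * gperm w"
proof -
  have "mact w (Poly_Mapping.single i 1) = Poly_Mapping.single (w \<langle>$\<rangle> i) 1"
  proof (rule poly_mapping_eqI)
    fix k
    show "Poly_Mapping.lookup (mact w (Poly_Mapping.single i 1)) k =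
        Poly_Mapping.lookup (Poly_Mapping.single (w \<langle>$\<rangle> i) 1) k"
      using inverse_apply_iff[of w k i] by (auto simp: lookup_single when_def)
  qed
  then show ?thesis
    by (simp add: gperm_def Xv_def mult_single plus_xw_def)
qed

lemma Xv_commute: "Xv i * Xv j = Xv j * Xv i"
  by (simp add: Xv_def mult_single plus_xw_def add.commute)

lemma scal_commute: "scal c * f = f * scal c"
proof -
  have "scal c * Poly_Mapping.single k b = Poly_Mapping.single k b * scal c" for k and b :: complex
    by (simp add: scal_def mult_single mult.commute)
  moreover have "f = (\<Sum>k \<in> Poly_Mapping.keys f. Poly_Mapping.single k (Poly_Mapping.lookup f k))"
    by (rule poly_mapping_eqI)
      (simp add: lookup_sum lookup_single when_def sum.delta in_keys_iff)
  ultimately show ?thesis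
    by (metis (no_types, lifting) sum.cong sum_distrib_left sum_distrib_right)
qed

section \<open>Irreducible representations\<close>

text \<open>
  The boxes of the diagram of \<open>la\<close> are numbered row by row by \<open>0, \<dots>, n - 1\<close>;
  \<^term>\<open>tab_row la i\<close> and \<^term>\<open>tab_col la j\<close> are the sets of numbers in a row and in a column.
\<close>
definition tab_row :: "nat list \<Rightarrow> nat \<Rightarrow> nat set" where
  "tab_row la i = {sum_list (take i la) + j | j. i < length la \<and> j < la ! i}"

definition tab_col :: "nat list \<Rightarrow> nat \<Rightarrow> nat set" where
  "tab_col la j = {sum_list (take i la) + j | i. i < length la \<and> j < la ! i}"

definition row_group :: "nat list \<Rightarrow> nat perm set" where
  "row_group la = {w \<in> Sym (sum_list la). \<forall>i. apply w ` tab_row la i = tab_row la i}"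

definition col_group :: "nat list \<Rightarrow> nat perm set" where
  "col_group la = {w \<in> Sym (sum_list la). \<forall>j. apply w ` tab_col la j = tab_col la j}"

definition young_symmetrizer :: "nat list \<Rightarrow> alg" where
  "young_symmetrizer la =
     (\<Sum>w \<in> row_group la. gperm w) *
     (\<Sum>w \<in> col_group la. scal (of_int (sign (apply w))) * gperm w)"

definition left_ideal :: "alg set \<Rightarrow> alg \<Rightarrow> alg set" where
  "left_ideal R e = {a * e | a. a \<in> R}"

text \<open>
  $L_\lambda$ is the left ideal of the group algebra generated by the Young symmetrizer. With
  row sums to the left of signed column sums in the symmetrizer, \<open>[n]\<close> gives the trivial and
  \<open>replicate n 1\<close> the sign representation.
\<close>
definition Lirr :: "nat list \<Rightarrow> alg set" where
  "Lirr la = left_ideal (CSn (sum_list la)) (young_symmetrizer la)"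

text \<open>
  Maps that are linear over the group algebra, from a left ideal \<open>L\<close> to a submodule \<open>N\<close> of a type
  on which the algebra acts by \<open>act\<close>. A map is represented by the function that vanishes
  outside \<open>L\<close>.
\<close>
definition Hom_Sn :: "nat \<Rightarrow> (alg \<Rightarrow> 'v \<Rightarrow> 'v) \<Rightarrow> alg set \<Rightarrow> 'v set \<Rightarrow> (alg \<Rightarrow> 'v::ab_group_add) set" where
  "Hom_Sn n act L N = {f.
     (\<forall>x \<in> L. f x \<in> N) \<and>
     (\<forall>x \<in> L. \<forall>y \<in> L. f (x + y) = f x + f y) \<and>
     (\<forall>a \<in> CSn n. \<forall>x \<in> L. f (a * x) = act a (f x)) \<and>
     (\<forall>x. x \<notin> L \<longrightarrow> f x = 0)}"

definition iso_Sn :: "nat \<Rightarrow> alg set \<Rightarrow> alg set \<Rightarrow> bool" where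
  "iso_Sn n L N \<longleftrightarrow> (\<exists>f \<in> Hom_Sn n (*) L N. bij_betw f L N)"

section \<open>Graded modules\<close>

text \<open>
  A finitely generated graded $A_n$-module is given by its homogeneous components \<open>M i\<close> inside an
  ambient complex vector space, the type \<open>'v\<close>, on which the algebra acts by \<open>act\<close>.
\<close>
locale fg_graded_module =
  fixes n :: nat and act :: "alg \<Rightarrow> 'v \<Rightarrow> 'v::ab_group_add" and M :: "int \<Rightarrow> 'v set"
  assumes act_one: "act 1 v = v"
    and act_mult: "a \<in> An n \<Longrightarrow> b \<in> An n \<Longrightarrow> act (a * b) v = act a (act b v)"
    and act_add_left: "a \<in> An n \<Longrightarrow> b \<in> An n \<Longrightarrow> act (a + b) v = act a v + act b v"
    and act_add_right: "a \<in> An n \<Longrightarrow> act a (v + w) = act a v + act a w"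
    and zero_mem: "0 \<in> M i"
    and add_mem: "v \<in> M i \<Longrightarrow> w \<in> M i \<Longrightarrow> v + w \<in> M i"
    and act_mem: "a \<in> An_deg n d \<Longrightarrow> v \<in> M i \<Longrightarrow> act a v \<in> M (d + i)"
    and direct: "finite I \<Longrightarrow> (\<And>i. i \<in> I \<Longrightarrow> v' i \<in> M i) \<Longrightarrow> (\<Sum>i \<in> I. v' i) = 0 \<Longrightarrow>
      i \<in> I \<Longrightarrow> v' i = 0"
    and fin_gen: "\<exists>G. finite G \<and> G \<subseteq> (\<Union>i. M i) \<and>
      (\<forall>i. \<forall>v \<in> M i. \<exists>a. (\<forall>g \<in> G. a g \<in> An n) \<and> v = (\<Sum>g \<in> G. act (a g) g))"

text \<open>
  $[M:L_\mu]_q$, regarded in $\mathbb{Q}(\!(q)\!)$. For a finitely generated graded module the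
  dimensions are finite and vanish for all sufficiently negative \<open>i\<close>, as \<^term>\<open>Abs_fls\<close> requires.
\<close>
definition graded_mult ::
  "nat \<Rightarrow> (alg \<Rightarrow> 'v \<Rightarrow> 'v::ab_group_add) \<Rightarrow> (int \<Rightarrow> 'v set) \<Rightarrow> nat list \<Rightarrow> rat fls" where
  "graded_mult n act M mu = Abs_fls (\<lambda>i. of_nat
     (vector_space.dim (\<lambda>c f x. act (scal c) (f x)) (Hom_Sn n act (Lirr mu) (M i))))"

text \<open>The homogeneous components of $A_n e$.\<close>
definition Pmod :: "nat \<Rightarrow> alg \<Rightarrow> int \<Rightarrow> alg set" where
  "Pmod n e i = left_ideal (An n) e \<inter> An_deg n i"

lemma keys_xw_mult:
  assumes "c \<in> Poly_Mapping.keys (f * g :: alg)"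
  obtains a b where "a \<in> Poly_Mapping.keys f" "b \<in> Poly_Mapping.keys g" "c = a + b"
  using assms keys_mult[of f g] by auto

lemma An_mult:
  assumes "f \<in> An n" "g \<in> An n" shows "f * g \<in> An n"
  unfolding An_def
proof (intro CollectI ballI)
  fix c assume "c \<in> Poly_Mapping.keys (f * g)"
  then obtain a b where ab: "a \<in> Poly_Mapping.keys f" "b \<in> Poly_Mapping.keys g" "c = a + b"
    by (rule keys_xw_mult)
  have a: "Poly_Mapping.keys (expo a) \<subseteq> {..<n}" "wpart a \<in> Sym n"
    and b: "Poly_Mapping.keys (expo b) \<subseteq> {..<n}" "wpart b \<in> Sym n"
    using assms ab by (auto simp: An_def)
  have w: "wpart a \<langle>$\<rangle> i < n" if "i < n" for i
  proof (rule ccontr)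
    assume "\<not> wpart a \<langle>$\<rangle> i < n"
    then have "wpart a \<langle>$\<rangle> (wpart a \<langle>$\<rangle> i) = wpart a \<langle>$\<rangle> i"
      using a(2) by (auto simp: Sym_def in_affected subset_iff)
    then show False
      using that \<open>\<not> wpart a \<langle>$\<rangle> i < n\<close> by (simp add: apply_inj)
  qed
  have "Poly_Mapping.keys (expo c) \<subseteq> Poly_Mapping.keys (expo a) \<union> apply (wpart a) ` Poly_Mapping.keys (expo b)"
    using Poly_Mapping.keys_add[of "expo a" "mact (wpart a) (expo b)"]
    by (simp add: ab(3) plus_xw_def keys_mact)
  then show "Poly_Mapping.keys (expo c) \<subseteq> {..<n} \<and> wpart c \<in> Sym n"
    using a b w by (force simp: ab(3) plus_xw_def Sym_mult)
qed

lemma An_deg_mult: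
  assumes "f \<in> An_deg n d" "g \<in> An_deg n i" shows "f * g \<in> An_deg n (d + i)"
  using assms by (auto simp: An_deg_def An_mult plus_xw_def mdeg_add elim!: keys_xw_mult)

lemma An_add: "f \<in> An n \<Longrightarrow> g \<in> An n \<Longrightarrow> f + g \<in> An n"
  using Poly_Mapping.keys_add[of f g] by (auto simp: An_def)

lemma An_deg_add: "f \<in> An_deg n d \<Longrightarrow> g \<in> An_deg n d \<Longrightarrow> f + g \<in> An_deg n d"
  using Poly_Mapping.keys_add[of f g] by (auto simp: An_deg_def An_add)

lemma An_one: "1 \<in> An n"
  by (auto simp: An_def zero_xw_def Sym_def)

lemma fg_graded_module_Pmod:
  assumes "e \<in> CSn n"
  shows "fg_graded_module n (*) (Pmod n e)"
proof
  fix a b v w :: alg and i d :: int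
  show "0 \<in> Pmod n e i"
    by (auto simp: Pmod_def left_ideal_def An_def An_deg_def intro: exI[of _ 0])
  show "v + w \<in> Pmod n e i" if "v \<in> Pmod n e i" "w \<in> Pmod n e i"
    using that by (auto simp: Pmod_def left_ideal_def An_deg_add simp flip: distrib_right intro: An_add)
  show "a * v \<in> Pmod n e (d + i)" if "a \<in> An_deg n d" "v \<in> Pmod n e i"
    using that
    by (auto simp: Pmod_def left_ideal_def An_deg_mult An_deg_def[of n d] simp flip: mult.assoc
      intro: An_mult) 
next
  fix I :: "int set" and v' i
  assume I: "finite I" "\<And>i. i \<in> I \<Longrightarrow> v' i \<in> Pmod n e i" "(\<Sum>i \<in> I. v' i) = 0" "i \<in> I"
  have "Poly_Mapping.lookup (v' i) b = 0" for b
  proof (rule ccontr)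
    assume nz: "Poly_Mapping.lookup (v' i) b \<noteq> 0"
    have deg: "int (mdeg (expo b)) = j" if "j \<in> I" "Poly_Mapping.lookup (v' j) b \<noteq> 0" for j
      using I(2)[OF that(1)] that(2) by (auto simp: Pmod_def An_deg_def in_keys_iff)
    have "(\<Sum>j \<in> I. Poly_Mapping.lookup (v' j) b) = (\<Sum>j \<in> {i}. Poly_Mapping.lookup (v' j) b)"
      using I(1,4) deg[OF I(4) nz] deg by (intro sum.mono_neutral_right) auto
    moreover have "(\<Sum>j \<in> I. Poly_Mapping.lookup (v' j) b) = 0"
      using I(3) by (simp flip: lookup_sum)
    ultimately show False using nz by simp
  qed
  then show "v' i = 0" by (intro poly_mapping_eqI) simp
next
  have "e \<in> Pmod n e 0"
    using assms An_one[of n] unfolding Pmod_def left_ideal_def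
    by (auto simp: CSn_def An_def An_deg_def mdeg_def intro!: exI[of _ 1])
  then show "\<exists>G. finite G \<and> G \<subseteq> (\<Union>i. Pmod n e i) \<and>
      (\<forall>i. \<forall>v \<in> Pmod n e i. \<exists>a. (\<forall>g \<in> G. a g \<in> An n) \<and> v = (\<Sum>g \<in> G. a g * g))"
    by (intro exI[of _ "{e}"]) (auto simp: Pmod_def left_ideal_def)
qed (simp_all add: algebra_simps)

section \<open>Symmetric functions\<close>

text \<open>
  Formal power series in $x_0, x_1, \dots$, given by their coefficients. The ring of symmetric
  functions is the subring of symmetric series of bounded degree.
\<close>
typedef 'a mps = "UNIV :: (mon \<Rightarrow> 'a) set"
  morphisms mcoeff Mps
  by simp

setup_lifting type_definition_mps

lemma mps_eqI: "(\<And>m. mcoeff f m = mcoeff g m) \<Longrightarrow> f = g"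
  by (metis ext mcoeff_inject)

lemma mcoeff_Mps [simp]: "mcoeff (Mps f) = f"
  by (simp add: Mps_inverse)

definition splits :: "mon \<Rightarrow> (mon \<times> mon) set" where
  "splits m = {(a, b). a + b = m}"

lemma finite_splits [simp]: "finite (splits m)"
proof -
  let ?B = "\<Union>i \<in> Poly_Mapping.keys m. {..Poly_Mapping.lookup m i}"
  let ?F = "{f. \<forall>i. (i \<in> Poly_Mapping.keys m \<longrightarrow> f i \<in> ?B) \<and> (i \<notin> Poly_Mapping.keys m \<longrightarrow> f i = 0)}"
  have F: "Poly_Mapping.lookup a \<in> ?F" if "\<And>i. Poly_Mapping.lookup a i \<le> Poly_Mapping.lookup m i" for a
  proof (intro CollectI allI conjI impI)
    fix i assume "i \<in> Poly_Mapping.keys m"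
    then show "Poly_Mapping.lookup a i \<in> ?B"
      by (rule UN_I) (simp add: that)
  next
    fix i assume "i \<notin> Poly_Mapping.keys m"
    then have "Poly_Mapping.lookup m i = 0" by (simp add: in_keys_iff)
    then show "Poly_Mapping.lookup a i = 0" using that[of i] by linarith
  qed
  have F2: "Poly_Mapping.lookup a \<in> ?F" "Poly_Mapping.lookup b \<in> ?F" if "a + b = m" for a b
    by (rule F, simp flip: that add: lookup_add)+
  have "(\<lambda>(a, b). (Poly_Mapping.lookup a, Poly_Mapping.lookup b)) ` splits m \<subseteq> ?F \<times> ?F"
  proof (rule image_subsetI)
    fix p assume "p \<in> splits m"
    then obtain a b where p: "p = (a, b)" and ab: "a + b = m" by (auto simp: splits_def)
    show "(case p of (a, b) \<Rightarrow> (Poly_Mapping.lookup a, Poly_Mapping.lookup b)) \<in> ?F \<times> ?F"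
      unfolding p prod.case by (rule SigmaI) (rule F2[OF ab])+
  qed
  moreover have "finite ?F"
    by (rule finite_set_of_finite_funs) auto
  ultimately have "finite ((\<lambda>(a, b). (Poly_Mapping.lookup a, Poly_Mapping.lookup b)) ` splits m)"
    by (meson finite_SigmaI finite_subset)
  then show ?thesis
    by (rule finite_imageD) (auto simp: inj_on_def poly_mapping.lookup_inject)
qed

instantiation mps :: (comm_ring_1) comm_ring_1
begin

definition zero_mps :: "'a mps" where "0 = Mps (\<lambda>m. 0)"
definition one_mps :: "'a mps" where "1 = Mps (\<lambda>m. if m = 0 then 1 else 0)"
definition plus_mps :: "'a mps \<Rightarrow> 'a mps \<Rightarrow> 'a mps" where
  "f + g = Mps (\<lambda>m. mcoeff f m + mcoeff g m)"
definition minus_mps :: "'a mps \<Rightarrow> 'a mps \<Rightarrow> 'a mps" where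
  "f - g = Mps (\<lambda>m. mcoeff f m - mcoeff g m)"
definition uminus_mps :: "'a mps \<Rightarrow> 'a mps" where
  "- f = Mps (\<lambda>m. - mcoeff f m)"
definition times_mps :: "'a mps \<Rightarrow> 'a mps \<Rightarrow> 'a mps" where
  "f * g = Mps (\<lambda>m. \<Sum>(a, b) \<in> splits m. mcoeff f a * mcoeff g b)"

instance
proof
  fix f g h :: "'a mps"
  show "f * g * h = f * (g * h)"
  proof (rule mps_eqI)
    fix m
    have "mcoeff (f * g * h) m =
        (\<Sum>(x, c) \<in> splits m. \<Sum>(a, b) \<in> splits x. mcoeff f a * mcoeff g b * mcoeff h c)"
      by (simp add: times_mps_def sum_distrib_right case_prod_unfold)
    also have "\<dots> = (\<Sum>((x, c), (a, b)) \<in> Sigma (splits m) (\<lambda>(x, c). splits x).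
        mcoeff f a * mcoeff g b * mcoeff h c)"
      by (subst sum.Sigma[symmetric]) (auto simp: case_prod_unfold)
    also have "\<dots> = (\<Sum>((a, y), (b, c)) \<in> Sigma (splits m) (\<lambda>(a, y). splits y).
        mcoeff f a * (mcoeff g b * mcoeff h c))"
      by (rule sum.reindex_bij_witness[where
          i = "\<lambda>((a, y), (b, c)). ((a + b, c), (a, b))" and
          j = "\<lambda>((x, c), (a, b)). ((a, b + c), (b, c))"])
        (auto simp: splits_def add.assoc mult.assoc)
    also have "\<dots> =
        (\<Sum>(a, y) \<in> splits m. \<Sum>(b, c) \<in> splits y. mcoeff f a * (mcoeff g b * mcoeff h c))"
      by (subst sum.Sigma[symmetric]) (auto simp: case_prod_unfold)
    also have "\<dots> = mcoeff (f * (g * h)) m"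
      by (simp add: times_mps_def sum_distrib_left case_prod_unfold)
    finally show "mcoeff (f * g * h) m = mcoeff (f * (g * h)) m" .
  qed
  show "f * g = g * f"
  proof (rule mps_eqI)
    fix m
    have "(\<Sum>(a, b) \<in> splits m. mcoeff f a * mcoeff g b) =
        (\<Sum>(a, b) \<in> splits m. mcoeff g a * mcoeff f b)"
      by (rule sum.reindex_bij_witness[where i = prod.swap and j = prod.swap])
        (auto simp: splits_def add.commute mult.commute)
    then show "mcoeff (f * g) m = mcoeff (g * f) m"
      by (simp add: times_mps_def)
  qed
  show "1 * f = f"
  proof (rule mps_eqI)
    fix m
    have "mcoeff (1 * f) m = (\<Sum>p \<in> splits m. if p = (0, m) then mcoeff f m else 0)"
      unfolding times_mps_def mcoeff_Mps
      by (rule sum.cong) (auto simp: one_mps_def splits_def split: if_splits)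
    also have "\<dots> = mcoeff f m"
      by (simp add: splits_def[of m] finite_splits[unfolded splits_def])
    finally show "mcoeff (1 * f) m = mcoeff f m" .
  qed
  show "(f + g) * h = f * h + g * h"
    by (simp add: times_mps_def plus_mps_def distrib_right sum.distrib case_prod_unfold)
  show "(0 :: 'a mps) \<noteq> 1"
  proof
    assume "(0 :: 'a mps) = 1"
    then have "mcoeff (0 :: 'a mps) 0 = mcoeff 1 0" by simp
    then show False by (simp add: zero_mps_def one_mps_def)
  qed
qed (auto intro!: mps_eqI simp: plus_mps_def minus_mps_def uminus_mps_def zero_mps_def)

end

definition mconst :: "'a::comm_ring_1 \<Rightarrow> 'a mps" where
  "mconst c = Mps (\<lambda>m. if m = 0 then c else 0)"

definition mvar :: "nat \<Rightarrow> 'a::comm_ring_1 mps" where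
  "mvar i = Mps (\<lambda>m. if m = Poly_Mapping.single i 1 then 1 else 0)"

text \<open>$\Lambda_q$; the variable $q$ is \<^term>\<open>fls_X\<close>.\<close>
definition Lambda_q :: "rat fls mps set" where
  "Lambda_q = {f. (\<forall>w m. mcoeff f (mact w m) = mcoeff f m) \<and>
     (\<exists>d. \<forall>m. mcoeff f m \<noteq> 0 \<longrightarrow> mdeg m \<le> d)}"

text \<open>Schur functions, as generating functions of semistandard tableaux with entries in \<^typ>\<open>nat\<close>.\<close>
definition cells :: "nat list \<Rightarrow> (nat \<times> nat) set" where
  "cells la = {(i, j). i < length la \<and> j < la ! i}"

definition ssyt :: "nat list \<Rightarrow> (nat \<times> nat \<Rightarrow> nat) set" where
  "ssyt la = {T \<in> extensional (cells la).
     (\<forall>i j k. (i, j) \<in> cells la \<and> (i, k) \<in> cells la \<and> j < k \<longrightarrow> T (i, j) \<le> T (i, k)) \<and>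
     (\<forall>i j k. (i, k) \<in> cells la \<and> (j, k) \<in> cells la \<and> i < j \<longrightarrow> T (i, k) < T (j, k))}"

definition schur :: "nat list \<Rightarrow> rat fls mps" where
  "schur la = Mps (\<lambda>m. of_nat (card
     {T \<in> ssyt la. \<forall>k. card {c \<in> cells la. T c = k} = Poly_Mapping.lookup m k}))"

text \<open>
  $q_r$ is the coefficient of $u^r$ in $\prod_i F(x_i u)$ with $F(t) = \frac{1 - qt}{1 - t}$. Its
  coefficient at $x^m$ is $\prod_i\,[t^{m_i}]F(t)$ if $\sum_i m_i = r$, and \<open>0\<close> otherwise; as
  $F(0) = 1$, only the indices with $m_i > 0$ matter. See \<open>mcoeff_gen_prod\<close> below for the link
  with the product itself.
\<close>
definition hl_factor :: "rat fls fps" where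
  "hl_factor = (1 - fps_const fls_X * fps_X) / (1 - fps_X)"

definition hl_q :: "int \<Rightarrow> rat fls mps" where
  "hl_q r = Mps (\<lambda>m. if int (mdeg m) = r
     then \<Prod>i \<in> Poly_Mapping.keys m. fps_nth hl_factor (Poly_Mapping.lookup m i) else 0)"

lemma mcoeff_sum: "mcoeff (sum f I) m = (\<Sum>i \<in> I. mcoeff (f i) m)"
  by (induction I rule: infinite_finite_induct) (auto simp: zero_mps_def plus_mps_def)

lemma mcoeff_mult_var:
  "mcoeff (f * (mconst c * mvar i ^ k)) m = (if k \<le> Poly_Mapping.lookup m i
     then mcoeff f (m - Poly_Mapping.single i k) * c else 0)"
proof -
  have pow: "mconst c * mvar i ^ k = Mps (\<lambda>m. if m = Poly_Mapping.single i k then c else 0)" for k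
  proof (induction k)
    case 0
    then show ?case by (simp add: mconst_def)
  next
    case (Suc k)
    have "mconst c * mvar i ^ Suc k = (mconst c * mvar i ^ k) * mvar i"
      by (simp add: mult_ac)
    also have "\<dots> = Mps (\<lambda>m. if m = Poly_Mapping.single i (Suc k) then c else 0)"
    proof (rule mps_eqI)
      fix m
      have "mcoeff ((mconst c * mvar i ^ k) * mvar i) m =
          (\<Sum>p \<in> splits m. if p = (Poly_Mapping.single i k, Poly_Mapping.single i 1) then c else 0)"
        unfolding Suc unfolding times_mps_def mcoeff_Mps
        by (rule sum.cong) (auto simp: mvar_def split: if_splits)
      also have "\<dots> = (if m = Poly_Mapping.single i (Suc k) then c else 0)"
        by (auto simp: splits_def[of m] finite_splits[unfolded splits_def] simp flip: single_add)
      finally show "mcoeff ((mconst c * mvar i ^ k) * mvar i) m =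
          mcoeff (Mps (\<lambda>m. if m = Poly_Mapping.single i (Suc k) then c else 0)) m"
        by simp
    qed
    finally show ?case .
  qed
  let ?s = "Poly_Mapping.single i k"
  have eq: "a + ?s = m \<longleftrightarrow> k \<le> Poly_Mapping.lookup m i \<and> a = m - ?s" for a
  proof
    assume "a + ?s = m"
    then show "k \<le> Poly_Mapping.lookup m i \<and> a = m - ?s"
      by (auto simp: lookup_add)
  next
    assume "k \<le> Poly_Mapping.lookup m i \<and> a = m - ?s"
    then show "a + ?s = m"
      by (intro poly_mapping_eqI) (auto simp: lookup_add lookup_minus lookup_single when_def)
  qed
  have "mcoeff (f * (mconst c * mvar i ^ k)) m =
      (\<Sum>p \<in> splits m. if p = (m - ?s, ?s) then mcoeff f (m - ?s) * c else 0)"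
    unfolding pow unfolding times_mps_def mcoeff_Mps
    by (rule sum.cong) (auto simp: splits_def split: if_splits)
  also have "\<dots> = (if k \<le> Poly_Mapping.lookup m i then mcoeff f (m - ?s) * c else 0)"
    using eq[of "m - ?s"] by (auto simp: splits_def[of m] finite_splits[unfolded splits_def])
  finally show ?thesis .
qed

text \<open>$\frac{1 - q x_i u}{1 - x_i u}$ as a power series in $u$.\<close>
definition gen_factor :: "nat \<Rightarrow> rat fls mps fps" where
  "gen_factor i = (1 - fps_const (mconst fls_X * mvar i) * fps_X) * Abs_fps (\<lambda>k. mvar i ^ k)"

lemma geometric_factor: "(1 - fps_const (mvar i) * fps_X) * Abs_fps (\<lambda>k. mvar i ^ k) = 1"
  by (rule fps_ext) (simp add: left_diff_distrib mult.assoc power_eq_if)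

lemma hl_factor_nth: "fps_nth hl_factor k = (if k = 0 then 1 else 1 - fls_X)"
proof -
  have "(1 - fps_X) * Abs_fps (\<lambda>_. 1 :: rat fls) = 1"
    by (rule fps_ext) (simp add: left_diff_distrib)
  then have "inverse (1 - fps_X) = Abs_fps (\<lambda>_. 1 :: rat fls)"
    by (metis fps_inverse_unique)
  then have eq: "hl_factor = (1 - fps_const fls_X * fps_X) * Abs_fps (\<lambda>_. 1 :: rat fls)"
    unfolding hl_factor_def by (subst fps_divide_unit) auto
  show ?thesis
    unfolding eq by (simp add: left_diff_distrib mult.assoc)
qed

lemma gen_factor_nth: "fps_nth (gen_factor i) k = mconst (fps_nth hl_factor k) * mvar i ^ k"
proof -
  have "mconst (1 - fls_X :: rat fls) = 1 - mconst fls_X" and "mconst (1 :: rat fls) = 1"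
    by (auto intro!: mps_eqI simp: mconst_def minus_mps_def one_mps_def)
  then show ?thesis
    by (cases k) (simp_all add: hl_factor_nth gen_factor_def left_diff_distrib mult.assoc)
qed

lemma mcoeff_gen_prod:
  assumes "finite I"
  shows "mcoeff (fps_nth (\<Prod>i \<in> I. gen_factor i) r) m =
    (if Poly_Mapping.keys m \<subseteq> I then mcoeff (hl_q (int r)) m else 0)"
proof -
  have "mcoeff (fps_nth (\<Prod>i \<in> I. gen_factor i) r) m =
    (if Poly_Mapping.keys m \<subseteq> I \<and> mdeg m = r
     then \<Prod>i \<in> I. fps_nth hl_factor (Poly_Mapping.lookup m i) else 0)"
    using assms
  proof (induction I arbitrary: m r)
    case empty
    then show ?case
      by (auto simp: one_mps_def zero_mps_def mdeg_def)
  next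
    case (insert j I)
    let ?l = "Poly_Mapping.lookup m j"
    let ?G = "\<Prod>i \<in> I. gen_factor i"
    let ?m = "m - Poly_Mapping.single j ?l"
    have m: "m = ?m + Poly_Mapping.single j ?l"
      by (intro poly_mapping_eqI) (auto simp: lookup_add lookup_minus lookup_single when_def)
    have lk: "Poly_Mapping.lookup ?m i = (if i = j then 0 else Poly_Mapping.lookup m i)" for i
      by (auto simp: lookup_minus lookup_single when_def)
    have keys: "Poly_Mapping.keys ?m \<subseteq> I \<longleftrightarrow> Poly_Mapping.keys m \<subseteq> insert j I"
      using insert.hyps by (auto simp: subset_iff in_keys_iff lk)
    have deg: "mdeg m = mdeg ?m + ?l"
      by (subst m, subst mdeg_add) (simp add: mdeg_def)
    have "mcoeff (fps_nth (\<Prod>i \<in> insert j I. gen_factor i) r) m =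
        mcoeff (\<Sum>k = 0..r. fps_nth ?G (r - k) * (mconst (fps_nth hl_factor k) * mvar j ^ k)) m"
      using insert.hyps by (simp add: fps_mult_nth gen_factor_nth mult.commute[of ?G])
        (simp add: mult.commute)
    also have "\<dots> = (\<Sum>k = 0..r. mcoeff
        (fps_nth ?G (r - k) * (mconst (fps_nth hl_factor k) * mvar j ^ k)) m)"
      by (rule mcoeff_sum)
    also have "\<dots> = (\<Sum>k = 0..r. if k = ?l then mcoeff (fps_nth ?G (r - ?l)) ?m * fps_nth hl_factor ?l else 0)"
    proof (rule sum.cong)
      fix k
      have "\<not> Poly_Mapping.keys (m - Poly_Mapping.single j k) \<subseteq> I" if "k < ?l"
        using that insert.hyps by (auto simp: subset_iff in_keys_iff lookup_minus intro!: exI[of _ j])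
      then show "mcoeff (fps_nth ?G (r - k) * (mconst (fps_nth hl_factor k) * mvar j ^ k)) m =
        (if k = ?l then mcoeff (fps_nth ?G (r - ?l)) ?m * fps_nth hl_factor ?l else 0)"
        by (auto simp: mcoeff_mult_var insert.IH)
    qed simp
    also have "\<dots> = (if ?l \<le> r then mcoeff (fps_nth ?G (r - ?l)) ?m * fps_nth hl_factor ?l else 0)"
      by simp
    also have "\<dots> = (if Poly_Mapping.keys m \<subseteq> insert j I \<and> mdeg m = r
     then \<Prod>i \<in> insert j I. fps_nth hl_factor (Poly_Mapping.lookup m i) else 0)"
    proof -
      have "(\<Prod>i \<in> I. fps_nth hl_factor (Poly_Mapping.lookup ?m i)) =
          (\<Prod>i \<in> I. fps_nth hl_factor (Poly_Mapping.lookup m i))"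
        using insert.hyps by (intro prod.cong) (auto simp: lk)
      then show ?thesis
        using insert.hyps by (auto simp: insert.IH keys deg mult.commute)
    qed
    finally show ?case .
  qed
  moreover have "(\<Prod>i \<in> I. fps_nth hl_factor (Poly_Mapping.lookup m i)) =
      (\<Prod>i \<in> Poly_Mapping.keys m. fps_nth hl_factor (Poly_Mapping.lookup m i))"
    if "Poly_Mapping.keys m \<subseteq> I"
    using that assms by (intro prod.mono_neutral_right) (auto simp: in_keys_iff hl_factor_nth)
  ultimately show ?thesis
    by (auto simp: hl_q_def)
qed

definition big_schur :: "nat list \<Rightarrow> rat fls mps" where
  "big_schur la = det (mat (length la) (length la) (\<lambda>(i, j). hl_q (int (la ! i) - int i + int j)))"

definition Psi ::
  "nat \<Rightarrow> (alg \<Rightarrow> 'v \<Rightarrow> 'v::ab_group_add) \<Rightarrow> (int \<Rightarrow> 'v set) \<Rightarrow> rat fls mps" where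
  "Psi n act M = (\<Sum>mu \<in> partitions n. mconst (graded_mult n act M mu) * big_schur mu)"

lemma Lambda_q_const: "mconst c \<in> Lambda_q"
proof -
  have "mact w m = 0 \<longleftrightarrow> m = 0" for w m
    by (metis mact_mult mact_one mact_zero perm.left_inverse)
  then show ?thesis
    by (auto simp: Lambda_q_def mconst_def mdeg_def intro!: exI[of _ 0])
qed

lemma Lambda_q_add:
  assumes "f \<in> Lambda_q" "g \<in> Lambda_q" shows "f + g \<in> Lambda_q"
proof -
  obtain d d' where "\<And>m. mcoeff f m \<noteq> 0 \<Longrightarrow> mdeg m \<le> d" "\<And>m. mcoeff g m \<noteq> 0 \<Longrightarrow> mdeg m \<le> d'"
    using assms by (auto simp: Lambda_q_def)
  then have "mdeg m \<le> max d d'" if "mcoeff f m + mcoeff g m \<noteq> 0" for m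
    using that by (metis add_0 max.coboundedI1 max.coboundedI2)
  then show ?thesis
    using assms by (auto simp: Lambda_q_def plus_mps_def)
qed

lemma Lambda_q_mult:
  assumes "f \<in> Lambda_q" "g \<in> Lambda_q" shows "f * g \<in> Lambda_q"
proof -
  obtain d d' where d: "\<And>m. mcoeff f m \<noteq> 0 \<Longrightarrow> mdeg m \<le> d" "\<And>m. mcoeff g m \<noteq> 0 \<Longrightarrow> mdeg m \<le> d'"
    using assms by (auto simp: Lambda_q_def)
  have "mdeg m \<le> d + d'" if nz: "mcoeff (f * g) m \<noteq> 0" for m
  proof -
    obtain p where "p \<in> splits m" "mcoeff f (fst p) * mcoeff g (snd p) \<noteq> 0"
      using nz unfolding times_mps_def mcoeff_Mps case_prod_unfold
      by (metis (mono_tags, lifting) sum.not_neutral_contains_not_neutral)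
    then show ?thesis
      using d[of "fst p"] d[of "snd p"] by (auto simp: splits_def mdeg_add intro!: add_mono)
  qed
  moreover have "mcoeff (f * g) (mact w m) = mcoeff (f * g) m" for w m
  proof -
    have inv: "mact w (mact (inverse w) x) = x" "mact (inverse w) (mact w x) = x" for x
      by (simp_all flip: mact_mult)
    have "(\<Sum>(a, b) \<in> splits (mact w m). mcoeff f a * mcoeff g b) =
        (\<Sum>(a, b) \<in> splits m. mcoeff f a * mcoeff g b)"
      by (rule sum.reindex_bij_witness[where i = "map_prod (mact w) (mact w)" and
            j = "map_prod (mact (inverse w)) (mact (inverse w))"])
        (use assms in \<open>auto simp: splits_def inv Lambda_q_def simp flip: mact_add\<close>)
    then show ?thesis by (simp add: times_mps_def)
  qed
  ultimately show ?thesis by (auto simp: Lambda_q_def)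
qed

lemma Lambda_q_sum: "(\<And>i. i \<in> I \<Longrightarrow> f i \<in> Lambda_q) \<Longrightarrow> sum f I \<in> Lambda_q"
  using Lambda_q_const[of 0]
  by (induction I rule: infinite_finite_induct)
    (auto simp: Lambda_q_add mconst_def zero_mps_def cong: if_cong)

lemma Lambda_q_prod: "(\<And>i. i \<in> I \<Longrightarrow> f i \<in> Lambda_q) \<Longrightarrow> prod f I \<in> Lambda_q"
  using Lambda_q_const[of 1]
  by (induction I rule: infinite_finite_induct)
    (auto simp: Lambda_q_mult mconst_def one_mps_def cong: if_cong)

lemma Lambda_q_hl_q: "hl_q r \<in> Lambda_q"
proof -
  have "(\<Prod>i \<in> Poly_Mapping.keys (mact w m). fps_nth hl_factor (Poly_Mapping.lookup (mact w m) i)) =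
      (\<Prod>i \<in> Poly_Mapping.keys m. fps_nth hl_factor (Poly_Mapping.lookup m i))" for w m
    unfolding keys_mact
    by (rule prod.reindex_cong[of "apply w"])
      (auto intro: inj_onI simp: apply_inj)
  then show ?thesis
    by (auto simp: Lambda_q_def hl_q_def intro!: exI[of _ "nat r"])
qed

lemma Lambda_q_big_schur: "big_schur la \<in> Lambda_q"
proof -
  have "signof p = mconst (signof p)" for p
    by (auto intro!: mps_eqI simp: sign_def mconst_def one_mps_def uminus_mps_def)
  then have "signof p \<in> Lambda_q" for p
    by (metis Lambda_q_const)
  then show ?thesis
    unfolding big_schur_def det_def
    by (auto intro!: Lambda_q_sum Lambda_q_mult Lambda_q_prod Lambda_q_hl_q
        simp: permutes_in_image[where S = "{0..<length la}", simplified])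
qed

lemma Lambda_q_Psi: "Psi n act M \<in> Lambda_q"
  unfolding Psi_def by (intro Lambda_q_sum Lambda_q_mult Lambda_q_const Lambda_q_big_schur)

end

theory Submission
  imports Defs "HOL-Combinatorics.Cycles"
begin

text \<open>
  As a representation of the symmetric group, $P_\lambda$ in degree \<open>d\<close> is
  $\mathbb{C}[X]_d \otimes L_\lambda$, so $[P_\lambda : L_\mu]_q$ is the inner product of
  $\chi_\mu$ with $\chi_\lambda \cdot S_q$, where $S_q$ is the graded character of $\mathbb{C}[X]$.
  On the other side, the coefficient of $x^\alpha$ in $S_\mu$ is the inner product of $\chi_\mu$
  with $M^\alpha \cdot \Lambda_{-q}$, where $M^\alpha$ is the character of the action on the
  colourings of content $\alpha$ and $\Lambda_{-q}$ that of the exterior algebra of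
  $\mathbb{C}^n$. As the irreducible characters are an orthonormal basis of the class functions and
  $S_q \Lambda_{-q} = 1$ (the Koszul complex), the coefficient of $x^\alpha$ in
  $\Psi([P_\lambda])$ is the inner product of $\chi_\lambda$ with $M^\alpha$, which is the
  Kostka number.

  The characters enter through the determinantal formula
  $\chi_\mu = \sum_p \mathrm{sgn}(p)\, M^{(\mu_i - i + p(i))_i}$. By the Jacobi--Trudi identity
  the right-hand side has inner product $K_{\mu\alpha}$ with $M^\alpha$, and triangularity of the
  Kostka numbers makes these functions orthonormal. They are the characters of the
  Young symmetrizers because the difference of the two has norm $1 - 2 + 1 = 0$.
\<close>

text \<open>The exterior algebra enters because every positive power of a variable has the same
  coefficient 1 - q in the series defining the q_r (\<open>hl_factor_nth\<close>). So a coefficient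
  of a product of q_r counts matrices, weighted by 1 - q to the number of nonzero entries. The same
  weight appears when a permutation character is averaged against the exterior character, since a
  block of k >= 1 points of one colour has invariants only in exterior degrees 0 and 1. At q = 0
  this is the classical pairing of products of complete symmetric functions.

  Irreducibility is never treated as such. Schur's lemma is replaced by the property that y x y is a
  multiple of y for a Young symmetrizer y: it gives the norm of the character of y and makes
  convolution with a class function act on it by a scalar. Dimensions of Hom spaces are obtained as
  traces of explicit projections.

  Averages are kept multiplied by the group order, so that the characters stay integer-valued and
  the identities pass between the complex numbers, where the modules live, and Laurent
  series.\<close>

lemma Sym_one: "1 \<in> Sym n"
  by (simp add: Sym_def)

lemma Sym_inverse: "w \<in> Sym n \<Longrightarrow> inverse w \<in> Sym n"
  by (simp add: Sym_def)

lemma Sym_fixes: "w \<in> Sym n \<Longrightarrow> \<not> x < n \<Longrightarrow> w \<langle>$\<rangle> x = x"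
  by (auto simp: Sym_def in_affected subset_iff)

lemma Sym_less: "w \<in> Sym n \<Longrightarrow> x < n \<Longrightarrow> w \<langle>$\<rangle> x < n"
  by (metis Sym_fixes apply_inj)

lemma Sym_less_iff: "w \<in> Sym n \<Longrightarrow> w \<langle>$\<rangle> x < n \<longleftrightarrow> x < n"
  by (metis Sym_fixes Sym_less)

lemma Sym_eqI: "v \<in> Sym n \<Longrightarrow> w \<in> Sym n \<Longrightarrow> (\<And>x. x < n \<Longrightarrow> v \<langle>$\<rangle> x = w \<langle>$\<rangle> x) \<Longrightarrow> v = w"
  by (rule perm_eqI) (metis Sym_fixes)

lemma permutes_Sym:
  assumes "p permutes {..<n}"
  obtains w where "w \<in> Sym n" "apply w = p"
proof
  have *: "bij p \<and> finite {a. p a \<noteq> a}"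
    using permutes_bij[OF assms] assms
    by (auto intro!: finite_subset[of "{a. p a \<noteq> a}" "{..<n}"] simp: permutes_def)
  then show "apply (Perm p) = p"
    by (simp add: Perm_inverse)
  then show "Perm p \<in> Sym n"
    using assms by (auto simp: Sym_def in_affected permutes_def)
qed

lemma permutation_apply: "permutation (apply w)"
proof -
  have "apply w permutes affected w"
    using bij_apply[of w] by (auto simp: permutes_def in_affected bij_iff)
  then show ?thesis
    by (rule permutes_imp_permutation[rotated]) simp
qed

lemma sign_mult: "sign (apply (v * w)) = sign (apply v) * sign (apply w)"
  by (simp add: apply_times sign_compose permutation_apply)

lemma sign_inverse_perm: "sign (apply (inverse w)) = sign (apply w)"
  by (simp add: apply_inverse sign_inverse permutation_apply)

lemma swap_Sym: "x < n \<Longrightarrow> y < n \<Longrightarrow> \<langle>x \<leftrightarrow> y\<rangle> \<in> Sym n"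
  by (cases "x = y") (auto simp: Sym_def affected_swap)

lemma apply_swap: "apply \<langle>x \<leftrightarrow> y\<rangle> = transpose x y"
  by (rule ext) (auto simp: transpose_def)

lemma card_Sym_pos: "0 < card (Sym n)"
  using finite_Sym Sym_one by (auto simp: card_gt_0_iff)

lemma perm_cancel [simp]:
  "inverse v * (v * w) = (w :: 'a perm)" "v * (inverse v * w) = (w :: 'a perm)"
  by (simp_all flip: mult.assoc)

lemma sum_Sym_left: "v \<in> Sym n \<Longrightarrow> (\<Sum>w \<in> Sym n. f (v * w)) = (\<Sum>w \<in> Sym n. f w)"
  by (rule sum.reindex_bij_witness[where j = "\<lambda>w. v * w" and i = "\<lambda>w. inverse v * w"])
    (auto simp: Sym_mult Sym_inverse)

lemma sum_Sym_right: "v \<in> Sym n \<Longrightarrow> (\<Sum>w \<in> Sym n. f (w * v)) = (\<Sum>w \<in> Sym n. f w)"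
  by (rule sum.reindex_bij_witness[where j = "\<lambda>w. w * v" and i = "\<lambda>w. w * inverse v"])
    (auto simp: Sym_mult Sym_inverse mult.assoc)

lemma sum_Sym_inverse: "(\<Sum>w \<in> Sym n. f (inverse w)) = (\<Sum>w \<in> Sym n. f w)"
  by (rule sum.reindex_bij_witness[where j = inverse and i = inverse])
    (auto simp: Sym_mult Sym_inverse)


section \<open>Colourings\<close>

text \<open>
  Contents are integer-valued, so that the negative entries occurring in the determinantal formula
  yield no colouring at all.
\<close>
definition colorings :: "nat \<Rightarrow> ('c \<Rightarrow> int) \<Rightarrow> (nat \<Rightarrow> 'c) set" where
  "colorings n g = {c \<in> {..<n} \<rightarrow>\<^sub>E UNIV. \<forall>k. int (card {x. x < n \<and> c x = k}) = g k}"

definition fixes_coloring :: "nat \<Rightarrow> nat perm \<Rightarrow> (nat \<Rightarrow> 'c) \<Rightarrow> bool" where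
  "fixes_coloring n w c \<longleftrightarrow> (\<forall>x < n. c (w \<langle>$\<rangle> x) = c x)"

text \<open>The permutation character written M^alpha in the overview, with \<open>g\<close> for
  alpha. It is induced from the trivial character of a Young subgroup, and it vanishes identically
  when no colouring has content \<open>g\<close>.\<close>

definition fixed_colorings :: "nat \<Rightarrow> ('c \<Rightarrow> int) \<Rightarrow> nat perm \<Rightarrow> nat" where
  "fixed_colorings n g w = card {c \<in> colorings n g. fixes_coloring n w c}"

lemma colorings_range:
  assumes "c \<in> colorings n g"
  shows "{k. g k \<noteq> 0} = c ` {..<n}"
proof -
  have g: "g k = int (card {x. x < n \<and> c x = k})" for k
    using assms by (simp add: colorings_def)
  have "finite {x. x < n \<and> c x = k}" for k by simp
  then have "g k \<noteq> 0 \<longleftrightarrow> {x. x < n \<and> c x = k} \<noteq> {}" for k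
    unfolding g by (metis card_0_eq of_nat_eq_0_iff)
  then show ?thesis by auto
qed

lemma finite_colorings [simp]: "finite (colorings n g)"
proof (cases "colorings n g = {}")
  case False
  then obtain c where "c \<in> colorings n g" by auto
  then have fin: "finite {k. g k \<noteq> 0}" by (simp add: colorings_range)
  have "colorings n g \<subseteq> {..<n} \<rightarrow>\<^sub>E {k. g k \<noteq> 0}"
  proof
    fix c assume c: "c \<in> colorings n g"
    then show "c \<in> {..<n} \<rightarrow>\<^sub>E {k. g k \<noteq> 0}"
      by (subst colorings_range[OF c]) (auto simp: colorings_def PiE_iff)
  qed
  then show ?thesis
    by (rule finite_subset) (simp add: finite_PiE fin)
qed simp

text \<open>Equal contents mean equal image multisets, and two functions with the same image
  multiset differ by a permutation of the domain. So the colourings of one content form a single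
  orbit, which makes averages over the group computable.\<close>

lemma colorings_transitive:
  assumes "c \<in> colorings n g" "c' \<in> colorings n g"
  obtains w where "w \<in> Sym n" "\<And>x. x < n \<Longrightarrow> c x = c' (w \<langle>$\<rangle> x)"
proof -
  have "image_mset c (mset_set {..<n}) = image_mset c' (mset_set {..<n})"
  proof (rule multiset_eqI)
    fix k
    have "int (card {x. x < n \<and> c x = k}) = int (card {x. x < n \<and> c' x = k})"
      using assms by (simp add: colorings_def)
    then show "count (image_mset c (mset_set {..<n})) k = count (image_mset c' (mset_set {..<n})) k"
      by (simp add: count_image_mset vimage_def Int_def conj_commute)
  qed
  from image_mset_eq_implies_permutes[OF _ this]
  obtain p where p: "p permutes {..<n}" "\<forall>x \<in> {..<n}. c x = c' (p x)" by auto
  from permutes_Sym[OF p(1)] obtain w where "w \<in> Sym n" "apply w = p" .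
  with p(2) that show ?thesis by auto
qed

text \<open>Precomposition with \<open>w\<close>, hence a right action; the restriction keeps the
  result in the extensional function space.\<close>

definition act_coloring :: "nat \<Rightarrow> nat perm \<Rightarrow> (nat \<Rightarrow> 'c) \<Rightarrow> nat \<Rightarrow> 'c" where
  "act_coloring n w c = (\<lambda>x \<in> {..<n}. c (w \<langle>$\<rangle> x))"

lemma act_coloring_colorings:
  assumes "c \<in> colorings n g" "w \<in> Sym n" shows "act_coloring n w c \<in> colorings n g"
proof -
  have "card {x. x < n \<and> c (w \<langle>$\<rangle> x) = k} = card {x. x < n \<and> c x = k}" for k
  proof (rule bij_betw_same_card)
    show "bij_betw (apply w) {x. x < n \<and> c (w \<langle>$\<rangle> x) = k} {x. x < n \<and> c x = k}"
      by (rule bij_betw_byWitness[where f' = "apply (inverse w)"])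
        (use assms in \<open>auto simp: Sym_less_iff Sym_inverse\<close>)
  qed
  moreover have "{x. x < n \<and> act_coloring n w c x = k} = {x. x < n \<and> c (w \<langle>$\<rangle> x) = k}" for k
    by (auto simp: act_coloring_def)
  ultimately show ?thesis
    using assms by (auto simp: colorings_def) (auto simp: act_coloring_def)
qed

lemma act_coloring_inverse:
  assumes "c \<in> colorings n g" "w \<in> Sym n" shows "act_coloring n (inverse w) (act_coloring n w c) =
      c"
proof
  fix x
  show "act_coloring n (inverse w) (act_coloring n w c) x = c x"
    using assms by (cases "x < n")
      (auto simp: act_coloring_def Sym_less_iff Sym_inverse colorings_def PiE_arb[of c "{..<n}"])
qed

text \<open>Burnside's lemma for a single orbit. With \<open>t c\<close> carrying the base colouring
  \<open>c0\<close> to \<open>c\<close>, a pair of a permutation \<open>w\<close> and a colouring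
  \<open>c\<close> fixed by it corresponds to the group element \<open>t c * w\<close>, from which
  \<open>c\<close> is recovered as the image of \<open>c0\<close>.\<close>

lemma sum_fixed_colorings:
  assumes "colorings n g \<noteq> {}"
  shows "(\<Sum>w \<in> Sym n. fixed_colorings n g w) = card (Sym n)"
proof -
  obtain c0 where c0: "c0 \<in> colorings n g" using assms by auto
  have "\<forall>c. \<exists>w. c \<in> colorings n g \<longrightarrow> w \<in> Sym n \<and> (\<forall>x < n. c x = c0 (w \<langle>$\<rangle> x))"
    using colorings_transitive[OF _ c0] by metis
  then obtain t where t: "\<And>c. c \<in> colorings n g \<Longrightarrow> t c \<in> Sym n"
    "\<And>c x. c \<in> colorings n g \<Longrightarrow> x < n \<Longrightarrow> c x = c0 (t c \<langle>$\<rangle> x)" by metis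
  let ?S = "SIGMA w:Sym n. {c \<in> colorings n g. fixes_coloring n w c}"
  have "(\<Sum>w \<in> Sym n. fixed_colorings n g w) = card ?S"
    unfolding fixed_colorings_def by (rule card_SigmaI[symmetric]) (auto simp: finite_Sym)
  also have "\<dots> = card (Sym n)"
  proof (rule bij_betw_same_card)
    have 1: "act_coloring n (t c * w) c0 = c" if "c \<in> colorings n g" "fixes_coloring n w c"
        "w \<in> Sym n" for c w
    proof
      fix x
      show "act_coloring n (t c * w) c0 x = c x"
      proof (cases "x < n")
        case True
        then have "w \<langle>$\<rangle> x < n" using that Sym_less by blast
        then have "c0 (t c \<langle>$\<rangle> (w \<langle>$\<rangle> x)) = c (w \<langle>$\<rangle> x)" using t that by metis
        also have "\<dots> = c x" using that True by (simp add: fixes_coloring_def)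
        finally show ?thesis using True by (simp add: act_coloring_def apply_times)
      qed (use that in \<open>auto simp: act_coloring_def colorings_def\<close>)
    qed
    have 2: "fixes_coloring n (inverse (t c) * v) c" if "v \<in> Sym n" "c = act_coloring n v c0"
        for c v
    proof -
      have c: "c \<in> colorings n g" using that act_coloring_colorings c0 by blast
      have "c (inverse (t c) \<langle>$\<rangle> (v \<langle>$\<rangle> x)) = c x" if "x < n" for x
      proof -
        have "inverse (t c) \<langle>$\<rangle> (v \<langle>$\<rangle> x) < n"
          using \<open>x < n\<close> \<open>v \<in> Sym n\<close> t(1)[OF c] by (simp add: Sym_less Sym_inverse)
        then have "c (inverse (t c) \<langle>$\<rangle> (v \<langle>$\<rangle> x)) = c0 (v \<langle>$\<rangle> x)"
          using t(2)[OF c] by simp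
        also have "\<dots> = c x" using that \<open>c = act_coloring n v c0\<close> by (simp add: act_coloring_def)
        finally show ?thesis .
      qed
      then show ?thesis by (simp add: fixes_coloring_def apply_times)
    qed
    show "bij_betw (\<lambda>(w, c). t c * w) ?S (Sym n)"
      by (rule bij_betw_byWitness[where f' = "\<lambda>v.
          (inverse (t (act_coloring n v c0)) * v, act_coloring n v c0)"])
        (auto simp: 1 2 act_coloring_colorings[OF c0] t Sym_mult Sym_inverse)
  qed
  finally show ?thesis .
qed

lemma fixed_colorings_empty: "colorings n g = {} \<Longrightarrow> fixed_colorings n g w = 0"
  by (simp add: fixed_colorings_def)

text \<open>Acting by the inverse of \<open>v\<close> matches the colourings fixed by the conjugate
  with those fixed by \<open>w\<close>.\<close>

lemma fixed_colorings_conj: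
  assumes v: "v \<in> Sym n" and w: "w \<in> Sym n"
  shows "fixed_colorings n g (inverse v * w * v) = fixed_colorings n g w"
  unfolding fixed_colorings_def
proof (rule bij_betw_same_card)
  have 1: "fixes_coloring n w (act_coloring n (inverse v) c)"
      if "fixes_coloring n (inverse v * w * v) c" for c
    unfolding fixes_coloring_def
  proof (intro allI impI)
    fix x assume x: "x < n"
    let ?y = "inverse v \<langle>$\<rangle> x"
    have "?y < n" using x v by (simp add: Sym_less Sym_inverse)
    then have "c (inverse v \<langle>$\<rangle> (w \<langle>$\<rangle> x)) = c ?y"
      using that by (auto simp: fixes_coloring_def apply_times dest!: spec[of _ ?y])
    then show "act_coloring n (inverse v) c (w \<langle>$\<rangle> x) = act_coloring n (inverse v) c x"
      using x w by (simp add: act_coloring_def Sym_less)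
  qed
  have 2: "fixes_coloring n (inverse v * w * v) (act_coloring n v c)" if "fixes_coloring n w c"
      for c
    using that v w by (auto simp: fixes_coloring_def act_coloring_def apply_times Sym_less
        Sym_inverse)
  show "bij_betw (act_coloring n (inverse v))
      {c \<in> colorings n g. fixes_coloring n (inverse v * w * v) c}
      {c \<in> colorings n g. fixes_coloring n w c}"
    by (rule bij_betw_byWitness[where f' = "act_coloring n v"])
      (use act_coloring_inverse[OF _ v] act_coloring_inverse[OF _ Sym_inverse[OF v]] v in
        \<open>auto simp: 1 2 act_coloring_colorings Sym_inverse\<close>)
qed

lemma fixes_coloring_inverse:
  assumes "w \<in> Sym n" shows "fixes_coloring n (inverse w) c \<longleftrightarrow> fixes_coloring n w c"
  using assms unfolding fixes_coloring_def by
      (metis Sym_less Sym_inverse inverse_apply apply_inverse_perm)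

lemma fixed_colorings_inverse: "w \<in> Sym n \<Longrightarrow> fixed_colorings n g (inverse w) = fixed_colorings n g w"
  by (simp add: fixed_colorings_def fixes_coloring_inverse)


section \<open>The exterior algebra character and its average against colourings\<close>

definition restrict_perm :: "nat perm \<Rightarrow> nat set \<Rightarrow> nat \<Rightarrow> nat" where
  "restrict_perm w J x = (if x \<in> J then w \<langle>$\<rangle> x else x)"

definition inv_sets :: "nat \<Rightarrow> nat perm \<Rightarrow> nat set set" where
  "inv_sets n w = {J. J \<subseteq> {..<n} \<and> apply w ` J = J}"

text \<open>
  The trace on the exterior algebra, with degree \<open>j\<close> weighted by $(-q)^j$: only the invariant sets
  \<open>J\<close> contribute to the diagonal.
\<close>
definition ext_char :: "nat \<Rightarrow> 'a::comm_ring_1 \<Rightarrow> nat perm \<Rightarrow> 'a" where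
  "ext_char n q w = (\<Sum>J \<in> inv_sets n w. (- q) ^ card J * of_int (sign (restrict_perm w J)))"

lemma finite_inv_sets [simp]: "finite (inv_sets n w)"
  by (rule finite_subset[of _ "Pow {..<n}"]) (auto simp: inv_sets_def)

lemma restrict_perm_permutes:
  assumes "apply w ` J = J" shows "restrict_perm w J permutes J"
proof (rule bij_imp_permutes)
  have "inj_on (apply w) J" by (auto simp: inj_on_def apply_inj)
  then have "bij_betw (apply w) J J" using assms by (simp add: bij_betw_def)
  then show "bij_betw (restrict_perm w J) J J"
    by (rule bij_betw_cong[THEN iffD1, rotated]) (simp add: restrict_perm_def)
qed (simp add: restrict_perm_def)

text \<open>
  Multiplication by the transposition of \<open>x\<close> and \<open>y\<close> reverses the sign.
\<close>
lemma sum_sign_stabilizer_zero: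
  assumes J: "J \<subseteq> {..<n}" and xy: "x \<in> J" "y \<in> J" "x \<noteq> y" "c x = c y"
  shows "(\<Sum>w | w \<in> Sym n \<and> fixes_coloring n w c \<and> apply w ` J = J. sign (restrict_perm w J)) = 0"
proof -
  let ?S = "{w. w \<in> Sym n \<and> fixes_coloring n w c \<and> apply w ` J = J}"
  let ?t = "\<langle>x \<leftrightarrow> y\<rangle>"
  have t: "?t \<in> Sym n" using J xy by (intro swap_Sym) auto
  have ct: "c (?t \<langle>$\<rangle> z) = c z" for z
    using xy by (cases "z = x"; cases "z = y") auto
  have tJ: "apply ?t ` J = J"
    using xy by (auto simp: apply_swap transpose_def image_iff Bex_def)
  have mem: "?t * w \<in> ?S" if "w \<in> ?S" for w
  proof -
    have "apply (?t * w) ` J = J"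
      using that tJ by (metis (mono_tags, lifting) apply_times image_comp mem_Collect_eq)
    then show ?thesis
      using that t by (auto simp: Sym_mult fixes_coloring_def apply_times ct)
  qed
  have sg: "sign (restrict_perm (?t * w) J) = - sign (restrict_perm w J)" if "w \<in> ?S" for w
  proof -
    have wJ: "w \<langle>$\<rangle> z \<in> J" if "z \<in> J" for z using that \<open>w \<in> ?S\<close> by blast
    have "restrict_perm (?t * w) J = transpose x y \<circ> restrict_perm w J"
      using xy by (auto simp: restrict_perm_def apply_times apply_swap transpose_def)
    moreover have "permutation (restrict_perm w J)"
      using that J by (intro permutes_imp_permutation[of J] restrict_perm_permutes)
          (auto intro: finite_subset)
    ultimately show ?thesis
      using xy by (simp add: sign_compose sign_swap_id permutation_swap_id)
  qed
  have "(\<Sum>w \<in> ?S. sign (restrict_perm w J)) = (\<Sum>w \<in> ?S. sign (restrict_perm (?t * w) J))"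
  proof (rule sum.reindex_bij_witness[where i = "\<lambda>w. ?t * w" and j = "\<lambda>w. ?t * w"])
    show "?t * (?t * w) = w" for w by (simp flip: mult.assoc)
    show "?t * (?t * w) = w" for w by (simp flip: mult.assoc)
  qed (use mem sg in auto)
  also have "\<dots> = - (\<Sum>w \<in> ?S. sign (restrict_perm w J))"
    by (simp add: sg sum_negf)
  finally show ?thesis by simp
qed

text \<open>A permutation that preserves the colours and maps \<open>J\<close> to itself must fix
  \<open>J\<close> pointwise, as the colours on \<open>J\<close> are distinct. All signs are
  therefore 1, and the permutations concerned form the stabilizer of the colouring refined by
  membership in \<open>J\<close>.\<close>

lemma sum_sign_stabilizer_inj:
  assumes J: "J \<subseteq> {..<n}" and inj: "inj_on c J"
  shows "(\<Sum>w | w \<in> Sym n \<and> fixes_coloring n w c \<and> apply w ` J = J. sign (restrict_perm w J)) =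
    int (card {w \<in> Sym n. fixes_coloring n w (\<lambda>x \<in> {..<n}. (c x, x \<in> J))})"
proof -
  have fixed: "w \<langle>$\<rangle> x = x" if "w \<in> Sym n" "fixes_coloring n w c" "apply w ` J = J" "x \<in> J" for w x
  proof (rule inj_onD[OF inj])
    show "w \<langle>$\<rangle> x \<in> J" using that by blast
    show "c (w \<langle>$\<rangle> x) = c x" using that J by (auto simp: fixes_coloring_def)
  qed fact
  have "{w. w \<in> Sym n \<and> fixes_coloring n w c \<and> apply w ` J = J} =
      {w \<in> Sym n. fixes_coloring n w (\<lambda>x \<in> {..<n}. (c x, x \<in> J))}"
  proof (rule Set.set_eqI, rule iffI)
    fix w assume w: "w \<in> {w. w \<in> Sym n \<and> fixes_coloring n w c \<and> apply w ` J = J}"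
    have "w \<langle>$\<rangle> x \<in> J \<longleftrightarrow> x \<in> J" for x
      using w by (metis (mono_tags, lifting) apply_inj image_iff mem_Collect_eq)
    then show "w \<in> {w \<in> Sym n. fixes_coloring n w (\<lambda>x \<in> {..<n}. (c x, x \<in> J))}"
      using w by (auto simp: fixes_coloring_def Sym_less)
  next
    fix w assume w: "w \<in> {w \<in> Sym n. fixes_coloring n w (\<lambda>x \<in> {..<n}. (c x, x \<in> J))}"
    then have inv: "c (w \<langle>$\<rangle> x) = c x" "w \<langle>$\<rangle> x \<in> J \<longleftrightarrow> x \<in> J" if "x < n" for x
      using that by (auto simp: fixes_coloring_def Sym_less)
    have sub: "apply w ` J \<subseteq> J" using inv J by auto
    have "apply w ` J = J"
      by (rule endo_inj_surj[OF finite_subset[OF J] sub]) (auto simp: inj_on_def apply_inj)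
    then show "w \<in> {w. w \<in> Sym n \<and> fixes_coloring n w c \<and> apply w ` J = J}"
      using w inv by (auto simp: fixes_coloring_def)
  qed
  moreover have "sign (restrict_perm w J) = 1"
    if "w \<in> {w. w \<in> Sym n \<and> fixes_coloring n w c \<and> apply w ` J = J}" for w
  proof -
    have "restrict_perm w J = id" using that fixed by (auto simp: restrict_perm_def)
    then show ?thesis by simp
  qed
  ultimately show ?thesis by simp
qed

text \<open>
  The content of a colouring of content \<open>g\<close> refined
      by a set that contains one point of each colour in
  \<open>T\<close> and no others.
\<close>
definition marked :: "('c \<Rightarrow> int) \<Rightarrow> 'c set \<Rightarrow> 'c \<times> bool \<Rightarrow> int" where
  "marked g T = (\<lambda>(k, b). if k \<in> T then (if b then 1 else g k - 1) else (if b then 0 else g k))"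

text \<open>Each colour class splits into its points inside and outside \<open>J\<close>;
  injectivity puts exactly one point inside when the colour occurs on \<open>J\<close>.\<close>

lemma mark_coloring:
  assumes c: "c \<in> colorings n g" and J: "J \<subseteq> {..<n}" and inj: "inj_on c J"
  shows "(\<lambda>x \<in> {..<n}. (c x, x \<in> J)) \<in> colorings n (marked g (c ` J))"
proof -
  let ?d = "\<lambda>x \<in> {..<n}. (c x, x \<in> J)"
  have t: "int (card {x. x < n \<and> ?d x = (k, True)}) = (if k \<in> c ` J then 1 else 0)" for k
  proof (cases "k \<in> c ` J")
    case True
    then obtain x where x: "x \<in> J" "c x = k" by auto
    have "{x. x < n \<and> ?d x = (k, True)} = {x}"
      using x J inj by (auto simp: inj_on_def)
    then show ?thesis using True by simp
  next
    case False
    have "{x. x < n \<and> ?d x = (k, True)} = {}" using False by auto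
    then show ?thesis using False by (simp del: restrict_apply)
  qed
  have tot: "g k = int (card {x. x < n \<and> ?d x = (k, True)}) +
      int (card {x. x < n \<and> ?d x = (k, False)})" for k
  proof -
    have "g k = int (card {x. x < n \<and> c x = k})" using c by (simp add: colorings_def)
    also have "{x. x < n \<and> c x = k} = {x. x < n \<and> ?d x = (k, True)} \<union> {x. x < n \<and> ?d x =
        (k, False)}"
      by auto
    also have "card \<dots> = card {x. x < n \<and> ?d x = (k, True)} + card {x. x < n \<and> ?d x = (k, False)}"
      by (rule card_Un_disjoint) auto
    finally show ?thesis by simp
  qed
  have "int (card {x. x < n \<and> ?d x = kb}) = marked g (c ` J) kb" for kb
  proof (cases kb)
    case (Pair k b)
    then show ?thesis using t[of k] tot[of k] by (cases b) (auto simp: marked_def split: if_splits)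
  qed
  then show ?thesis by (simp add: colorings_def)
qed

text \<open>The inverse passage: first components recover the colouring, second components the
  marked points, and the counts 0 and 1 in \<open>marked\<close> force one marked point for each
  colour in \<open>T\<close>.\<close>

lemma unmark_coloring:
  assumes d: "d \<in> colorings n (marked g T)" and T: "T \<subseteq> {k. g k \<noteq> 0}"
  defines "c \<equiv> \<lambda>x \<in> {..<n}. fst (d x)" and "J \<equiv> {x. x < n \<and> snd (d x)}"
  shows "c \<in> colorings n g" "inj_on c J" "c ` J = T" "(\<lambda>x \<in> {..<n}. (c x, x \<in> J)) = d"
proof -
  have cd: "int (card {x. x < n \<and> d x = kb}) = marked g T kb" for kb
    using d by (cases kb) (simp add: colorings_def)
  have "int (card {x. x < n \<and> c x = k}) = g k" for k
  proof -
    have "{x. x < n \<and> c x = k} = {x. x < n \<and> d x = (k, True)} \<union> {x. x < n \<and> d x = (k, False)}"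
      by (auto simp: c_def prod_eq_iff)
    also have "card \<dots> = card {x. x < n \<and> d x = (k, True)} + card {x. x < n \<and> d x = (k, False)}"
      by (rule card_Un_disjoint) auto
    finally show ?thesis using cd[of "(k, True)"] cd[of "(k, False)"] by (auto simp: marked_def)
  qed
  then show "c \<in> colorings n g"
    by (auto simp: colorings_def c_def)
  have one: "{x \<in> J. c x = k} = {x. x < n \<and> d x = (k, True)}" for k
    by (auto simp: J_def c_def prod_eq_iff)
  have cc: "card {x \<in> J. c x = k} = (if k \<in> T then 1 else 0)" for k
    unfolding one using cd[of "(k, True)"] by (auto simp: marked_def split: if_splits)
  show "inj_on c J"
  proof (rule inj_onI)
    fix x y assume xy: "x \<in> J" "y \<in> J" "c x = c y"
    have "card {z \<in> J. c z = c x} \<le> 1" by (simp add: cc)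
    moreover have "finite {z \<in> J. c z = c x}" by (simp add: J_def)
    ultimately show "x = y"
      using xy by (auto simp: card_le_Suc0_iff_eq)
  qed
  have "k \<in> c ` J \<longleftrightarrow> k \<in> T" for k
  proof -
    have "k \<in> c ` J \<longleftrightarrow> {x \<in> J. c x = k} \<noteq> {}" by auto
    also have "\<dots> \<longleftrightarrow> card {x \<in> J. c x = k} \<noteq> 0"
      by (subst card_0_eq) (auto simp: J_def)
    also have "\<dots> \<longleftrightarrow> k \<in> T" by (simp add: cc)
    finally show ?thesis .
  qed
  then show "c ` J = T" by auto
  show "(\<lambda>x \<in> {..<n}. (c x, x \<in> J)) = d"
    using d by (auto simp: fun_eq_iff c_def J_def colorings_def PiE_arb[of d "{..<n}"])
qed

lemma sum_swap_dep:
  assumes "finite A" "finite B"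
  shows "(\<Sum>w \<in> A. \<Sum>c | c \<in> B \<and> P w c. f w c) = (\<Sum>c \<in> B. \<Sum>w | w \<in> A \<and> P w c. f w c)"
proof -
  have "(\<Sum>w \<in> A. \<Sum>c | c \<in> B \<and> P w c. f w c) = (\<Sum>w \<in> A. \<Sum>c \<in> B. if P w c then f w c else 0)"
    using assms by (simp add: sum.If_cases Int_def)
  also have "\<dots> = (\<Sum>c \<in> B. \<Sum>w \<in> A. if P w c then f w c else 0)"
    by (rule sum.swap)
  also have "\<dots> = (\<Sum>c \<in> B. \<Sum>w | w \<in> A \<and> P w c. f w c)"
    using assms by (simp add: sum.If_cases Int_def)
  finally show ?thesis .
qed

text \<open>The left side is a sum over triples of a permutation, a colouring \<open>c\<close> and a
  set \<open>J\<close>, both kept by the permutation. For fixed \<open>c\<close> and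
  \<open>J\<close> the signs cancel unless \<open>c\<close> is injective on \<open>J\<close>. The
  surviving pairs are the colourings refined by a set \<open>T\<close> of marked colours; for each
  \<open>T\<close> they form one orbit and contribute the group order, which leaves the sum of
  \<open>(- q) ^ card T\<close> over the sets \<open>T\<close> of colours in use.\<close>

lemma sum_fixed_colorings_ext_char:
  fixes q :: "'a::comm_ring_1"
  assumes ne: "colorings n g \<noteq> {}"
  shows "(\<Sum>w \<in> Sym n. of_nat (fixed_colorings n g w) * ext_char n q w) =
    of_nat (card (Sym n)) * (1 - q) ^ card {k. g k \<noteq> 0}"
proof -
  let ?K = "{k. g k \<noteq> 0}"
  let ?D = "colorings n g \<times> Pow {..<n}"
  let ?st = "\<lambda>c J. {w \<in> Sym n. fixes_coloring n w (\<lambda>x \<in> {..<n}. (c x, x \<in> J))}"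
  have finK: "finite ?K" using ne by (auto simp: colorings_range)
  have "(\<Sum>w \<in> Sym n. of_nat (fixed_colorings n g w) * ext_char n q w) =
      (\<Sum>w \<in> Sym n. \<Sum>p | p \<in> ?D \<and> (fixes_coloring n w (fst p) \<and> apply w ` snd p = snd p).
        (- q) ^ card (snd p) * of_int (sign (restrict_perm w (snd p))))"
  proof (rule sum.cong[OF refl])
    fix w
    have eq: "{p. p \<in> ?D \<and> (fixes_coloring n w (fst p) \<and> apply w ` snd p = snd p)} =
        {c \<in> colorings n g. fixes_coloring n w c} \<times> inv_sets n w"
      by (auto simp: inv_sets_def)
    show "of_nat (fixed_colorings n g w) * ext_char n q w =
        (\<Sum>p | p \<in> ?D \<and> (fixes_coloring n w (fst p) \<and> apply w ` snd p = snd p).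
        (- q) ^ card (snd p) * of_int (sign (restrict_perm w (snd p))))"
      unfolding eq by (simp add: fixed_colorings_def ext_char_def sum.cartesian_product' )
  qed
  also have "\<dots> = (\<Sum>p \<in> ?D. \<Sum>w | w \<in> Sym n \<and> (fixes_coloring n w (fst p) \<and> apply w ` snd p = snd p).
        (- q) ^ card (snd p) * of_int (sign (restrict_perm w (snd p))))"
    by (rule sum_swap_dep) (auto simp: finite_Sym)
  also have "\<dots> = (\<Sum>p \<in> ?D. (- q) ^ card (snd p) *
      of_int (if inj_on (fst p) (snd p) then int (card (?st (fst p) (snd p))) else 0))"
  proof (rule sum.cong[OF refl])
    fix p assume "p \<in> ?D"
    then obtain c J where p: "p = (c, J)" and J: "J \<subseteq> {..<n}" by auto
    have "(\<Sum>w | w \<in> Sym n \<and> (fixes_coloring n w c \<and> apply w ` J = J). sign (restrict_perm w J)) =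
        (if inj_on c J then int (card (?st c J)) else 0)"
      using sum_sign_stabilizer_inj[OF J, of c] sum_sign_stabilizer_zero[OF J, of _ _ c]
      by (auto simp: inj_on_def)
    then show "(\<Sum>w | w \<in> Sym n \<and> (fixes_coloring n w (fst p) \<and> apply w ` snd p = snd p).
        (- q) ^ card (snd p) * of_int (sign (restrict_perm w (snd p)))) = (- q) ^ card (snd p) *
      of_int (if inj_on (fst p) (snd p) then int (card (?st (fst p) (snd p))) else 0)"
      unfolding p fst_conv snd_conv by (simp flip: sum_distrib_left of_int_sum)
  qed
  also have "\<dots> = (\<Sum>p | p \<in> ?D \<and> inj_on (fst p) (snd p).
      (- q) ^ card (snd p) * of_nat (card (?st (fst p) (snd p))))"
    by (subst sum.inter_filter) (auto intro!: sum.cong)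
  also have "\<dots> = (\<Sum>p \<in> (SIGMA T:Pow ?K. colorings n (marked g T)).
      (- q) ^ card (fst p) * of_nat (card {w \<in> Sym n. fixes_coloring n w (snd p)}))"
  proof (rule sum.reindex_bij_witness[where
        j = "\<lambda>p. (fst p ` snd p, \<lambda>x \<in> {..<n}. (fst p x, x \<in> snd p))" and
        i = "\<lambda>p. (\<lambda>x \<in> {..<n}. fst (snd p x), {x. x < n \<and> snd (snd p x)})"])
    fix p assume "p \<in> {p. p \<in> ?D \<and> inj_on (fst p) (snd p)}"
    then obtain c J where p: "p = (c, J)" and c: "c \<in> colorings n g" and J: "J \<subseteq> {..<n}"
        and inj: "inj_on c J"
      by auto
    have "(\<lambda>x\<in>{..<n}. fst ((\<lambda>x\<in>{..<n}. (c x, x \<in> J)) x)) = c"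
      using c by (auto simp: fun_eq_iff colorings_def PiE_arb[of c "{..<n}"])
    moreover have "{x. x < n \<and> snd ((\<lambda>x\<in>{..<n}. (c x, x \<in> J)) x)} = J"
      using J by auto
    ultimately show "(\<lambda>x\<in>{..<n}. fst (snd (fst p ` snd p, \<lambda>x\<in>{..<n}. (fst p x, x \<in> snd p)) x),
          {x. x < n \<and> snd (snd (fst p ` snd p, \<lambda>x\<in>{..<n}. (fst p x, x \<in> snd p)) x)}) = p"
      by (simp add: p)
    show "(fst p ` snd p, \<lambda>x\<in>{..<n}. (fst p x, x \<in> snd p)) \<in>
        (SIGMA T:Pow ?K. colorings n (marked g T))"
      using mark_coloring[OF c J inj] J by (auto simp: p colorings_range[OF c])
    show "(- q) ^ card (fst (fst p ` snd p, \<lambda>x\<in>{..<n}. (fst p x, x \<in> snd p))) *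
         of_nat (card {w \<in> Sym n. fixes_coloring n w
             (snd (fst p ` snd p, \<lambda>x\<in>{..<n}. (fst p x, x \<in> snd p)))}) =
         (- q) ^ card (snd p) * of_nat (card (?st (fst p) (snd p)))"
      by (simp add: p card_image inj)
  next
    fix p assume "p \<in> (SIGMA T:Pow ?K. colorings n (marked g T))"
    then obtain T d where p: "p = (T, d)" and T: "T \<subseteq> ?K" and d: "d \<in> colorings n (marked g T)"
        by auto
    note u = unmark_coloring[OF d T]
    show "(fst (\<lambda>x\<in>{..<n}. fst (snd p x), {x. x < n \<and> snd (snd p x)}) `
          snd (\<lambda>x\<in>{..<n}. fst (snd p x), {x. x < n \<and> snd (snd p x)}),
          \<lambda>x\<in>{..<n}. (fst (\<lambda>x\<in>{..<n}. fst (snd p x), {x. x < n \<and> snd (snd p x)}) x,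
             x \<in> snd (\<lambda>x\<in>{..<n}. fst (snd p x), {x. x < n \<and> snd (snd p x)}))) = p"
      using u(3,4) unfolding p fst_conv snd_conv by simp
    show "(\<lambda>x\<in>{..<n}. fst (snd p x), {x. x < n \<and> snd (snd p x)}) \<in> {p. p \<in> ?D \<and>
        inj_on (fst p) (snd p)}"
      using u(1,2) unfolding p fst_conv snd_conv by auto
  qed
  also have "\<dots> = (\<Sum>T \<in> Pow ?K. \<Sum>d \<in> colorings n (marked g T).
      (- q) ^ card T * of_nat (card {w \<in> Sym n. fixes_coloring n w d}))"
    by (subst sum.Sigma) (auto simp: finK case_prod_unfold)
  also have "\<dots> = (\<Sum>T \<in> Pow ?K. (- q) ^ card T * of_nat (card (Sym n)))"
  proof (rule sum.cong[OF refl])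
    fix T assume T: "T \<in> Pow ?K"
    obtain c where c: "c \<in> colorings n g" using ne by auto
    \<comment> \<open>One point of each colour in \<open>T\<close> gives a set \<open>J\<close> that
      realises the marked content, so that the orbit is nonempty.\<close>
    have "T \<subseteq> c ` {..<n}" using T by (auto simp flip: colorings_range[OF c])
    then obtain J where J: "J \<subseteq> {..<n}" "inj_on c J" "T = c ` J"
      by (meson subset_image_inj)
    have "colorings n (marked g T) \<noteq> {}"
      using mark_coloring[OF c J(1,2)] J(3) by auto
    then have "(\<Sum>w \<in> Sym n. fixed_colorings n (marked g T) w) = card (Sym n)"
      by (rule sum_fixed_colorings)
    moreover have "(\<Sum>w \<in> Sym n. fixed_colorings n (marked g T) w) =
        (\<Sum>d \<in> colorings n (marked g T). card {w \<in> Sym n. fixes_coloring n w d})"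
      using sum_swap_dep[where A = "Sym n" and B = "colorings n (marked g T)" and P =
          "fixes_coloring n"
          and f = "\<lambda>_ _. 1 :: nat"]
      by (simp add: fixed_colorings_def finite_Sym)
    ultimately show "(\<Sum>d \<in> colorings n (marked g T).
      (- q) ^ card T * of_nat (card {w \<in> Sym n. fixes_coloring n w d})) =
          (- q) ^ card T * of_nat (card (Sym n))"
      by (simp flip: sum_distrib_left of_nat_sum)
  qed
  also have "\<dots> = of_nat (card (Sym n)) * (1 - q) ^ card ?K"
  proof -
    have "(1 - q) ^ card ?K = (\<Prod>k \<in> ?K. - q + 1)" by simp
    also have "\<dots> = (\<Sum>T \<in> Pow ?K. (- q) ^ card T)"
      using prod_add[OF finK, of "\<lambda>_. - q" "\<lambda>_. 1"] by (simp del: add_uminus_conv_diff)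
    finally show ?thesis by (simp add: sum_distrib_left mult.commute)
  qed
  finally show ?thesis .
qed


section \<open>The Koszul identity for traces\<close>

lemma sign_cycle_of_list: "distinct cs \<Longrightarrow> sign (cycle_of_list cs) = (- 1) ^ (length cs - 1)"
proof (induction cs rule: cycle_of_list.induct)
  case (1 i j cs)
  then have "sign (cycle_of_list (j # cs)) = (- 1) ^ length cs" by simp
  then show ?case
    using 1(2) unfolding cycle_of_list.simps
    by (subst sign_compose) (auto simp: permutation_swap_id permutation_of_cycle sign_swap_id)
qed (auto simp: sign_id)

text \<open>Up to the power of q this is the contribution of \<open>J\<close> to
  \<open>ext_char\<close>. For invariant \<open>J\<close> it is (-1) to the number of cycles of
  \<open>w\<close> in \<open>J\<close>: a cycle of length k contributes (-1)^k through the size and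
  (-1)^(k-1) through the sign.\<close>

definition signed_sub :: "nat perm \<Rightarrow> nat set \<Rightarrow> int" where
  "signed_sub w J = (- 1) ^ card J * sign (restrict_perm w J)"

lemma signed_sub_Un:
  assumes "finite J" "finite C" "J \<inter> C = {}" "apply w ` J = J" "apply w ` C = C"
  shows "signed_sub w (J \<union> C) = signed_sub w J * signed_sub w C"
proof -
  have *: "w \<langle>$\<rangle> x \<in> C" if "x \<in> C" for x using that assms by blast
  have "restrict_perm w (J \<union> C) = restrict_perm w J \<circ> restrict_perm w C"
    using assms(3) * by (auto simp: restrict_perm_def fun_eq_iff)
  moreover have "permutation (restrict_perm w J)" "permutation (restrict_perm w C)"
    using assms by (auto intro!: permutes_imp_permutation[OF _ restrict_perm_permutes])
  ultimately show ?thesis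
    using assms by (simp add: signed_sub_def sign_compose card_Un_disjoint power_add)
qed

lemma signed_sub_cycle:
  assumes "C = set (support (apply w) x)"
  shows "apply w ` C = C" "x \<in> C" "signed_sub w C = - 1"
proof -
  note per = permutation_apply[of w]
  let ?cs = "support (apply w) x"
  have C: "C = range (\<lambda>i. (apply w ^^ i) x)"
    unfolding assms by (rule support_set[OF per])
  show xC: "x \<in> C" unfolding C by (rule range_eqI[of _ _ 0]) simp
  have "apply w ` C \<subseteq> C"
  proof (rule image_subsetI)
    fix y assume "y \<in> C"
    then obtain i where "y = (apply w ^^ i) x" unfolding C by auto
    then show "w \<langle>$\<rangle> y \<in> C" unfolding C by (intro range_eqI[of _ _ "Suc i"]) simp
  qed
  moreover have "finite C" by (simp add: assms)
  ultimately show "apply w ` C = C"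
    by (intro endo_inj_surj) (auto simp: inj_on_def apply_inj)
  have d: "distinct ?cs" by (rule cycle_of_permutation[OF per])
  have "restrict_perm w C = cycle_of_list ?cs"
  proof
    fix y
    show "restrict_perm w C y = cycle_of_list ?cs y"
      using cycle_restrict[OF per, of y x] id_outside_supp[of y ?cs]
      by (auto simp: restrict_perm_def assms)
  qed
  moreover have len: "length ?cs = card C" unfolding assms using d
      by (rule distinct_card[symmetric])
  moreover have "card C > 0" using xC \<open>finite C\<close> by (auto simp: card_gt_0_iff)
  ultimately have "signed_sub w C = (- 1) ^ card C * (- 1) ^ (card C - 1)"
    unfolding signed_sub_def using sign_cycle_of_list[OF d] by (simp only:)
  also have "\<dots> = - 1"
    using \<open>card C > 0\<close> by (cases "card C") (simp_all flip: power_add)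
  finally show "signed_sub w C = - 1" .
qed

text \<open>
  Adding or removing a fixed cycle reverses the sign.
\<close>
lemma sum_signed_sub:
  assumes K: "finite K" "apply w ` K = K" "K \<noteq> {}"
  shows "(\<Sum>J | J \<subseteq> K \<and> apply w ` J = J. signed_sub w J) = 0"
proof -
  obtain x where x: "x \<in> K" using K by auto
  define C where "C = set (support (apply w) x)"
  note C = signed_sub_cycle[OF C_def]
  have Crange: "C = range (\<lambda>i. (apply w ^^ i) x)"
    unfolding C_def by (rule support_set[OF permutation_apply])
  have pow: "(apply w ^^ i) y \<in> J \<longleftrightarrow> y \<in> J" if "apply w ` J = J" for i y J
  proof -
    have "w \<langle>$\<rangle> z \<in> J \<longleftrightarrow> z \<in> J" for z
      using that by (metis apply_inj image_iff)
    then show ?thesis by (induction i) auto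
  qed
  have dich: "C \<subseteq> J \<or> C \<inter> J = {}" if "apply w ` J = J" for J
    using pow[OF that] by (auto simp: Crange)
  have CK: "C \<subseteq> K" using dich[OF K(2)] x C(2) by auto
  let ?S = "{J. J \<subseteq> K \<and> apply w ` J = J}"
  define t where "t = (\<lambda>J. (J - C) \<union> (C - J))"
  have fin: "finite J" if "J \<in> ?S" for J using that K(1) finite_subset by auto
  have tS: "t J \<in> ?S \<and> signed_sub w (t J) = - signed_sub w J" if J: "J \<in> ?S" for J
  proof (cases "C \<subseteq> J")
    case True
    then have t: "t J = J - C" by (auto simp: t_def)
    have im: "apply w ` (J - C) = J - C"
      using J C(1) by (subst image_set_diff) (auto simp: inj_def apply_inj)
    have "J = (J - C) \<union> C" using True by auto
    then have "signed_sub w J = signed_sub w (J - C) * signed_sub w C"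
      using signed_sub_Un[of "J - C" C w] im C(1) fin[OF J] finite_subset[OF CK K(1)] by auto
    then show ?thesis using J im by (auto simp: t C(3))
  next
    case False
    then have dis: "C \<inter> J = {}" using dich J by auto
    then have t: "t J = J \<union> C" by (auto simp: t_def)
    have "signed_sub w (J \<union> C) = signed_sub w J * signed_sub w C"
      using J C(1) fin[OF J] finite_subset[OF CK K(1)] dis by (intro signed_sub_Un) auto
    then show ?thesis using J CK C(1) by (simp add: t C(3) image_Un)
  qed
  have "(\<Sum>J \<in> ?S. signed_sub w J) = (\<Sum>J \<in> ?S. signed_sub w (t J))"
    by (rule sum.reindex_bij_witness[where i = t and j = t]) (use tS in \<open>auto simp: t_def\<close>)
  also have "\<dots> = - (\<Sum>J \<in> ?S. signed_sub w J)"
    using tS by (simp add: sum_negf)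
  finally show ?thesis by simp
qed

text \<open>Monomials are permuted among themselves, so the number of these is the trace of
  \<open>w\<close> on the degree-\<open>d\<close> part of the polynomial ring.\<close>

definition inv_mons :: "nat \<Rightarrow> nat perm \<Rightarrow> nat \<Rightarrow> mon set" where
  "inv_mons n w d = {m. Poly_Mapping.keys m \<subseteq> {..<n} \<and> mact w m = m \<and> mdeg m = d}"

lemma finite_mons: "finite {m. Poly_Mapping.keys m \<subseteq> {..<n} \<and> mdeg m = d}"
proof -
  have "Poly_Mapping.lookup ` {m. Poly_Mapping.keys m \<subseteq> {..<n} \<and> mdeg m = d} \<subseteq>
      {f. \<forall>i. (i \<in> {..<n} \<longrightarrow> f i \<in> {..d}) \<and> (i \<notin> {..<n} \<longrightarrow> f i = 0)}"
  proof (clarsimp, intro conjI impI)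
    fix m :: mon and i
    assume m: "Poly_Mapping.keys m \<subseteq> {..<n}" "d = mdeg m"
    show "Poly_Mapping.lookup m i \<le> mdeg m" if "i < n"
      using that mdeg_superset[OF _ m(1)] by (simp add: member_le_sum)
    show "Poly_Mapping.lookup m i = 0" if "\<not> i < n"
      using m that by (auto simp: in_keys_iff subset_iff)
  qed
  moreover have "finite {f :: nat \<Rightarrow> nat. \<forall>i. (i \<in> {..<n} \<longrightarrow> f i \<in> {..d}) \<and> (i \<notin> {..<n} \<longrightarrow> f i = 0)}"
    by (rule finite_set_of_finite_funs) auto
  ultimately have "finite (Poly_Mapping.lookup ` {m. Poly_Mapping.keys m \<subseteq> {..<n} \<and> mdeg m = d})"
    by (rule finite_subset)
  then show ?thesis
    by (rule finite_imageD) (simp add: inj_on_def poly_mapping.lookup_inject)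
qed

lemma finite_inv_mons [simp]: "finite (inv_mons n w d)"
  by (rule finite_subset[OF _ finite_mons[of n d]]) (auto simp: inv_mons_def)

definition indic :: "nat set \<Rightarrow> mon" where
  "indic J = (\<Sum>j \<in> J. Poly_Mapping.single j 1)"

lemma lookup_indic: "finite J \<Longrightarrow> Poly_Mapping.lookup (indic J) i = (if i \<in> J then 1 else 0)"
  by (simp add: indic_def lookup_sum lookup_single when_def)

lemma mdeg_indic: "finite J \<Longrightarrow> mdeg (indic J) = card J"
  by (subst mdeg_superset[of J]) (auto simp: lookup_indic in_keys_iff split: if_splits)

lemma mact_indic:
  assumes "finite J" "apply w ` J = J" shows "mact w (indic J) = indic J"
proof (rule poly_mapping_eqI)
  fix i
  have "inverse w \<langle>$\<rangle> i \<in> J \<longleftrightarrow> i \<in> J"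
    using assms(2) by (metis apply_inj apply_inverse_perm image_iff)
  then show "Poly_Mapping.lookup (mact w (indic J)) i = Poly_Mapping.lookup (indic J) i"
    by (simp add: lookup_indic assms)
qed

text \<open>A pair of an invariant set \<open>J\<close> and an invariant monomial \<open>m\<close>
  is recorded as the product monomial \<open>M = m + indic J\<close> together with \<open>J\<close>,
  a subset of the support of \<open>M\<close>. This is the grading of the Koszul complex by
  monomials, and for each \<open>M\<close> it leaves a sum over \<open>J\<close> alone.\<close>

lemma inv_mons_split:
  "(\<Sum>J \<in> inv_sets n w. if card J \<le> D then f J * of_nat (card (inv_mons n w (D - card J))) else 0) =
    (\<Sum>M \<in> inv_mons n w D. \<Sum>J | J \<subseteq> Poly_Mapping.keys M \<and> apply w ` J = J. (f J :: 'a::comm_ring_1))"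
proof -
  have finJ: "finite J" if "J \<in> inv_sets n w" for J
    using that finite_subset[of J "{..<n}"] by (auto simp: inv_sets_def)
  have sub: "{J. J \<subseteq> Poly_Mapping.keys M \<and> apply w ` J = J} =
      {J \<in> inv_sets n w. J \<subseteq> Poly_Mapping.keys M}" if "M \<in> inv_mons n w D" for M
    using that by (auto simp: inv_mons_def inv_sets_def)
  have "(\<Sum>J \<in> inv_sets n w. if card J \<le> D then f J * of_nat (card (inv_mons n w (D - card J)))
      else 0) =
      (\<Sum>J \<in> inv_sets n w. \<Sum>m \<in> (if card J \<le> D then inv_mons n w (D - card J) else {}). f J)"
    by (rule sum.cong) auto
  also have "\<dots> = (\<Sum>p \<in> (SIGMA J:inv_sets n w.
      if card J \<le> D then inv_mons n w (D - card J) else {}). f (fst p))"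
    by (subst sum.Sigma) (auto simp: case_prod_unfold)
  also have "\<dots> = (\<Sum>p \<in> (SIGMA M:inv_mons n w D. {J \<in> inv_sets n w. J \<subseteq> Poly_Mapping.keys M}).
      f (snd p))"
  proof (rule sum.reindex_bij_witness[where i = "\<lambda>(M, J). (J, M - indic J)" and j =
      "\<lambda>(J, m). (m + indic J, J)"])
    fix p assume "p \<in> (SIGMA J:inv_sets n w. if card J \<le> D then inv_mons n w (D - card J) else {})"
    then obtain J m where p: "p = (J, m)" and J: "J \<in> inv_sets n w" and le: "card J \<le> D"
        and m: "m \<in> inv_mons n w (D - card J)"
      by (auto split: if_splits)
    have "Poly_Mapping.keys (m + indic J) \<subseteq> {..<n}"
      using m J finJ[OF J] by (auto simp: inv_mons_def inv_sets_def in_keys_iff subset_iff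
          lookup_add lookup_indic split: if_splits)
    moreover have "J \<subseteq> Poly_Mapping.keys (m + indic J)"
      using finJ[OF J] by (auto simp: in_keys_iff lookup_add lookup_indic)
    moreover have "mact w (m + indic J) = m + indic J"
      using m J finJ[OF J] by (simp add: mact_add mact_indic inv_mons_def inv_sets_def)
    ultimately show "(case p of (J, m) \<Rightarrow> (m + indic J, J)) \<in>
        (SIGMA M:inv_mons n w D. {J \<in> inv_sets n w. J \<subseteq> Poly_Mapping.keys M})"
      using J m le finJ[OF J] by (simp add: p inv_mons_def mdeg_add mdeg_indic)
    show "(case case p of (J, m) \<Rightarrow> (m + indic J, J) of (M, J) \<Rightarrow> (J, M - indic J)) = p"
      by (simp add: p)
  next
    fix p assume "p \<in> (SIGMA M:inv_mons n w D. {J \<in> inv_sets n w. J \<subseteq> Poly_Mapping.keys M})"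
    then obtain M J where p: "p = (M, J)" and M: "M \<in> inv_mons n w D" and J: "J \<in> inv_sets n w"
        and JM: "J \<subseteq> Poly_Mapping.keys M"
      by auto
    have eq: "M - indic J + indic J = M"
    proof (rule poly_mapping_eqI)
      fix i show "Poly_Mapping.lookup (M - indic J + indic J) i = Poly_Mapping.lookup M i"
        using JM finJ[OF J] by (auto simp: lookup_add lookup_minus lookup_indic in_keys_iff
            subset_iff)
    qed
    have deg: "mdeg M = mdeg (M - indic J) + card J"
      by (subst eq[symmetric], subst mdeg_add) (simp add: mdeg_indic finJ[OF J])
    have "mact w (M - indic J) + indic J = mact w (M - indic J + indic J)"
      using J finJ[OF J] by (simp add: mact_add mact_indic inv_sets_def)
    also have "\<dots> = M - indic J + indic J" using M by (simp add: eq inv_mons_def)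
    finally have "mact w (M - indic J) = M - indic J" by simp
    moreover have "Poly_Mapping.keys (M - indic J) \<subseteq> {..<n}"
      using M by (auto simp: inv_mons_def in_keys_iff subset_iff lookup_minus)
    ultimately show "(case p of (M, J) \<Rightarrow> (J, M - indic J)) \<in>
        (SIGMA J:inv_sets n w. if card J \<le> D then inv_mons n w (D - card J) else {})"
      using M J deg by (auto simp: p inv_mons_def)
    show "(case case p of (M, J) \<Rightarrow> (J, M - indic J) of (J, m) \<Rightarrow> (m + indic J, J)) = p"
      by (simp add: p eq)
  qed (auto split: prod.splits)
  also have "\<dots> = (\<Sum>M \<in> inv_mons n w D. \<Sum>J | J \<in> inv_sets n w \<and> J \<subseteq> Poly_Mapping.keys M. f J)"
    by (subst sum.Sigma) (auto simp: case_prod_unfold)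
  also have "\<dots> = (\<Sum>M \<in> inv_mons n w D. \<Sum>J | J \<subseteq> Poly_Mapping.keys M \<and> apply w ` J = J. f J)"
    by (rule sum.cong[OF refl]) (simp add: sub)
  finally show ?thesis .
qed

text \<open>Sorted by the product monomial \<open>M\<close>, the product consists of the alternating
  sums treated in \<open>sum_signed_sub\<close>, taken over the invariant subsets of the support of
  \<open>M\<close>. They vanish except for \<open>M = 0\<close>, just as the Koszul complex is exact
  except in degree 0.\<close>

lemma ext_char_sym_char:
  "ext_char n fps_X w * Abs_fps (\<lambda>d. of_nat (card (inv_mons n w d))) = (1 :: 'a::comm_ring_1 fps)"
proof (rule fps_ext)
  fix D
  let ?F = "Abs_fps (\<lambda>d. of_nat (card (inv_mons n w d))) :: 'a fps"
  have summand: "fps_nth ((- fps_X) ^ card J * of_int (sign (restrict_perm w J)) * ?F) D =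
      (if card J \<le> D then of_int (signed_sub w J) * of_nat (card (inv_mons n w (D - card J))) else
          0)" for J
  proof -
    have "(- fps_X) ^ card J * of_int (sign (restrict_perm w J)) * ?F =
        fps_const (of_int (signed_sub w J)) * (fps_X ^ card J * ?F)"
      by (simp add: signed_sub_def power_minus[of fps_X] fps_of_int flip: fps_const_mult
          fps_const_power fps_const_neg)
    then show ?thesis by (simp add: fps_X_power_mult_nth)
  qed
  have "fps_nth (ext_char n fps_X w * ?F) D =
      (\<Sum>J \<in> inv_sets n w. if card J \<le> D then of_int (signed_sub w J) * of_nat
          (card (inv_mons n w (D - card J))) else 0)"
    unfolding ext_char_def sum_distrib_right fps_sum_nth by (simp only: summand)
  also have "\<dots> = (\<Sum>M \<in> inv_mons n w D. of_int (\<Sum>J | J \<subseteq> Poly_Mapping.keys M \<and> apply w ` J =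
      J. signed_sub w J))"
    unfolding inv_mons_split by simp
  also have "\<dots> = (\<Sum>M \<in> inv_mons n w D. if M = 0 then 1 else 0)"
  proof (rule sum.cong[OF refl])
    fix M assume M: "M \<in> inv_mons n w D"
    show "of_int (\<Sum>J | J \<subseteq> Poly_Mapping.keys M \<and> apply w ` J = J. signed_sub w J) =
        (if M = 0 then 1 else 0 :: 'a)"
    proof (cases "M = 0")
      case True
      have "{J. J \<subseteq> {} \<and> apply w ` J = J} = {{}}" by auto
      moreover have "restrict_perm w {} = id" by (auto simp: restrict_perm_def)
      ultimately show ?thesis using True by (simp add: signed_sub_def)
    next
      case False
      have "apply w ` Poly_Mapping.keys M = Poly_Mapping.keys M"
        using M by (simp add: inv_mons_def flip: keys_mact)
      then show ?thesis using False sum_signed_sub[of "Poly_Mapping.keys M" w] by simp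
    qed
  qed
  also have "\<dots> = fps_nth 1 D"
  proof -
    have "0 \<in> inv_mons n w D \<longleftrightarrow> D = 0" by (auto simp: inv_mons_def mdeg_def)
    then show ?thesis by (simp add: sum.delta)
  qed
  finally show "fps_nth (ext_char n fps_X w * ?F) D = fps_nth 1 D" .
qed


section \<open>Products of permutation characters and matrices with given margins\<close>

definition col_content :: "nat \<Rightarrow> (nat \<Rightarrow> 'c) \<Rightarrow> 'c \<Rightarrow> int" where
  "col_content n c k = int (card {x. x < n \<and> c x = k})"

lemma colorings_content: "colorings n g = {c \<in> {..<n} \<rightarrow>\<^sub>E UNIV. col_content n c = g}"
  by (auto simp: colorings_def col_content_def fun_eq_iff)

lemma content_cong: "(\<And>x. x < n \<Longrightarrow> c x = d x) \<Longrightarrow> col_content n c = col_content n d"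
  unfolding col_content_def by (intro ext arg_cong[of _ _ int] arg_cong[of _ _ card]) auto

lemma content_mset: "col_content n c k = int (count (image_mset c (mset_set {..<n})) k)"
  by (simp add: col_content_def count_image_mset vimage_def Int_def conj_commute)

lemma content_comp:
  assumes "col_content n c = col_content n d" shows "col_content n (f \<circ> c) = col_content n (f \<circ> d)"
proof -
  have "image_mset c (mset_set {..<n}) = image_mset d (mset_set {..<n})"
    by (rule multiset_eqI) (use assms in \<open>simp add: fun_eq_iff content_mset\<close>)
  then have "image_mset (f \<circ> c) (mset_set {..<n}) = image_mset (f \<circ> d) (mset_set {..<n})"
    by (simp flip: multiset.map_comp)
  then show ?thesis by (simp add: fun_eq_iff content_mset)
qed

lemma content_fst:
  assumes "finite K" "(\<lambda>x. snd (c x)) ` {..<n} \<subseteq> K"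
  shows "col_content n (fst \<circ> c) i = (\<Sum>k \<in> K. col_content n c (i, k))"
proof -
  have "(\<Sum>k \<in> K. sum (\<lambda>_. 1 :: int) {x \<in> {x. x < n \<and> fst (c x) = i}. snd (c x) = k}) =
      sum (\<lambda>_. 1) {x. x < n \<and> fst (c x) = i}"
    using assms by (intro sum.group) auto
  moreover have "{x \<in> {x. x < n \<and> fst (c x) = i}. snd (c x) = k} = {x. x < n \<and> c x = (i, k)}" for k
    by (auto simp: prod_eq_iff)
  ultimately show ?thesis by (simp add: col_content_def)
qed

lemma content_snd:
  assumes "finite K" "(\<lambda>x. fst (c x)) ` {..<n} \<subseteq> K"
  shows "col_content n (snd \<circ> c) k = (\<Sum>i \<in> K. col_content n c (i, k))"
proof -
  have "(\<Sum>i \<in> K. sum (\<lambda>_. 1 :: int) {x \<in> {x. x < n \<and> snd (c x) = k}. fst (c x) = i}) =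
      sum (\<lambda>_. 1) {x. x < n \<and> snd (c x) = k}"
    using assms by (intro sum.group) auto
  moreover have "{x \<in> {x. x < n \<and> snd (c x) = k}. fst (c x) = i} = {x. x < n \<and> c x = (i, k)}" for i
    by (auto simp: prod_eq_iff)
  ultimately show ?thesis by (simp add: col_content_def)
qed

lemma colorings_nonempty:
  fixes g :: "'c \<Rightarrow> int"
  assumes "\<And>k. g k \<ge> 0" and fin: "finite K" and K: "\<And>k. k \<notin> K \<Longrightarrow> g k = 0"
      and n: "(\<Sum>k \<in> K. g k) = int n"
  shows "colorings n g \<noteq> {}"
proof -
  define M where "M = (\<Sum>k \<in> K. replicate_mset (nat (g k)) k)"
  have count: "int (count M k) = g k" for k
    using assms(1) K[of k] fin by (auto simp: M_def count_sum sum.delta)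
  have "int (size M) = (\<Sum>k \<in> K. g k)"
    unfolding M_def using assms(1) by simp
  then have size: "size M = n" using n by simp
  obtain xs where xs: "mset xs = M" using ex_mset by auto
  then have len: "length xs = n" using size by (metis size_mset)
  define c where "c = (\<lambda>x \<in> {..<n}. xs ! x)"
  have "int (card {x. x < n \<and> c x = k}) = g k" for k
  proof -
    have "{x. x < n \<and> c x = k} = {x. x < length xs \<and> k = xs ! x}" by (auto simp: c_def len)
    then have "card {x. x < n \<and> c x = k} = count (mset xs) k"
      by (simp only: count_mset count_list_eq_length_filter length_filter_conv_card)
    then show ?thesis using xs count by simp
  qed
  then have "c \<in> colorings n g" by (auto simp: colorings_def c_def)
  then show ?thesis by auto
qed

text \<open>For margins of total \<open>n\<close>, these are the nonnegative integer matrices with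
  row sums \<open>b\<close> and column sums \<open>a\<close>. They are presented as contents of
  colourings by pairs so that every element is realised by a colouring, as averaging its permutation
  character requires.\<close>

definition margins :: "nat \<Rightarrow> ('b \<Rightarrow> int) \<Rightarrow> ('c \<Rightarrow> int) \<Rightarrow> ('b \<times> 'c \<Rightarrow> int) set" where
  "margins n b a = col_content n ` {c \<in> {..<n} \<rightarrow>\<^sub>E UNIV. col_content n (fst \<circ> c) = b \<and>
      col_content n (snd \<circ> c) = a}"

lemma pair_colorings:
  fixes b :: "'b \<Rightarrow> int" and a :: "'c \<Rightarrow> int"
  shows "bij_betw (\<lambda>(c, d). \<lambda>x \<in> {..<n}. (c x, d x)) (colorings n b \<times> colorings n a)
    {c \<in> {..<n} \<rightarrow>\<^sub>E UNIV. col_content n (fst \<circ> c) = b \<and> col_content n (snd \<circ> c) = a}"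
proof (rule bij_betw_byWitness[where f' = "\<lambda>c. (\<lambda>x \<in> {..<n}. fst (c x), \<lambda>x \<in> {..<n}. snd (c x))"])
  show "\<forall>p \<in> colorings n b \<times> colorings n a.
      (\<lambda>c. (\<lambda>x \<in> {..<n}. fst (c x), \<lambda>x \<in> {..<n}. snd (c x)))
          ((\<lambda>(c, d). \<lambda>x \<in> {..<n}. (c x, d x)) p) = p"
  proof (clarify, intro conjI)
    fix c :: "nat \<Rightarrow> 'b" and d :: "nat \<Rightarrow> 'c" assume "c \<in> colorings n b" "d \<in> colorings n a"
    then have "restrict c {..<n} = c" "restrict d {..<n} = d" 
      unfolding colorings_def by (blast intro: PiE_restrict)+
    moreover have "(\<lambda>x \<in> {..<n}. fst ((\<lambda>x \<in> {..<n}. (c x, d x)) x)) = restrict c {..<n}"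
      "(\<lambda>x \<in> {..<n}. snd ((\<lambda>x \<in> {..<n}. (c x, d x)) x)) = restrict d {..<n}"
      by (auto intro!: restrict_ext)
    ultimately show "(\<lambda>x \<in> {..<n}. fst ((\<lambda>x \<in> {..<n}. (c x, d x)) x)) = c"
      "(\<lambda>x \<in> {..<n}. snd ((\<lambda>x \<in> {..<n}. (c x, d x)) x)) = d" by simp_all
  qed
  show "\<forall>c \<in> {c \<in> {..<n} \<rightarrow>\<^sub>E UNIV. col_content n (fst \<circ> c) = b \<and> col_content n (snd \<circ> c) = a}.
      (\<lambda>(c, d). \<lambda>x \<in> {..<n}. (c x, d x)) (\<lambda>x \<in> {..<n}. fst (c x), \<lambda>x \<in> {..<n}. snd (c x)) = c"
  proof
    fix c :: "nat \<Rightarrow> 'b \<times> 'c"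
    assume "c \<in> {c \<in> {..<n} \<rightarrow>\<^sub>E UNIV. col_content n (fst \<circ> c) = b \<and> col_content n (snd \<circ> c) = a}"
    then have "restrict c {..<n} = c" by (blast intro: PiE_restrict)
    moreover have "(\<lambda>x \<in> {..<n}. ((\<lambda>x \<in> {..<n}. fst (c x)) x, (\<lambda>x \<in> {..<n}. snd (c x)) x)) =
        restrict c {..<n}"
      by (auto intro!: restrict_ext)
    ultimately show "(\<lambda>(c, d). \<lambda>x \<in> {..<n}. (c x, d x))
        (\<lambda>x \<in> {..<n}. fst (c x), \<lambda>x \<in> {..<n}. snd (c x)) = c"
      by simp
  qed
  have "col_content n (fst \<circ> (\<lambda>x \<in> {..<n}. (c x, d x))) = col_content n c"
    "col_content n (snd \<circ> (\<lambda>x \<in> {..<n}. (c x, d x))) = col_content n d" for c :: "nat \<Rightarrow> 'b"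
        and d :: "nat \<Rightarrow> 'c"
    by (auto intro!: content_cong)
  then show "(\<lambda>(c, d). \<lambda>x \<in> {..<n}. (c x, d x)) ` (colorings n b \<times> colorings n a) \<subseteq>
      {c \<in> {..<n} \<rightarrow>\<^sub>E UNIV. col_content n (fst \<circ> c) = b \<and> col_content n (snd \<circ> c) = a}"
    unfolding colorings_content by (intro image_subsetI) (clarsimp simp del: split_paired_All)
  have "col_content n (\<lambda>x \<in> {..<n}. fst (c x)) = col_content n (fst \<circ> c)"
    "col_content n (\<lambda>x \<in> {..<n}. snd (c x)) = col_content n (snd \<circ> c)" for c :: "nat \<Rightarrow> 'b \<times> 'c"
    by (auto intro!: content_cong)
  then show "(\<lambda>c. (\<lambda>x \<in> {..<n}. fst (c x), \<lambda>x \<in> {..<n}. snd (c x))) `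
      {c \<in> {..<n} \<rightarrow>\<^sub>E UNIV. col_content n (fst \<circ> c) = b \<and> col_content n (snd \<circ> c) = a} \<subseteq>
          colorings n b \<times> colorings n a"
    unfolding colorings_content by (intro image_subsetI) simp
qed

lemma finite_margin_colorings:
  "finite {c \<in> {..<n} \<rightarrow>\<^sub>E UNIV. col_content n (fst \<circ> c) = b \<and> col_content n (snd \<circ> c) = a}"
  by (rule bij_betw_finite[OF pair_colorings, THEN iffD1]) simp

lemma finite_margins [simp]: "finite (margins n b a)"
  unfolding margins_def using finite_margin_colorings by (rule finite_imageI)

lemma filter_image: "{y \<in> f ` X. P y} = f ` {x \<in> X. P (f x)}"
  by auto

text \<open>The product counts pairs of fixed colourings, and a pair is one colouring by pairs,
  fixed exactly when both components are. Sorting by the joint content gives the decomposition,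
  which is Mackey's formula for Young subgroups.\<close>

lemma fixed_colorings_mult:
  assumes w: "w \<in> Sym n"
  shows "fixed_colorings n b w * fixed_colorings n a w =
      (\<Sum>g \<in> margins n b a. fixed_colorings n g w)"
proof -
  let ?C = "{c \<in> {..<n} \<rightarrow>\<^sub>E UNIV. col_content n (fst \<circ> c) = b \<and> col_content n (snd \<circ> c) = a}"
  have inv: "fixes_coloring n w (\<lambda>x \<in> {..<n}. (c x, d x)) \<longleftrightarrow> fixes_coloring n w c \<and>
      fixes_coloring n w d" for c :: "nat \<Rightarrow> 'a" and d :: "nat \<Rightarrow> 'b"
    using w by (auto simp: fixes_coloring_def Sym_less)
  have img: "(\<lambda>(c, d). \<lambda>x \<in> {..<n}. (c x, d x)) `
      ({c \<in> colorings n b. fixes_coloring n w c} \<times> {c \<in> colorings n a. fixes_coloring n w c})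
      = {c \<in> ?C. fixes_coloring n w c}" (is "?h ` ?A = ?B")
  proof -
    have "?h ` (colorings n b \<times> colorings n a) = ?C" using pair_colorings
        by (rule bij_betw_imp_surj_on)
    then have "{c \<in> ?C. fixes_coloring n w c} =
        ?h ` {p \<in> colorings n b \<times> colorings n a. fixes_coloring n w (?h p)}"
      using filter_image[of ?h "colorings n b \<times> colorings n a" "fixes_coloring n w"] by (simp only:)
    also have "{p \<in> colorings n b \<times> colorings n a. fixes_coloring n w (?h p)} = ?A"
      by (auto simp: inv)
    finally show ?thesis ..
  qed
  have inj: "inj_on ?h ?A"
    by (rule inj_on_subset[OF bij_betw_imp_inj_on[OF pair_colorings]]) auto
  have "card ?A = card ?B"
    using card_image[OF inj] unfolding img by (rule sym)
  then have "fixed_colorings n b w * fixed_colorings n a w = card ?B"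
    by (simp add: fixed_colorings_def card_cartesian_product)
  also have "?B = (\<Union>g \<in> margins n b a. {c \<in> colorings n g. fixes_coloring n w c})"
  proof (rule Set.set_eqI, rule iffI)
    fix c assume "c \<in> (\<Union>g \<in> margins n b a. {c \<in> colorings n g. fixes_coloring n w c})"
    then obtain d where d: "col_content n (fst \<circ> d) = b" "col_content n (snd \<circ> d) = a"
        "col_content n c = col_content n d"
      and c: "c \<in> {..<n} \<rightarrow>\<^sub>E UNIV" "fixes_coloring n w c"
      by (auto simp: margins_def colorings_content)
    show "c \<in> ?B"
      using c d content_comp[OF d(3), of fst] content_comp[OF d(3), of snd] by auto
  next
    fix c assume c: "c \<in> ?B"
    show "c \<in> (\<Union>g \<in> margins n b a. {c \<in> colorings n g. fixes_coloring n w c})"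
    proof (rule UN_I)
      show "col_content n c \<in> margins n b a" unfolding margins_def using c by blast
      show "c \<in> {d \<in> colorings n (col_content n c). fixes_coloring n w d}"
        using c by (simp add: colorings_content)
    qed
  qed
  also have "card \<dots> = (\<Sum>g \<in> margins n b a. card {c \<in> colorings n g. fixes_coloring n w c})"
    by (rule card_UN_disjoint) (simp_all, auto simp: colorings_content)
  finally show ?thesis by (simp add: fixed_colorings_def)
qed

text \<open>The same matrices stored by rows, each row as an exponent vector; \<open>m\<close> holds
  the column sums and \<open>b\<close> the row sums. In this form they index the terms of a product
  of \<open>l\<close> homogeneous series, and a negative \<open>b i\<close> leaves none.\<close>

definition row_decs :: "nat \<Rightarrow> (nat \<Rightarrow> int) \<Rightarrow> mon \<Rightarrow> (nat \<Rightarrow> mon) set" where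
  "row_decs l b m = {A \<in> {..<l} \<rightarrow>\<^sub>E UNIV. (\<Sum>i<l. A i) = m \<and> (\<forall>i<l. int (mdeg (A i)) = b i)}"

definition row_matrix :: "nat \<Rightarrow> (nat \<Rightarrow> mon) \<Rightarrow> nat \<times> nat \<Rightarrow> int" where
  "row_matrix l A = (\<lambda>(i, k). if i < l then int (Poly_Mapping.lookup (A i) k) else 0)"

lemma lookup_sum_rows:
  assumes "A \<in> row_decs l b m"
  shows "Poly_Mapping.lookup m k = (\<Sum>i<l. Poly_Mapping.lookup (A i) k)"
  using assms by (auto simp: row_decs_def simp flip: lookup_sum)

lemma keys_row:
  assumes "A \<in> row_decs l b m" "i < l"
  shows "Poly_Mapping.keys (A i) \<subseteq> Poly_Mapping.keys m"
  using assms(2) by (auto simp: in_keys_iff lookup_sum_rows[OF assms(1)])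

lemma mdeg_sum: "mdeg (\<Sum>i \<in> I. f i) = (\<Sum>i \<in> I. mdeg (f i))"
proof (induction I rule: infinite_finite_induct)
  case (insert i I)
  then show ?case by (simp add: mdeg_add)
qed (simp_all add: mdeg_def)

text \<open>The entries are nonnegative with total \<open>n\<close>, so some colouring has the
  matrix as its content; this colouring witnesses membership in \<open>margins\<close>.\<close>

lemma row_matrix_margins:
  assumes A: "A \<in> row_decs l b m" and m: "mdeg m = n" and b: "\<And>i. \<not> i < l \<Longrightarrow> b i = 0"
  shows "row_matrix l A \<in> margins n b (\<lambda>k. int (Poly_Mapping.lookup m k))"
proof -
  let ?K = "{..<l} \<times> Poly_Mapping.keys m"
  let ?g = "row_matrix l A"
  have row: "(\<Sum>k \<in> Poly_Mapping.keys m. ?g (i, k)) = b i" for i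
  proof (cases "i < l")
    case True
    have "int (mdeg (A i)) = b i" using A True by (auto simp: row_decs_def)
    then show ?thesis
      using True mdeg_superset[OF _ keys_row[OF A True]] by (simp add: row_matrix_def)
  qed (auto simp: b row_matrix_def)
  have zero: "?g p = 0" if "p \<notin> ?K" for p
  proof (cases p)
    case (Pair i k)
    then show ?thesis
      using that keys_row[OF A, of i] by (cases "i < l")
          (auto simp: row_matrix_def simp flip: not_in_keys_iff_lookup_eq_zero)
  qed
  have "(\<Sum>p \<in> ?K. ?g p) = (\<Sum>i<l. b i)"
    by (simp add: row sum.cartesian_product')
  also have "\<dots> = (\<Sum>i<l. int (mdeg (A i)))"
    using A by (intro sum.cong) (auto simp: row_decs_def)
  also have "\<dots> = int n"
    using A m by (auto simp: row_decs_def mdeg_sum)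
  finally have "colorings n ?g \<noteq> {}"
    using zero by (intro colorings_nonempty[of _ ?K]) (auto simp: row_matrix_def split: prod.splits)
  then obtain c where c: "c \<in> colorings n ?g" by auto
  then have ct: "col_content n c = ?g" by (simp add: colorings_content)
  have "c ` {..<n} \<subseteq> ?K" using colorings_range[OF c] zero by fastforce
  then have sub: "(\<lambda>x. snd (c x)) ` {..<n} \<subseteq> Poly_Mapping.keys m"
      "(\<lambda>x. fst (c x)) ` {..<n} \<subseteq> {..<l}"
    by (auto simp: image_subset_iff mem_Times_iff)
  have "col_content n (fst \<circ> c) = b"
    by (rule ext) (simp add: content_fst[OF _ sub(1)] ct row)
  moreover have "col_content n (snd \<circ> c) = (\<lambda>k. int (Poly_Mapping.lookup m k))"
    by (rule ext) (simp add: content_snd[OF _ sub(2)] ct row_matrix_def lookup_sum_rows[OF A])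
  ultimately show ?thesis
    using c ct by (auto simp: margins_def colorings_def intro!: image_eqI[of _ _ c])
qed

lemma margins_row_matrix:
  assumes g: "g \<in> margins n b (\<lambda>k. int (Poly_Mapping.lookup m k))" and b: "\<And>i. \<not> i < l \<Longrightarrow> b i = 0"
  obtains A where "A \<in> row_decs l b m" "row_matrix l A = g"
proof -
  obtain c where c: "col_content n (fst \<circ> c) = b"
      "col_content n (snd \<circ> c) = (\<lambda>k. int (Poly_Mapping.lookup m k))" "g = col_content n c"
    using g by (auto simp: margins_def)
  let ?L = "(\<lambda>x. snd (c x)) ` {..<n}"
  define A where "A = (\<lambda>i \<in> {..<l}. Abs_poly_mapping (\<lambda>k. nat (g (i, k))))"
  have g0: "g (i, k) = 0" if "k \<notin> ?L" for i k
  proof -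
    have "{x. x < n \<and> c x = (i, k)} = {}" using that by force
    then show ?thesis by (simp add: c(3) col_content_def)
  qed
  have "{k. nat (g (i, k)) \<noteq> 0} \<subseteq> ?L" for i using g0[of _ i]
      by (metis (mono_tags, lifting) mem_Collect_eq nat_0 subsetI)
  then have "finite {k. nat (g (i, k)) \<noteq> 0}" for i
    by (rule finite_subset) simp
  then have lk: "Poly_Mapping.lookup (A i) k = nat (g (i, k))" if "i < l" for i k
    using that by (simp add: A_def)
  have pos: "g p \<ge> 0" for p by (simp add: c(3) col_content_def)
  have rows: "(\<lambda>x. fst (c x)) ` {..<n} \<subseteq> {..<l}"
  proof (rule image_subsetI)
    fix x assume x: "x \<in> {..<n}"
    have "col_content n (fst \<circ> c) (fst (c x)) \<noteq> 0"
      using x by (auto simp: col_content_def card_eq_0_iff)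
    then show "fst (c x) \<in> {..<l}" using b[of "fst (c x)"] c(1) by auto
  qed
  have "g (i, k) = 0" if "\<not> i < l" for i k
  proof -
    have "{x. x < n \<and> c x = (i, k)} = {}" using that rows by force
    then show ?thesis by (simp add: c(3) col_content_def)
  qed
  then have "row_matrix l A = g"
    by (auto simp: row_matrix_def fun_eq_iff lk pos)
  moreover have "(\<Sum>i<l. A i) = m"
  proof (rule poly_mapping_eqI)
    fix k
    have "int (Poly_Mapping.lookup (\<Sum>i<l. A i) k) = (\<Sum>i<l. g (i, k))"
      by (simp add: lookup_sum lk pos)
    also have "\<dots> = col_content n (snd \<circ> c) k"
      by (simp add: content_snd[OF _ rows] c(3))
    finally show "Poly_Mapping.lookup (\<Sum>i<l. A i) k = Poly_Mapping.lookup m k"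
      by (simp add: c(2))
  qed
  moreover have "int (mdeg (A i)) = b i" if "i < l" for i
  proof -
    have "Poly_Mapping.keys (A i) \<subseteq> ?L" using that g0 by (force simp: in_keys_iff lk)
    then have "int (mdeg (A i)) = (\<Sum>k \<in> ?L. g (i, k))"
      using that by (subst mdeg_superset[of ?L]) (auto simp: lk pos)
    also have "\<dots> = col_content n (fst \<circ> c) i"
      by (subst content_fst[of ?L]) (auto simp: c(3))
    finally show ?thesis by (simp add: c(1))
  qed
  ultimately show ?thesis
    by (intro that[of A]) (auto simp: row_decs_def A_def)
qed

lemma row_matrix_bij:
  assumes m: "mdeg m = n" and b: "\<And>i. \<not> i < l \<Longrightarrow> b i = 0"
  shows "bij_betw (row_matrix l) (row_decs l b m) (margins n b (\<lambda>k. int (Poly_Mapping.lookup m k)))"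
  unfolding bij_betw_def
proof (intro conjI)
  show "inj_on (row_matrix l) (row_decs l b m)"
  proof (rule inj_onI)
    fix A B assume A: "A \<in> row_decs l b m" and B: "B \<in> row_decs l b m"
        and eq: "row_matrix l A = row_matrix l B"
    have "A i = B i" if "i < l" for i
    proof (rule poly_mapping_eqI)
      fix k show "Poly_Mapping.lookup (A i) k = Poly_Mapping.lookup (B i) k"
        using fun_cong[OF eq, of "(i, k)"] that by (simp add: row_matrix_def)
    qed
    then show "A = B"
      using A B by (intro PiE_ext[of A "{..<l}" "\<lambda>_. UNIV" B]) (auto simp: row_decs_def)
  qed
  show "row_matrix l ` row_decs l b m = margins n b (\<lambda>k. int (Poly_Mapping.lookup m k))"
  proof (rule Set.set_eqI, rule iffI)
    fix g assume "g \<in> margins n b (\<lambda>k. int (Poly_Mapping.lookup m k))"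
    then obtain A where "A \<in> row_decs l b m" "row_matrix l A = g"
      by (rule margins_row_matrix) (rule b)
    then show "g \<in> row_matrix l ` row_decs l b m" by auto
  qed (use row_matrix_margins[OF _ m b] in auto)
qed

lemma finite_row_decs [simp]: "finite (row_decs l b m)"
proof -
  \<comment> \<open>Rows from \<open>l\<close> on are not seen by \<open>row_decs\<close>; setting
    them to zero makes the bijection with the margins applicable.\<close>
  let ?b = "\<lambda>i. if i < l then b i else 0"
  have "row_decs l b m = row_decs l ?b m" by (auto simp: row_decs_def)
  then show ?thesis
    using bij_betw_finite[OF row_matrix_bij[of m "mdeg m" l ?b]] by simp
qed

text \<open>The product formula reduces this to averages over single matrices, each worth 1 - q to
  the number of its nonzero entries. Counting these entries row by row turns the power into a
  product, in which the factor of \<open>A i\<close> is the coefficient of that monomial in q_r,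
  with r its degree.\<close>

lemma sum_fixed_colorings_product_ext_char:
  fixes q :: "'a::comm_ring_1"
  assumes m: "mdeg m = n" and b: "\<And>i. \<not> i < l \<Longrightarrow> b i = 0"
  shows "(\<Sum>w \<in> Sym n. of_nat (fixed_colorings n b w) * of_nat
      (fixed_colorings n (\<lambda>k. int (Poly_Mapping.lookup m k)) w) * ext_char n q w) =
    of_nat (card (Sym n)) * (\<Sum>A \<in> row_decs l b m. \<Prod>i<l. (1 - q) ^ card (Poly_Mapping.keys (A i)))"
proof -
  let ?a = "\<lambda>k. int (Poly_Mapping.lookup m k)"
  have "(\<Sum>w \<in> Sym n. of_nat (fixed_colorings n b w) * of_nat (fixed_colorings n ?a w) * ext_char n
      q w) =
      (\<Sum>w \<in> Sym n. \<Sum>g \<in> margins n b ?a. of_nat (fixed_colorings n g w) * ext_char n q w)"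
  proof (rule sum.cong[OF refl])
    fix w assume "w \<in> Sym n"
    from fixed_colorings_mult[OF this, of b ?a]
    show "of_nat (fixed_colorings n b w) * of_nat (fixed_colorings n ?a w) * ext_char n q w =
        (\<Sum>g \<in> margins n b ?a. of_nat (fixed_colorings n g w) * ext_char n q w)"
      by (simp flip: of_nat_mult of_nat_sum sum_distrib_right)
  qed
  also have "\<dots> = (\<Sum>g \<in> margins n b ?a. \<Sum>w \<in> Sym n. of_nat (fixed_colorings n g w) * ext_char n q w)"
    by (rule sum.swap)
  also have "\<dots> = (\<Sum>g \<in> margins n b ?a. of_nat (card (Sym n)) * (1 - q) ^ card {k. g k \<noteq> 0})"
  proof (rule sum.cong[OF refl], rule sum_fixed_colorings_ext_char)
    fix g assume "g \<in> margins n b ?a"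
    then obtain c where "c \<in> {..<n} \<rightarrow>\<^sub>E UNIV" "g = col_content n c" by (auto simp: margins_def)
    then have "c \<in> colorings n g" by (simp add: colorings_content)
    then show "colorings n g \<noteq> {}" by auto
  qed
  also have "\<dots> = (\<Sum>A \<in> row_decs l b m. of_nat (card (Sym n)) * (1 - q) ^ card
      {k. row_matrix l A k \<noteq> 0})"
    using sum.reindex_bij_betw[OF row_matrix_bij[where l = l and b = b, OF m b]] by (rule sym)
  also have "\<dots> = (\<Sum>A \<in> row_decs l b m. of_nat (card (Sym n)) *
      (\<Prod>i<l. (1 - q) ^ card (Poly_Mapping.keys (A i))))"
  proof (rule sum.cong[OF refl])
    fix A
    have "{k. row_matrix l A k \<noteq> 0} = (SIGMA i:{..<l}. Poly_Mapping.keys (A i))"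
      by (auto simp: row_matrix_def in_keys_iff split: if_splits)
    then show "of_nat (card (Sym n)) * (1 - q) ^ card {k. row_matrix l A k \<noteq> 0} =
        of_nat (card (Sym n)) * (\<Prod>i<l. (1 - q) ^ card (Poly_Mapping.keys (A i)))"
      by (simp add: power_sum)
  qed
  finally show ?thesis by (simp add: sum_distrib_left)
qed

text \<open>The case q = 0, where only the empty set contributes to \<open>ext_char\<close>. It is
  the classical pairing of two products of complete symmetric functions.\<close>

lemma sum_fixed_colorings_product:
  assumes m: "mdeg m = n" and b: "\<And>i. \<not> i < l \<Longrightarrow> b i = 0"
  shows "(\<Sum>w \<in> Sym n. int (fixed_colorings n b w) * int
      (fixed_colorings n (\<lambda>k. int (Poly_Mapping.lookup m k)) w)) =
    int (card (Sym n)) * int (card (row_decs l b m))"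
proof -
  have "ext_char n (0 :: int) w = 1" for w
  proof -
    have "ext_char n (0 :: int) w = (\<Sum>J \<in> inv_sets n w. if J = {} then 1 else 0)"
      unfolding ext_char_def
    proof (rule sum.cong[OF refl])
      fix J assume "J \<in> inv_sets n w"
      then have "finite J" by (auto simp: inv_sets_def intro: finite_subset)
      moreover have "restrict_perm w {} = id" by (auto simp: restrict_perm_def)
      ultimately show "(- 0) ^ card J * of_int (sign (restrict_perm w J)) =
          (if J = {} then 1 else (0 :: int))"
        by (auto simp: card_gt_0_iff)
    qed
    then show ?thesis by (auto simp: inv_sets_def)
  qed
  then show ?thesis using sum_fixed_colorings_product_ext_char[where q = "0 :: int", OF m b] by simp
qed


section \<open>The Jacobi--Trudi identity\<close>

text \<open>The coefficient of x^m in the determinant of the complete symmetric functions h_(v_i +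
  j). An arbitrary integer vector \<open>v\<close>, and not only a shifted partition, makes room for
  row exchanges and for the vectors met when a variable is removed.\<close>

definition jt_sum :: "nat \<Rightarrow> (nat \<Rightarrow> int) \<Rightarrow> mon \<Rightarrow> int" where
  "jt_sum l v m = (\<Sum>p | p permutes {..<l}. sign p * int
      (card (row_decs l (\<lambda>i. v i + int (p i)) m)))"

lemma row_decs_cong: "(\<And>i. i < l \<Longrightarrow> b i = b' i) \<Longrightarrow> row_decs l b m = row_decs l b' m"
  by (auto simp: row_decs_def)

lemma jt_sum_cong:
  assumes "\<And>i. i < l \<Longrightarrow> v i = v' i" shows "jt_sum l v m = jt_sum l v' m"
proof -
  have "row_decs l (\<lambda>i. v i + int (p i)) m = row_decs l (\<lambda>i. v' i + int (p i)) m" for p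
    by (rule row_decs_cong) (simp add: assms)
  then show ?thesis by (simp add: jt_sum_def)
qed

lemma card_row_decs_permute:
  assumes t: "t permutes {..<l}"
  shows "card (row_decs l (b \<circ> t) m) = card (row_decs l b m)"
proof -
  have i: "t i < l \<longleftrightarrow> i < l" for i using permutes_in_image[OF t, of i] by simp
  have i': "inv_into UNIV t i < l \<longleftrightarrow> i < l" for i
      using permutes_in_image[OF permutes_inv[OF t], of i] by simp
  have s: "(\<Sum>i<l. f (s i)) = (\<Sum>i<l. f i)" if "s permutes {..<l}" for f :: "nat \<Rightarrow> mon" and s
    using sum.permute[OF that, of f] by (simp add: comp_def)
  show ?thesis
  proof (rule bij_betw_same_card, rule bij_betw_byWitness[where f' =
      "\<lambda>A. \<lambda>i \<in> {..<l}. A (t i)" and f = "\<lambda>A. \<lambda>i \<in> {..<l}. A (inv_into UNIV t i)"])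
    show "\<forall>A \<in> row_decs l (b \<circ> t) m. (\<lambda>i \<in> {..<l}. (\<lambda>i \<in> {..<l}. A (inv_into UNIV t i)) (t i)) = A"
      "\<forall>A \<in> row_decs l b m. (\<lambda>i \<in> {..<l}. (\<lambda>i \<in> {..<l}. A (t i)) (inv_into UNIV t i)) = A"
      using permutes_inverses[OF t] by (auto simp: row_decs_def fun_eq_iff i i' PiE_iff
          extensional_def)
    show "(\<lambda>A. \<lambda>i \<in> {..<l}. A (inv_into UNIV t i)) ` row_decs l (b \<circ> t) m \<subseteq> row_decs l b m"
      using permutes_inverses[OF t] s[OF permutes_inv[OF t]] by (auto simp: row_decs_def i')
    show "(\<lambda>A. \<lambda>i \<in> {..<l}. A (t i)) ` row_decs l b m \<subseteq> row_decs l (b \<circ> t) m"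
      using s[OF t] by (auto simp: row_decs_def i)
  qed
qed

text \<open>The determinant alternates in its rows: reindexing by \<open>p \<circ> t\<close>
  permutes each content, which leaves the number of matrices unchanged.\<close>

lemma jt_sum_permute:
  assumes t: "t permutes {..<l}"
  shows "jt_sum l (v \<circ> t) m = sign t * jt_sum l v m"
proof -
  have "jt_sum l (v \<circ> t) m =
      (\<Sum>p | p permutes {..<l}. sign (p \<circ> t) * int
          (card (row_decs l (\<lambda>i. (v \<circ> t) i + int ((p \<circ> t) i)) m)))"
    unfolding jt_sum_def by (rule sum_permutations_compose_right[OF t])
  also have "\<dots> = (\<Sum>p | p permutes {..<l}. sign t *
      (sign p * int (card (row_decs l (\<lambda>i. v i + int (p i)) m))))"
  proof (rule sum.cong[OF refl])
    fix p assume "p \<in> {p. p permutes {..<l}}"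
    then have "sign (p \<circ> t) = sign p * sign t"
      using t by (auto intro!: sign_compose permutes_imp_permutation[of "{..<l}"])
    moreover have "(\<lambda>i. (v \<circ> t) i + int ((p \<circ> t) i)) = (\<lambda>i. v i + int (p i)) \<circ> t" by auto
    ultimately show "sign (p \<circ> t) * int (card (row_decs l (\<lambda>i. (v \<circ> t) i + int ((p \<circ> t) i)) m)) =
        sign t * (sign p * int (card (row_decs l (\<lambda>i. v i + int (p i)) m)))"
      using card_row_decs_permute[OF t, of "\<lambda>i. v i + int (p i)" m] by simp
  qed
  finally show ?thesis by (simp add: jt_sum_def sum_distrib_left)
qed

definition compositions :: "nat \<Rightarrow> nat \<Rightarrow> (nat \<Rightarrow> nat) set" where
  "compositions l k = {c \<in> {..<l} \<rightarrow>\<^sub>E UNIV. (\<Sum>i<l. c i) = k}"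

lemma finite_compositions [simp]: "finite (compositions l k)"
proof (rule finite_subset)
  show "compositions l k \<subseteq> {..<l} \<rightarrow>\<^sub>E {..k}"
  proof
    fix c assume c: "c \<in> compositions l k"
    then have "c i \<le> k" if "i < l" for i
      using that member_le_sum[of i "{..<l}" c] by (auto simp: compositions_def)
    then show "c \<in> {..<l} \<rightarrow>\<^sub>E {..k}"
      using c by (auto simp: compositions_def PiE_def)
  qed
qed (simp add: finite_PiE)

text \<open>Splitting off one variable from each factor: h_r in the larger set of variables is the
  sum of x_N^c h_(r-c) in the smaller one. Here \<open>c i\<close> is the exponent of x_N taken from
  row \<open>i\<close>.\<close>

lemma row_decs_peel:
  assumes N: "Poly_Mapping.lookup m N = 0"
  shows "card (row_decs l b (m + Poly_Mapping.single N k)) =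
    (\<Sum>c \<in> compositions l k. card (row_decs l (\<lambda>i. b i - int (c i)) m))"
proof -
  let ?s = "Poly_Mapping.single N :: nat \<Rightarrow> mon"
  let ?j = "\<lambda>A. (\<lambda>i \<in> {..<l}. Poly_Mapping.lookup (A i) N, \<lambda>i \<in> {..<l}.
      A i - ?s (Poly_Mapping.lookup (A i) N))"
  let ?i = "\<lambda>p. \<lambda>i \<in> {..<l}. snd p i + ?s (fst p i)"
  have s: "a - ?s (Poly_Mapping.lookup a N) + ?s (Poly_Mapping.lookup a N) = a" for a
    by (rule poly_mapping_eqI) (auto simp: lookup_add lookup_minus lookup_single when_def)
  have deg: "mdeg (?s x) = x" for x by (simp add: mdeg_def)
  have ms: "mdeg (a - ?s (Poly_Mapping.lookup a N)) + Poly_Mapping.lookup a N = mdeg a" for a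
    using arg_cong[OF s[of a], of mdeg] by (simp add: mdeg_add deg)
  have sumsingle: "(\<Sum>i<l. ?s (f i)) = ?s (\<Sum>i<l. f i)" for f
    by (rule poly_mapping_eqI) (auto simp: lookup_sum lookup_single when_def)
  have "bij_betw ?j (row_decs l b (m + ?s k))
      (SIGMA c:compositions l k. row_decs l (\<lambda>i. b i - int (c i)) m)"
  proof (rule bij_betw_byWitness[where f' = ?i])
    show "\<forall>A \<in> row_decs l b (m + ?s k). ?i (?j A) = A"
    proof
      fix A assume A: "A \<in> row_decs l b (m + ?s k)"
      have "?i (?j A) = restrict A {..<l}" by (auto simp: s)
      also have "\<dots> = A" using A unfolding row_decs_def by (blast intro: PiE_restrict)
      finally show "?i (?j A) = A" .
    qed
    show "?j ` row_decs l b (m + ?s k) \<subseteq> (SIGMA c:compositions l k.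
        row_decs l (\<lambda>i. b i - int (c i)) m)"
    proof (rule image_subsetI)
      fix A assume A: "A \<in> row_decs l b (m + ?s k)"
      have k: "(\<Sum>i<l. Poly_Mapping.lookup (A i) N) = k"
        using lookup_sum_rows[OF A, of N] N by (simp add: lookup_add)
      have "(\<Sum>i<l. A i - ?s (Poly_Mapping.lookup (A i) N)) + ?s k =
          (\<Sum>i<l. A i - ?s (Poly_Mapping.lookup (A i) N) + ?s (Poly_Mapping.lookup (A i) N))"
        by (simp add: sum.distrib sumsingle k)
      also have "\<dots> = m + ?s k" using A by (simp add: s row_decs_def)
      finally have "(\<Sum>i<l. A i - ?s (Poly_Mapping.lookup (A i) N)) = m" by simp
      moreover have "int (mdeg (A i - ?s (Poly_Mapping.lookup (A i) N))) =
          b i - int (Poly_Mapping.lookup (A i) N)" if "i < l" for i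
        using A that ms[of "A i"] by (auto simp: row_decs_def)
      ultimately show "?j A \<in> (SIGMA c:compositions l k. row_decs l (\<lambda>i. b i - int (c i)) m)"
        using k by (auto simp: compositions_def row_decs_def)
    qed
    show "\<forall>p \<in> (SIGMA c:compositions l k. row_decs l (\<lambda>i. b i - int (c i)) m). ?j (?i p) = p"
    proof
      fix p assume "p \<in> (SIGMA c:compositions l k. row_decs l (\<lambda>i. b i - int (c i)) m)"
      then obtain c A where p: "p = (c, A)" and c: "c \<in> compositions l k"
          and A: "A \<in> row_decs l (\<lambda>i. b i - int (c i)) m"
        by auto
      have A0: "Poly_Mapping.lookup (A i) N = 0" if "i < l" for i
        using keys_row[OF A that] N by (auto simp: in_keys_iff subset_iff)
      have "?j (?i p) = (restrict c {..<l}, restrict A {..<l})"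
        by (auto simp: p A0 lookup_add)
      also have "restrict c {..<l} = c" using c unfolding compositions_def
          by (blast intro: PiE_restrict)
      also have "restrict A {..<l} = A" using A unfolding row_decs_def
          by (blast intro: PiE_restrict)
      finally show "?j (?i p) = p" by (simp only: p)
    qed
    show "?i ` (SIGMA c:compositions l k. row_decs l (\<lambda>i. b i - int (c i)) m) \<subseteq>
        row_decs l b (m + ?s k)"
      by (auto simp: row_decs_def compositions_def sum.distrib sumsingle mdeg_add deg)
  qed
  then have "card (row_decs l b (m + ?s k)) =
      card (SIGMA c:compositions l k. row_decs l (\<lambda>i. b i - int (c i)) m)"
    by (rule bij_betw_same_card)
  then show ?thesis by simp
qed

lemma jt_sum_peel:
  assumes "Poly_Mapping.lookup m N = 0"
  shows "jt_sum l v (m + Poly_Mapping.single N k) =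
      (\<Sum>c \<in> compositions l k. jt_sum l (\<lambda>i. v i - int (c i)) m)"
proof -
  have "jt_sum l v (m + Poly_Mapping.single N k) = (\<Sum>p | p permutes {..<l}. \<Sum>c \<in> compositions l k.
      sign p * int (card (row_decs l (\<lambda>i. v i - int (c i) + int (p i)) m)))"
    unfolding jt_sum_def row_decs_peel[OF assms] by (simp add: sum_distrib_left algebra_simps)
  also have "\<dots> = (\<Sum>c \<in> compositions l k. jt_sum l (\<lambda>i. v i - int (c i)) m)"
    unfolding jt_sum_def by (rule sum.swap)
  finally show ?thesis .
qed

text \<open>In the last row \<open>i\<close> every permutation has \<open>p i \<le> i\<close>, so
  that row of the determinant consists of complete symmetric functions of negative index.\<close>

lemma jt_sum_negative:
  assumes "l = Suc i" "v i + int i < 0"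
  shows "jt_sum l v m = 0"
  unfolding jt_sum_def
proof (rule sum.neutral, rule ballI)
  fix p assume "p \<in> {p. p permutes {..<l}}"
  then have "p i < l" using permutes_in_image[of p "{..<l}" i] assms(1) by simp
  then have neg: "v i + int (p i) < 0" using assms by simp
  have "int (mdeg (A i)) \<noteq> v i + int (p i)" for A :: "nat \<Rightarrow> mon" using neg by linarith
  then have "row_decs l (\<lambda>i. v i + int (p i)) m = {}" using assms(1) by (auto simp: row_decs_def)
  then show "sign p * int (card (row_decs l (\<lambda>i. v i + int (p i)) m)) = 0" by simp
qed

text \<open>Partitions as functions padded by zeros. Removing a strip may empty some rows, and in
  this form the size \<open>l\<close> of the determinant stays the same throughout the
  recursion.\<close>

definition is_shape :: "nat \<Rightarrow> (nat \<Rightarrow> nat) \<Rightarrow> bool" where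
  "is_shape l s \<longleftrightarrow> (\<forall>i. s (Suc i) \<le> s i) \<and> (\<forall>i\<ge>l. s i = 0)"

text \<open>\<open>c i\<close> boxes leave the end of row \<open>i\<close>. What remains of row
  \<open>i\<close> must be at least as long as the old row \<open>i + 1\<close>, so that no two
  removed boxes share a column.\<close>

definition strip_comps :: "nat \<Rightarrow> nat \<Rightarrow> (nat \<Rightarrow> nat) \<Rightarrow> (nat \<Rightarrow> nat) set" where
  "strip_comps l k s = {c \<in> compositions l k. \<forall>i<l. c i + s (Suc i) \<le> s i}"

text \<open>
  If \<open>i\<close> is the first row in which removing \<open>c\<close> from \<open>s\<close> fails to leave a horizontal strip, then
  exchanging the entries \<open>i\<close> and \<open>i + 1\<close> of the shifted vector is a sign-reversing involution.
\<close>
lemma jt_sum_peel_shape: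
  assumes N: "Poly_Mapping.lookup m N = 0" and s: "is_shape l s"
  shows "jt_sum l (\<lambda>i. int (s i) - int i) (m + Poly_Mapping.single N k) =
    (\<Sum>c \<in> strip_comps l k s. jt_sum l (\<lambda>i. int (s i - c i) - int i) m)"
proof -
  let ?f = "\<lambda>c. jt_sum l (\<lambda>i. int (s i) - int i - int (c i)) m"
  let ?B = "compositions l k - strip_comps l k s"
  define bad where "bad c i \<longleftrightarrow> i < l \<and> s i < c i + s (Suc i)" for c i
  define f where "f c = (LEAST i. bad c i)" for c
  \<comment> \<open>With \<open>i = f c\<close>, the new values solve
    \<open>s i - i - c' i = s (i+1) - (i+1) - c (i+1)\<close> and the mirror equation, so the
    shifted entries trade places. Badness at \<open>i\<close> is precisely what keeps the
    subtraction from truncating. In the last row there is nothing to exchange with, and the term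
    vanishes by itself.\<close>
  define t where "t c = (if Suc (f c) < l then
      c(f c := s (f c) - s (Suc (f c)) + 1 + c (Suc (f c)), Suc (f c) := c (f c) -
          (s (f c) - s (Suc (f c)) + 1)) else c)" for c
  have sdec: "s (Suc i) \<le> s i" for i using s by (simp add: is_shape_def)
  have bad_ex: "bad c (f c)" if "c \<in> ?B" for c
  proof -
    have "\<exists>i. bad c i" using that by (auto simp: strip_comps_def bad_def not_le)
    then show ?thesis unfolding f_def by (rule LeastI_ex)
  qed
  have main: "t c \<in> ?B \<and> t (t c) = c \<and> ?f (t c) = - ?f c" if c: "c \<in> ?B" for c
  proof (cases "Suc (f c) < l")
    case True
    define i where "i = f c"
    have i: "bad c i" "Suc i < l" using bad_ex[OF c] True by (auto simp: i_def)
    let ?d = "s i - s (Suc i) + 1"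
    have ge: "?d \<le> c i" using i sdec[of i] by (auto simp: bad_def)
    have tc: "t c = c(i := ?d + c (Suc i), Suc i := c i - ?d)" using True by (simp add: t_def i_def)
    have sum: "(\<Sum>j<l. t c j) = (\<Sum>j<l. c j)"
    proof -
      have split: "(\<Sum>j<l. g j) = g i + (g (Suc i) + (\<Sum>j \<in> {..<l} - {i} - {Suc i}. g j))"
          for g :: "nat \<Rightarrow> nat"
        using i(2) by (subst sum.remove[of _ i], simp, simp, subst sum.remove[of _ "Suc i"]) auto
      show ?thesis
        unfolding split[of "t c"] split[of c] using ge by (simp add: tc)
    qed
    have ext: "t c \<in> {..<l} \<rightarrow>\<^sub>E UNIV"
      using c i(2) by (auto simp: tc compositions_def PiE_iff extensional_def)
    have comp: "t c \<in> compositions l k" using sum ext c by (simp add: compositions_def)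
    have badt: "bad (t c) i" using i by (auto simp: bad_def tc)
    \<comment> \<open>Whether a row is bad depends on \<open>c\<close> in that row only, so the rows
      above \<open>i\<close> are unaffected and \<open>i\<close> stays the first bad one.\<close>
    have ft: "f (t c) = i"
      unfolding f_def[of "t c"]
    proof (rule Least_equality)
      fix j assume j: "bad (t c) j"
      show "i \<le> j"
      proof (rule ccontr)
        assume "\<not> i \<le> j"
        then have "bad c j" using j by (simp add: bad_def tc)
        then have "f c \<le> j" unfolding f_def by (rule Least_le)
        then show False using \<open>\<not> i \<le> j\<close> by (simp add: i_def)
      qed
    qed (rule badt)
    have "t c \<in> ?B" using comp badt by (auto simp: strip_comps_def bad_def not_le[symmetric])
    moreover have "t (t c) = c"
      unfolding t_def[of "t c"] ft using i(2) ge by (auto simp: tc)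
    moreover have "?f (t c) = - ?f c"
    proof -
      let ?t = "transpose i (Suc i)"
      let ?v = "\<lambda>i. int (s i) - int i - int (c i)"
      have "?t permutes {..<l}" using i(2) by (intro permutes_swap_id) auto
      then have "jt_sum l (?v \<circ> ?t) m = - jt_sum l ?v m" by (simp add: jt_sum_permute sign_swap_id)
      moreover have "?f (t c) = jt_sum l (?v \<circ> ?t) m"
        by (rule jt_sum_cong) (use ge sdec[of i] in \<open>auto simp: tc transpose_def\<close>)
      ultimately show ?thesis by simp
    qed
    ultimately show ?thesis by simp
  next
    case False
    then have tc: "t c = c" by (simp add: t_def)
    have b: "f c < l" "s (f c) < c (f c) + s (Suc (f c))" using bad_ex[OF c] by (auto simp: bad_def)
    then have l: "l = Suc (f c)" using False by simp
    then have "s (Suc (f c)) = 0" using s by (simp add: is_shape_def)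
    then have "?f c = 0" using b by (intro jt_sum_negative[OF l]) simp
    then show ?thesis using c tc by simp
  qed
  have "sum ?f ?B = sum (\<lambda>c. ?f (t c)) ?B"
    by (rule sum.reindex_bij_witness[where i = t and j = t]) (use main in auto)
  also have "\<dots> = - sum ?f ?B"
    using main by (simp add: sum_negf)
  finally have zero: "sum ?f ?B = 0" by simp
  have sub: "strip_comps l k s \<subseteq> compositions l k" by (auto simp: strip_comps_def)
  have "jt_sum l (\<lambda>i. int (s i) - int i) (m + Poly_Mapping.single N k) = sum ?f (compositions l k)"
    by (rule jt_sum_peel[OF N])
  also have "\<dots> = sum ?f ?B + sum ?f (strip_comps l k s)"
    using sub by (simp add: sum.subset_diff)
  also have "\<dots> = (\<Sum>c \<in> strip_comps l k s. jt_sum l (\<lambda>i. int (s i - c i) - int i) m)"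
    unfolding zero by (simp, intro sum.cong refl jt_sum_cong)
        (auto simp: strip_comps_def of_nat_diff add_leD1)
  finally show ?thesis .
qed


section \<open>Semistandard tableaux and removal of the largest entry\<close>

definition shape_cells :: "(nat \<Rightarrow> nat) \<Rightarrow> (nat \<times> nat) set" where
  "shape_cells s = {(i, j). j < s i}"

definition shape_ssyt :: "(nat \<Rightarrow> nat) \<Rightarrow> mon \<Rightarrow> (nat \<times> nat \<Rightarrow> nat) set" where
  "shape_ssyt s m = {T \<in> extensional (shape_cells s).
     (\<forall>i j k. k < s i \<and> j < k \<longrightarrow> T (i, j) \<le> T (i, k)) \<and>
     (\<forall>i j k. k < s i \<and> k < s j \<and> i < j \<longrightarrow> T (i, k) < T (j, k)) \<and>
     (\<forall>x. card {c \<in> shape_cells s. T c = x} = Poly_Mapping.lookup m x)}"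

lemma shape_antimono: "is_shape l s \<Longrightarrow> i \<le> j \<Longrightarrow> s j \<le> s i"
  by (rule lift_Suc_antimono_le) (auto simp: is_shape_def)

lemma shape_zero: "is_shape l s \<Longrightarrow> \<not> i < l \<Longrightarrow> s i = 0"
  by (auto simp: is_shape_def)

lemma shape_cells_Sigma: "is_shape l s \<Longrightarrow> shape_cells s = (SIGMA i:{..<l}. {..<s i})"
  by (auto simp: shape_cells_def dest: shape_zero)

lemma finite_shape_cells: "is_shape l s \<Longrightarrow> finite (shape_cells s)"
  by (simp add: shape_cells_Sigma)

lemma shape_ssyt_key:
  assumes "is_shape l s" "T \<in> shape_ssyt s m" "c \<in> shape_cells s"
  shows "T c \<in> Poly_Mapping.keys m"
proof -
  have "finite {d \<in> shape_cells s. T d = T c}" using finite_shape_cells[OF assms(1)] by simp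
  moreover have "c \<in> {d \<in> shape_cells s. T d = T c}" using assms(3) by simp
  ultimately have "card {d \<in> shape_cells s. T d = T c} \<noteq> 0" by (metis card_0_eq empty_iff)
  then show ?thesis using assms(2) by (auto simp: shape_ssyt_def in_keys_iff)
qed

lemma finite_shape_ssyt:
  assumes "is_shape l s" shows "finite (shape_ssyt s m)"
proof (rule finite_subset)
  show "shape_ssyt s m \<subseteq> shape_cells s \<rightarrow>\<^sub>E Poly_Mapping.keys m"
    using shape_ssyt_key[OF assms] by (auto simp: shape_ssyt_def PiE_def)
qed (simp add: finite_PiE finite_shape_cells[OF assms])

lemma shape_diff:
  assumes "is_shape l s" "c \<in> strip_comps l k s"
  shows "is_shape l (\<lambda>i. s i - c i)"
proof -
  have "s (Suc i) - c (Suc i) \<le> s i - c i" for i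
  proof (cases "i < l")
    case True
    then have "c i + s (Suc i) \<le> s i" using assms by (auto simp: strip_comps_def)
    then show ?thesis by simp
  next
    case False
    then show ?thesis using assms by (simp add: is_shape_def)
  qed
  then show ?thesis using assms by (simp add: is_shape_def)
qed

definition count_last :: "nat \<Rightarrow> (nat \<Rightarrow> nat) \<Rightarrow> nat \<Rightarrow> (nat \<times> nat \<Rightarrow> nat) \<Rightarrow> nat \<Rightarrow> nat" where
  "count_last l s N T = (\<lambda>i \<in> {..<l}. card {j. j < s i \<and> T (i, j) = N})"

context
  fixes l N k :: nat and s :: "nat \<Rightarrow> nat" and m :: mon
  assumes s: "is_shape l s" and N: "\<And>x. x \<in> Poly_Mapping.keys m \<Longrightarrow> x < N"
begin

lemma lookup_last: "Poly_Mapping.lookup (m + Poly_Mapping.single N k) x =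
    (if x = N then k else Poly_Mapping.lookup m x)"
proof -
  have "Poly_Mapping.lookup m N = 0" using N[of N] by (auto simp: in_keys_iff)
  then show ?thesis by (simp add: lookup_add lookup_single when_def)
qed

lemma ssyt_le_last:
  assumes T: "T \<in> shape_ssyt s (m + Poly_Mapping.single N k)" and j: "j < s i"
  shows "T (i, j) \<le> N"
proof -
  have "T (i, j) \<in> Poly_Mapping.keys (m + Poly_Mapping.single N k)"
    using j by (intro shape_ssyt_key[OF s T]) (simp add: shape_cells_def)
  then show ?thesis using N[of "T (i, j)"] by (auto simp: in_keys_iff lookup_last split: if_splits)
qed

text \<open>Rows increase weakly and no entry exceeds \<open>N\<close>, so the entries
  \<open>N\<close> fill the end of each row.\<close>

lemma ssyt_last_iff:
  assumes T: "T \<in> shape_ssyt s (m + Poly_Mapping.single N k)" and j: "j < s i"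
  shows "T (i, j) = N \<longleftrightarrow> s i - count_last l s N T i \<le> j"
proof -
  have i: "i < l" using j shape_zero[OF s, of i] by (cases "i < l") auto
  let ?X = "{j. j < s i \<and> T (i, j) = N}"
  have up: "j' \<in> ?X" if "j \<in> ?X" "j \<le> j'" "j' < s i" for j j'
  proof -
    have "T (i, j) \<le> T (i, j')"
      using T that by (cases "j = j'") (auto simp: shape_ssyt_def)
    then show ?thesis using that ssyt_le_last[OF T that(3)] by auto
  qed
  have X: "?X = {s i - card ?X..<s i}"
  proof (cases "?X = {}")
    case False
    define a where "a = Min ?X"
    have fin: "finite ?X" by simp
    have a: "a \<in> ?X" unfolding a_def by (rule Min_in[OF fin False])
    have "?X = {a..<s i}"
    proof (rule Set.set_eqI, rule iffI)
      fix x assume x: "x \<in> ?X"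
      then have "a \<le> x" unfolding a_def by (rule Min_le[OF fin])
      then show "x \<in> {a..<s i}" using x by simp
    next
      fix x assume "x \<in> {a..<s i}"
      then show "x \<in> ?X" by (intro up[OF a]) simp_all
    qed
    moreover from this have "card ?X = s i - a" by simp
    ultimately show ?thesis using a by auto
  next
    case True
    then show ?thesis by (simp only: card.empty) simp
  qed
  have "j \<in> ?X \<longleftrightarrow> j \<in> {s i - card ?X..<s i}" using X by (rule arg_cong)
  moreover have "count_last l s N T i = card ?X" using i by (simp add: count_last_def)
  ultimately show ?thesis using j by simp
qed

text \<open>Columns increase strictly and \<open>N\<close> is the largest possible entry, so no box
  lies below an \<open>N\<close>.\<close>

lemma count_last_strip:
  assumes T: "T \<in> shape_ssyt s (m + Poly_Mapping.single N k)"
  shows "count_last l s N T \<in> strip_comps l k s"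
proof -
  let ?c = "count_last l s N T"
  have "{c \<in> shape_cells s. T c = N} = (SIGMA i:{..<l}. {j. j < s i \<and> T (i, j) = N})"
    by (auto simp: shape_cells_Sigma[OF s])
  then have "card {c \<in> shape_cells s. T c = N} = (\<Sum>i<l. ?c i)"
    by (simp add: count_last_def)
  then have sum: "(\<Sum>i<l. ?c i) = k"
    using T by (simp add: shape_ssyt_def lookup_last)
  have "?c i + s (Suc i) \<le> s i" if i: "i < l" for i
  proof -
    have cle: "?c i \<le> s i"
      using i card_mono[of "{..<s i}" "{j. j < s i \<and> T (i, j) = N}"] by (auto simp: count_last_def)
    have "s (Suc i) \<le> s i - ?c i"
    proof (rule ccontr)
      assume "\<not> s (Suc i) \<le> s i - ?c i"
      then have j: "s i - ?c i < s (Suc i)" by simp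
      let ?j = "s i - ?c i"
      have j': "?j < s i" using j shape_antimono[OF s, of i "Suc i"] by simp
      have "T (i, ?j) = N" using ssyt_last_iff[OF T j'] by simp
      moreover have "T (i, ?j) < T (Suc i, ?j)" using T j j' by (auto simp: shape_ssyt_def)
      moreover have "T (Suc i, ?j) \<le> N" by (rule ssyt_le_last[OF T j])
      ultimately show False by simp
    qed
    then show ?thesis using cle by simp
  qed
  then show ?thesis
    using sum by (auto simp: strip_comps_def compositions_def count_last_def)
qed

lemma restrict_ssyt:
  assumes T: "T \<in> shape_ssyt s (m + Poly_Mapping.single N k)"
  defines "t \<equiv> \<lambda>i. s i - count_last l s N T i"
  shows "restrict T (shape_cells t) \<in> shape_ssyt t m"
proof -
  let ?R = "restrict T (shape_cells t)"
  have ts: "t i \<le> s i" for i by (simp add: t_def)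
  have R: "?R (i, j) = T (i, j)" if "j < t i" for i j using that by (simp add: shape_cells_def)
  have lt: "j < t i \<longleftrightarrow> j < s i \<and> T (i, j) \<noteq> N" for i j
    using ssyt_last_iff[OF T, of j i] ts[of i] by (cases "j < s i") (simp_all add: t_def not_le)
  have "card {c \<in> shape_cells t. ?R c = x} = Poly_Mapping.lookup m x" for x
  proof (cases "x = N")
    case True
    have "{c \<in> shape_cells t. ?R c = x} = {}" using lt True by (auto simp: shape_cells_def)
    moreover have "Poly_Mapping.lookup m N = 0" using N[of N] by (auto simp: in_keys_iff)
    ultimately show ?thesis using True by (simp only: card.empty)
  next
    case False
    have "{c \<in> shape_cells t. ?R c = x} = {c \<in> shape_cells s. T c = x}"
      using lt False by (auto simp: shape_cells_def)
    then show ?thesis using T False lookup_last[of x] by (simp add: shape_ssyt_def)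
  qed
  moreover have "?R (i, j) \<le> ?R (i, k')" if "k' < t i" "j < k'" for i j k'
    using that T ts[of i] R by (auto simp: shape_ssyt_def)
  moreover have "?R (i, k') < ?R (j, k')" if "k' < t i" "k' < t j" "i < j" for i j k'
    using that T ts[of i] ts[of j] R by (auto simp: shape_ssyt_def)
  ultimately show ?thesis by (simp add: shape_ssyt_def del: restrict_apply)
qed

lemma extend_ssyt:
  assumes c: "c \<in> strip_comps l k s" and R: "R \<in> shape_ssyt (\<lambda>i. s i - c i) m"
  defines "T \<equiv> \<lambda>p \<in> shape_cells s. if p \<in> shape_cells (\<lambda>i. s i - c i) then R p else N"
  shows "T \<in> shape_ssyt s (m + Poly_Mapping.single N k)" "count_last l s N T = c"
    "restrict T (shape_cells (\<lambda>i. s i - c i)) = R"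
proof -
  let ?t = "\<lambda>i. s i - c i"
  have t: "is_shape l ?t" by (rule shape_diff[OF s c])
  have sub: "shape_cells ?t \<subseteq> shape_cells s" by (auto simp: shape_cells_def)
  have RN: "R (i, j) < N" if "j < ?t i" for i j
    using that by (intro N shape_ssyt_key[OF t R]) (simp add: shape_cells_def)
  have T: "T (i, j) = (if j < ?t i then R (i, j) else N)" if "j < s i" for i j
    using that by (auto simp: T_def shape_cells_def)
  have cle: "c i \<le> s i" if "i < l" for i using c that by (force simp: strip_comps_def)
  \<comment> \<open>Every lower row ends within what is left of row \<open>i\<close>; hence in a
    column the entry of row \<open>i\<close> above another box is an old one, smaller than
    \<open>N\<close>.\<close>
  have strip: "s j \<le> ?t i" if "i < j" for i j
  proof (cases "i < l")
    case True
    have "s j \<le> s (Suc i)" using that by (intro shape_antimono[OF s]) simp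
    also have "\<dots> \<le> ?t i" using True c by (force simp: strip_comps_def)
    finally show ?thesis .
  next
    case False
    then show ?thesis using that shape_zero[OF s, of j] by simp
  qed
  have cnt: "{j. j < s i \<and> T (i, j) = N} = {?t i..<s i}" for i
  proof -
    have "T (i, j) = N \<longleftrightarrow> \<not> j < ?t i" if "j < s i" for j
      using T[OF that] RN[of j i] by auto
    then show ?thesis
      by (intro Set.set_eqI) (simp add: not_less conj_commute cong: conj_cong)
  qed
  show cl: "count_last l s N T = c"
  proof
    fix i show "count_last l s N T i = c i"
      using c cle by (cases "i < l") (auto simp: count_last_def cnt strip_comps_def
          compositions_def)
  qed
  show "restrict T (shape_cells ?t) = R"
  proof
    fix p
    have "R p = undefined" if "p \<notin> shape_cells ?t"
      using R that by (auto simp: shape_ssyt_def intro: extensional_arb)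
    then show "restrict T (shape_cells ?t) p = R p"
      using subsetD[OF sub, of p] by (cases "p \<in> shape_cells ?t") (simp_all add: T_def)
  qed
  have "card {p \<in> shape_cells s. T p = x} = Poly_Mapping.lookup (m + Poly_Mapping.single N k) x"
      for x
  proof (cases "x = N")
    case True
    have "{p \<in> shape_cells s. T p = N} = (SIGMA i:{..<l}. {j. j < s i \<and> T (i, j) = N})"
      by (auto simp: shape_cells_Sigma[OF s])
    then have "card {p \<in> shape_cells s. T p = N} = (\<Sum>i<l. c i)"
      using cle by (simp add: cnt)
    then show ?thesis using True c by (simp add: lookup_last strip_comps_def compositions_def)
  next
    case False
    have "{p \<in> shape_cells s. T p = x} = {p \<in> shape_cells ?t. R p = x}"
      using False sub by (auto simp: T_def split: if_splits)
    then show ?thesis using R False by (simp add: lookup_last shape_ssyt_def)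
  qed
  moreover have "T (i, j) \<le> T (i, k')" if "k' < s i" "j < k'" for i j k'
    using that R RN[of j i] by (auto simp: T shape_ssyt_def)
  moreover have "T (i, k') < T (j, k')" if "k' < s i" "k' < s j" "i < j" for i j k'
    using that R RN[of k' i] strip[OF that(3)] by (auto simp: T shape_ssyt_def)
  moreover have "T \<in> extensional (shape_cells s)" by (simp add: T_def)
  ultimately show "T \<in> shape_ssyt s (m + Poly_Mapping.single N k)" by (simp add: shape_ssyt_def)
qed

text \<open>Cutting off the boxes that hold the largest entry gives the branching rule over
  horizontal strips, the same recursion as \<open>jt_sum_peel_shape\<close>.\<close>

lemma card_shape_ssyt_peel:
  "card (shape_ssyt s (m + Poly_Mapping.single N k)) =
      (\<Sum>c \<in> strip_comps l k s. card (shape_ssyt (\<lambda>i. s i - c i) m))"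
proof -
  have "bij_betw (\<lambda>T. (count_last l s N T, restrict T
      (shape_cells (\<lambda>i. s i - count_last l s N T i))))
      (shape_ssyt s (m + Poly_Mapping.single N k))
          (SIGMA c:strip_comps l k s. shape_ssyt (\<lambda>i. s i - c i) m)"
  proof (rule bij_betw_byWitness[where
        f' = "\<lambda>(c, R). \<lambda>p \<in> shape_cells s. if p \<in> shape_cells (\<lambda>i. s i - c i) then R p else N"])
    show "\<forall>T \<in> shape_ssyt s (m + Poly_Mapping.single N k).
       (case (count_last l s N T, restrict T (shape_cells (\<lambda>i. s i - count_last l s N T i))) of
         (c, R) \<Rightarrow> \<lambda>p\<in>shape_cells s. if p \<in> shape_cells (\<lambda>i. s i - c i) then R p else N) = T"
    proof
      fix T assume T: "T \<in> shape_ssyt s (m + Poly_Mapping.single N k)"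
      have "(if p \<in> shape_cells (\<lambda>i. s i - count_last l s N T i)
          then restrict T (shape_cells (\<lambda>i. s i - count_last l s N T i)) p else N) = T p"
        if "p \<in> shape_cells s" for p
      proof (cases p)
        case (Pair i j)
        then have "j < s i" using that by (simp add: shape_cells_def)
        from ssyt_last_iff[OF T this] show ?thesis using Pair by (auto simp: shape_cells_def)
      qed
      then have "(\<lambda>p\<in>shape_cells s. if p \<in> shape_cells (\<lambda>i. s i - count_last l s N T i)
          then restrict T (shape_cells (\<lambda>i. s i - count_last l s N T i)) p else N) =
              restrict T (shape_cells s)"
        by (rule restrict_ext)
      also have "\<dots> = T" using T by (intro extensional_restrict) (simp add: shape_ssyt_def)
      finally show "(case (count_last l s N T, restrict T
          (shape_cells (\<lambda>i. s i - count_last l s N T i))) of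
         (c, R) \<Rightarrow> \<lambda>p\<in>shape_cells s. if p \<in> shape_cells (\<lambda>i. s i - c i) then R p else N) = T" by simp
    qed
  qed (use count_last_strip restrict_ssyt extend_ssyt in \<open>auto simp del: restrict_apply\<close>)
  then have "card (shape_ssyt s (m + Poly_Mapping.single N k)) =
      card (SIGMA c:strip_comps l k s. shape_ssyt (\<lambda>i. s i - c i) m)"
    by (rule bij_betw_same_card)
  also have "\<dots> = (\<Sum>c \<in> strip_comps l k s. card (shape_ssyt (\<lambda>i. s i - c i) m))"
  proof (rule card_SigmaI)
    show "finite (strip_comps l k s)" by (simp add: strip_comps_def)
    show "\<forall>c \<in> strip_comps l k s. finite (shape_ssyt (\<lambda>i. s i - c i) m)"
      using finite_shape_ssyt[OF shape_diff[OF s]] by blast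
  qed
  finally show ?thesis .
qed

end

text \<open>The start of both recursions, with no variables left. Only the empty shape has a
  tableau, and for it only the identity permutation makes all degrees zero; for any other shape the
  first row would need positive degree.\<close>

lemma jt_sum_zero:
  assumes s: "is_shape l s"
  shows "jt_sum l (\<lambda>i. int (s i) - int i) 0 = int (card (shape_ssyt s 0))"
proof (cases "\<forall>i. s i = 0")
  case True
  have rd: "row_decs l (\<lambda>i. int (s i) - int i + int (p i)) 0 =
      (if p = id then {\<lambda>i\<in>{..<l}. 0} else {})"
    if p: "p permutes {..<l}" for p
  proof -
    have zero: "A i = 0" if "A \<in> row_decs l b 0" "i < l" for A b i
      using keys_row[OF that] by simp
    show ?thesis
    proof (cases "p = id")
      case True
      have "row_decs l (\<lambda>i. int (s i) - int i + int (p i)) 0 = {\<lambda>i\<in>{..<l}. 0}"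
      proof (rule Set.set_eqI, rule iffI)
        fix A assume A: "A \<in> row_decs l (\<lambda>i. int (s i) - int i + int (p i)) 0"
        have "restrict A {..<l} = A" using A unfolding row_decs_def by (blast intro: PiE_restrict)
        moreover have "restrict A {..<l} = (\<lambda>i\<in>{..<l}. 0)" using zero[OF A]
            by (intro restrict_ext) simp
        ultimately show "A \<in> {\<lambda>i\<in>{..<l}. 0}" by simp
      qed (use True \<open>\<forall>i. s i = 0\<close> in \<open>auto simp: row_decs_def mdeg_def\<close>)
      then show ?thesis using True by simp
    next
      case False
      have "row_decs l (\<lambda>i. int (s i) - int i + int (p i)) 0 = {}"
      proof (rule equals0I)
        fix A assume A: "A \<in> row_decs l (\<lambda>i. int (s i) - int i + int (p i)) 0"
        have "p i = i" if "i < l" for i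
        proof -
          have "int (mdeg (A i)) = int (s i) - int i + int (p i)" using A that
              by (simp add: row_decs_def)
          then show ?thesis using zero[OF A that] \<open>\<forall>i. s i = 0\<close> by (simp add: mdeg_def)
        qed
        then have "p = id" using p by (auto simp: permutes_def fun_eq_iff)
        then show False using False by simp
      qed
      then show ?thesis using False by simp
    qed
  qed
  have "jt_sum l (\<lambda>i. int (s i) - int i) 0 = (\<Sum>p | p permutes {..<l}. if p = id then 1 else 0)"
    unfolding jt_sum_def by (rule sum.cong) (auto simp: rd)
  also have "\<dots> = 1" by (simp add: finite_permutations permutes_id)
  finally have "jt_sum l (\<lambda>i. int (s i) - int i) 0 = 1" .
  moreover have "shape_ssyt s 0 = {\<lambda>_. undefined}"
    using True by (auto simp: shape_ssyt_def shape_cells_def)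
  ultimately show ?thesis by simp
next
  case False
  then obtain i where i: "s i \<noteq> 0" by auto
  then have il: "i < l" using shape_zero[OF s, of i] by (cases "i < l") simp_all
  have s0: "s 0 \<noteq> 0" using i shape_antimono[OF s, of 0 i] by simp
  have "row_decs l (\<lambda>i. int (s i) - int i + int (p i)) 0 = {}" for p
  proof (rule equals0I)
    fix A assume A: "A \<in> row_decs l (\<lambda>i. int (s i) - int i + int (p i)) 0"
    have "A 0 = 0" using keys_row[OF A, of 0] il by simp
    moreover have "int (mdeg (A 0)) = int (s 0) - int 0 + int (p 0)" using A il
        by (simp add: row_decs_def)
    ultimately show False using s0 by (simp add: mdeg_def)
  qed
  moreover have "shape_ssyt s 0 = {}"
  proof (rule equals0I)
    fix T assume "T \<in> shape_ssyt s 0"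
    from shape_ssyt_key[OF s this, of "(0, 0)"] s0 show False by (simp add: shape_cells_def)
  qed
  ultimately show ?thesis by (simp add: jt_sum_def)
qed

text \<open>Determinant and Kostka number obey one recursion under removal of the largest variable.
  The induction is on a bound \<open>N\<close> for the variables of \<open>m\<close>, and the shape
  varies along the way.\<close>

theorem jacobi_trudi:
  assumes "is_shape l s"
  shows "jt_sum l (\<lambda>i. int (s i) - int i) m = int (card (shape_ssyt s m))"
proof -
  have "jt_sum l (\<lambda>i. int (s i) - int i) m = int (card (shape_ssyt s m))"
    if "Poly_Mapping.keys m \<subseteq> {..<N}" for N
    using that assms
  proof (induction N arbitrary: m s)
    case 0
    then have "m = 0" by simp
    then show ?case using jt_sum_zero[OF 0(2)] by simp
  next
    case (Suc N)
    let ?k = "Poly_Mapping.lookup m N"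
    define m' where "m' = m - Poly_Mapping.single N ?k"
    have lk: "Poly_Mapping.lookup m' x = (if x = N then 0 else Poly_Mapping.lookup m x)" for x
      by (simp add: m'_def lookup_minus lookup_single when_def)
    have m: "m = m' + Poly_Mapping.single N ?k"
      by (rule poly_mapping_eqI) (simp add: lookup_add lk lookup_single when_def)
    have keys: "Poly_Mapping.keys m' \<subseteq> {..<N}"
    proof
      fix x assume x: "x \<in> Poly_Mapping.keys m'"
      then have "x \<noteq> N" "x \<in> Poly_Mapping.keys m" using lk[of x]
          by (auto simp: in_keys_iff split: if_splits)
      then show "x \<in> {..<N}" using Suc.prems(1) by (auto simp: less_Suc_eq)
    qed
    have "jt_sum l (\<lambda>i. int (s i) - int i) m =
        (\<Sum>c \<in> strip_comps l ?k s. jt_sum l (\<lambda>i. int (s i - c i) - int i) m')"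
      by (subst m, rule jt_sum_peel_shape) (simp_all add: lk Suc.prems)
    also have "\<dots> = (\<Sum>c \<in> strip_comps l ?k s. int (card (shape_ssyt (\<lambda>i. s i - c i) m')))"
      by (intro sum.cong refl Suc.IH keys shape_diff[OF Suc.prems(2)])
    also have "\<dots> = int (card (shape_ssyt s (m' + Poly_Mapping.single N ?k)))"
      using keys by (subst card_shape_ssyt_peel[OF Suc.prems(2)]) auto
    finally show ?case using m by simp
  qed
  moreover obtain N where "Poly_Mapping.keys m \<subseteq> {..<N}"
    using finite_nat_iff_bounded[of "Poly_Mapping.keys m"] by auto
  ultimately show ?thesis by blast
qed


section \<open>Orthonormality and completeness\<close>

definition row_len :: "nat list \<Rightarrow> nat \<Rightarrow> nat" where
  "row_len mu i = (if i < length mu then mu ! i else 0)"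

text \<open>The content of the term \<open>p\<close> in the expansion of the determinant of h_(mu_i
  - i + j). Single entries may be negative.\<close>

definition row_vec :: "nat list \<Rightarrow> (nat \<Rightarrow> nat) \<Rightarrow> nat \<Rightarrow> int" where
  "row_vec mu p i = (if i < length mu then int (mu ! i) - int i + int (p i) else 0)"

text \<open>
  The determinantal formula; \<open>young_symmetrizer_facts\<close> identifies this with the character of the
  irreducible representation.
\<close>
definition irr_char :: "nat \<Rightarrow> nat list \<Rightarrow> nat perm \<Rightarrow> int" where
  "irr_char n mu w = (\<Sum>p | p permutes {..<length mu}.
      sign p * int (fixed_colorings n (row_vec mu p) w))"

abbreviation mon_int :: "mon \<Rightarrow> nat \<Rightarrow> int" where
  "mon_int m \<equiv> \<lambda>k. int (Poly_Mapping.lookup m k)"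

lemma row_len_shape: "mu \<in> partitions n \<Longrightarrow> is_shape (length mu) (row_len mu)"
  by (auto simp: is_shape_def row_len_def partitions_def sorted_wrt_iff_nth_less)

lemma sum_row_len: "mu \<in> partitions n \<Longrightarrow> (\<Sum>i<length mu. row_len mu i) = n"
  by (simp add: partitions_def row_len_def sum_list_sum_nth atLeast0LessThan)

lemma row_len_pos: "mu \<in> partitions n \<Longrightarrow> row_len mu i \<noteq> 0 \<longleftrightarrow> i < length mu"
  by (auto simp: row_len_def partitions_def in_set_conv_nth)

lemma row_len_inj:
  assumes "mu \<in> partitions n" "nu \<in> partitions n" "row_len mu = row_len nu"
  shows "mu = nu"
proof -
  have iff: "i < length mu \<longleftrightarrow> i < length nu" for i
    using row_len_pos[OF assms(1), of i] row_len_pos[OF assms(2), of i] assms(3) by simp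
  then have len: "length mu = length nu" using iff[of "length mu"] iff[of "length nu"] by linarith
  show ?thesis
  proof (rule nth_equalityI[OF len])
    fix i assume "i < length mu"
    then show "mu ! i = nu ! i" using fun_cong[OF assms(3), of i] len by (simp add: row_len_def)
  qed
qed

lemma permutes_sum_id: "p permutes {..<l} \<Longrightarrow> (\<Sum>i<l. p i) = (\<Sum>i<l. i)"
  using sum.permute[of p "{..<l}" "\<lambda>i. i"] by (simp add: comp_def)

lemma sum_row_vec:
  assumes "mu \<in> partitions n" "p permutes {..<length mu}"
  shows "(\<Sum>i<length mu. row_vec mu p i) = int n"
proof -
  have "(\<Sum>i<length mu. int (p i)) = (\<Sum>i<length mu. int i)"
    using permutes_sum_id[OF assms(2)] by (simp flip: of_nat_sum)
  moreover have "(\<Sum>i<length mu. int (mu ! i)) = int n"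
    using sum_row_len[OF assms(1)] by (simp add: row_len_def flip: of_nat_sum)
  ultimately show ?thesis by (simp add: row_vec_def sum.distrib sum_subtractf)
qed

lemma nonneg_mon:
  assumes "\<And>i. g i \<ge> 0" "\<And>i. \<not> i < l \<Longrightarrow> g i = (0 :: int)"
  obtains m where "mon_int m = g" "int (mdeg m) = (\<Sum>i<l. g i)"
proof -
  let ?m = "Abs_poly_mapping (\<lambda>i. nat (g i))"
  have "{i. nat (g i) \<noteq> 0} \<subseteq> {..<l}" using assms(2) by force
  then have fin: "finite {i. nat (g i) \<noteq> 0}" by (rule finite_subset) simp
  then have m: "mon_int ?m = g" using assms(1) by auto
  have "mdeg ?m = (\<Sum>i<l. Poly_Mapping.lookup ?m i)"
    using fin assms(2) by (intro mdeg_superset) (force simp: in_keys_iff)+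
  then have "int (mdeg ?m) = (\<Sum>i<l. mon_int ?m i)" by simp
  with m that show ?thesis by metis
qed

lemma fixed_colorings_negative: "g k < 0 \<Longrightarrow> fixed_colorings n g w = 0"
proof -
  assume "g k < 0"
  have "colorings n g = {}"
  proof (rule equals0I)
    fix c assume "c \<in> colorings n g"
    then have "g k = int (card {x. x < n \<and> c x = k})" by (simp add: colorings_def)
    then show False using \<open>g k < 0\<close> by simp
  qed
  then show ?thesis by (rule fixed_colorings_empty)
qed

lemma irr_char_mon:
  assumes mu: "mu \<in> partitions n" and m: "mdeg m = n"
  shows "(\<Sum>w \<in> Sym n. irr_char n mu w * int (fixed_colorings n (mon_int m) w)) =
    int (card (Sym n)) * int (card (shape_ssyt (row_len mu) m))"
proof -
  let ?l = "length mu"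
  have "(\<Sum>w \<in> Sym n. irr_char n mu w * int (fixed_colorings n (mon_int m) w)) =
      (\<Sum>w \<in> Sym n. \<Sum>p | p permutes {..<?l}. sign p *
          (int (fixed_colorings n (row_vec mu p) w) * int (fixed_colorings n (mon_int m) w)))"
    by (simp add: irr_char_def sum_distrib_right mult.assoc)
  also have "\<dots> = (\<Sum>p | p permutes {..<?l}. sign p *
      (\<Sum>w \<in> Sym n. int (fixed_colorings n (row_vec mu p) w) * int
      (fixed_colorings n (mon_int m) w)))"
    by (subst sum.swap) (simp add: sum_distrib_left)
  also have "\<dots> = (\<Sum>p | p permutes {..<?l}. sign p *
      (int (card (Sym n)) * int (card (row_decs ?l (row_vec mu p) m))))"
    by (intro sum.cong refl arg_cong2[where f = "(*)"] sum_fixed_colorings_product[OF m])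
        (simp add: row_vec_def)
  also have "\<dots> = int (card (Sym n)) * jt_sum ?l (\<lambda>i. int (row_len mu i) - int i) m"
  proof -
    have "row_decs ?l (row_vec mu p) m = row_decs ?l (\<lambda>i. int (row_len mu i) - int i +
        int (p i)) m" for p
      by (rule row_decs_cong) (simp add: row_vec_def row_len_def)
    then show ?thesis by (simp add: jt_sum_def sum_distrib_left mult_ac)
  qed
  finally show ?thesis by (simp add: jacobi_trudi row_len_shape[OF mu])
qed

lemma ssyt_ge_row:
  assumes s: "is_shape l s" and T: "T \<in> shape_ssyt s m" and j: "j < s i"
  shows "i \<le> T (i, j)"
  using j
proof (induction i)
  case (Suc i)
  then have j: "j < s i" using s by (meson is_shape_def less_le_trans)
  have "T (i, j) < T (Suc i, j)" using T Suc.prems j by (simp add: shape_ssyt_def)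
  with Suc.IH[OF j] show ?case by simp
qed simp

lemma card_cells_rows:
  assumes "is_shape l s" shows "card {c \<in> shape_cells s. fst c < k} = (\<Sum>i<k. s i)"
proof -
  have "{c \<in> shape_cells s. fst c < k} = (SIGMA i:{..<k}. {..<s i})"
    by (auto simp: shape_cells_def)
  then show ?thesis by simp
qed

lemma card_cells_entries:
  assumes s: "is_shape l s" and T: "T \<in> shape_ssyt s m"
  shows "card {c \<in> shape_cells s. T c < k} = (\<Sum>x<k. Poly_Mapping.lookup m x)"
proof -
  have "{c \<in> shape_cells s. T c < k} = (\<Union>x<k. {c \<in> shape_cells s. T c = x})" by auto
  also have "card \<dots> = (\<Sum>x<k. card {c \<in> shape_cells s. T c = x})"
    using finite_shape_cells[OF s] by (intro card_UN_disjoint) auto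
  also have "\<dots> = (\<Sum>x<k. Poly_Mapping.lookup m x)" using T by (simp add: shape_ssyt_def)
  finally show ?thesis .
qed

text \<open>Strict increase down the columns makes an entry in row \<open>i\<close> at least
  \<open>i\<close>.\<close>

lemma entries_subset_rows:
  assumes "is_shape l s" "T \<in> shape_ssyt s m"
  shows "{c \<in> shape_cells s. T c < k} \<subseteq> {c \<in> shape_cells s. fst c < k}"
  using ssyt_ge_row[OF assms] by (fastforce simp: shape_cells_def)

lemma ssyt_dominance:
  assumes s: "is_shape l s" and T: "T \<in> shape_ssyt s m"
  shows "(\<Sum>x<k. Poly_Mapping.lookup m x) \<le> (\<Sum>i<k. s i)"
  unfolding card_cells_entries[OF s T, symmetric] card_cells_rows[OF s, symmetric]
  using finite_shape_cells[OF s] by (intro card_mono entries_subset_rows[OF s T]) simp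

text \<open>When content equals shape, there are as many entries below \<open>k\<close> as boxes in
  the first \<open>k\<close> rows. The inclusion between the two sets is then an equality for every
  \<open>k\<close>, and each entry is its row index.\<close>

lemma card_ssyt_diagonal:
  assumes s: "is_shape l s" and m: "Poly_Mapping.lookup m = s"
  shows "card (shape_ssyt s m) = 1"
proof -
  let ?T = "restrict fst (shape_cells s)"
  have "card {c \<in> shape_cells s. ?T c = x} = s x" for x
  proof -
    have "{c \<in> shape_cells s. ?T c = x} = Pair x ` {..<s x}" by (auto simp: shape_cells_def)
    then show ?thesis by (simp add: card_image inj_on_def)
  qed
  then have "?T \<in> shape_ssyt s m"
    by (auto simp: shape_ssyt_def m shape_cells_def)
  moreover have "T = ?T" if T: "T \<in> shape_ssyt s m" for T
  proof
    fix c
    show "T c = ?T c"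
    proof (cases "c \<in> shape_cells s")
      case True
      have eq: "{c \<in> shape_cells s. T c < k} = {c \<in> shape_cells s. fst c < k}" for k
        using finite_shape_cells[OF s]
        by (intro card_subset_eq entries_subset_rows[OF s T])
            (simp_all add: card_cells_entries[OF s T] card_cells_rows[OF s] m)
      have "T c < k \<longleftrightarrow> fst c < k" for k using eq[of k] True by blast
      from this[of "T c"] this[of "fst c"] have "T c = fst c" by linarith
      then show ?thesis using True by simp
    next
      case False
      then have "T c = undefined" using T by (auto simp: shape_ssyt_def intro: extensional_arb)
      then show ?thesis using False by simp
    qed
  qed
  ultimately have "shape_ssyt s m = {?T}" by blast
  then show ?thesis by simp
qed

text \<open>Induction by removal of the maximum, which is at least the cardinality minus
  one.\<close>

lemma sum_card_le: "finite S \<Longrightarrow> (\<Sum>i<card S. i) \<le> \<Sum>(S :: nat set)"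
proof (induction "card S" arbitrary: S)
  case (Suc k)
  then have "S \<noteq> {}" by auto
  then have M: "Max S \<in> S" using Suc.prems by simp
  have "S \<subseteq> {..Max S}" using Suc.prems by auto
  then have "card S \<le> Suc (Max S)" using card_mono[of "{..Max S}" S] by simp
  then have k: "k \<le> Max S" using Suc.hyps(2) by simp
  have c: "card (S - {Max S}) = k" using M Suc by simp
  have "(\<Sum>i<k. i) \<le> \<Sum>(S - {Max S})" using Suc.hyps(1)[of "S - {Max S}"] Suc.prems c by simp
  moreover have "\<Sum>S = Max S + \<Sum>(S - {Max S})" using M Suc.prems by (simp add: sum.remove)
  ultimately show ?case using k unfolding Suc.hyps(2)[symmetric] by simp
qed simp

text \<open>The values p(0), ..., p(k-1) are distinct naturals, so their sum is at least 0 + ... +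
  (k-1). Past the last row both sides equal \<open>n\<close>.\<close>

lemma row_vec_dominates:
  assumes mu: "mu \<in> partitions n" and p: "p permutes {..<length mu}"
  shows "int (\<Sum>i<k. row_len mu i) \<le> (\<Sum>i<k. row_vec mu p i)"
proof (cases "k \<le> length mu")
  case True
  have inj: "inj_on p {..<k}" using permutes_inj[OF p] by (rule inj_on_subset) simp
  have "(\<Sum>i<k. i) \<le> (\<Sum>i \<in> p ` {..<k}. i)"
    using sum_card_le[of "p ` {..<k}"] by (simp add: card_image[OF inj])
  also have "\<dots> = (\<Sum>i<k. p i)" by (simp add: sum.reindex[OF inj])
  finally have "int (\<Sum>i<k. i) \<le> int (\<Sum>i<k. p i)" by (rule of_nat_mono)
  moreover have "(\<Sum>i<k. row_vec mu p i) = int (\<Sum>i<k. row_len mu i) - int (\<Sum>i<k. i) +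
      int (\<Sum>i<k. p i)"
    using True by (simp add: row_vec_def row_len_def sum.distrib sum_subtractf)
  ultimately show ?thesis by linarith
next
  case False
  have "(\<Sum>i<k. row_len mu i) = (\<Sum>i<length mu. row_len mu i)"
    using False by (intro sum.mono_neutral_right) (auto simp: row_len_def)
  moreover have "(\<Sum>i<k. row_vec mu p i) = (\<Sum>i<length mu. row_vec mu p i)"
    using False by (intro sum.mono_neutral_right) (auto simp: row_vec_def)
  ultimately show ?thesis using sum_row_vec[OF mu p] sum_row_len[OF mu] by simp
qed

text \<open>Take the least \<open>i\<close> moved by \<open>p\<close>. The earlier rows are
  untouched, and p(i) > i since the smaller values are used up, so the partial sum through row
  \<open>i\<close> is larger than that of the partition.\<close>

lemma row_vec_dominates_strictly:
  assumes p: "p permutes {..<length mu}" and ne: "p \<noteq> id"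
  obtains k where "int (\<Sum>i<k. row_len mu i) < (\<Sum>i<k. row_vec mu p i)"
proof -
  have "\<exists>i. p i \<noteq> i" using ne by (auto simp: fun_eq_iff)
  define i where "i = (LEAST i. p i \<noteq> i)"
  have i: "p i \<noteq> i" unfolding i_def by (rule LeastI_ex) fact
  have below: "p j = j" if "j < i" for j using not_less_Least that unfolding i_def by blast
  have il: "i < length mu" using i p by (auto simp: permutes_def)
  have "\<not> p i < i"
    using below[of "p i"] i permutes_inj[OF p] by (auto dest: injD)
  then have gt: "i < p i" using i by simp
  have eq: "row_vec mu p j = int (row_len mu j)" if "j < i" for j
    using that il below by (simp add: row_vec_def row_len_def)
  have "(\<Sum>j<Suc i. row_vec mu p j) = (\<Sum>j<i. int (row_len mu j)) + row_vec mu p i"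
    by (simp add: eq)
  moreover have "int (row_len mu i) < row_vec mu p i" using gt il
      by (simp add: row_vec_def row_len_def)
  ultimately have "int (\<Sum>j<Suc i. row_len mu j) < (\<Sum>j<Suc i. row_vec mu p j)" by simp
  then show ?thesis by (rule that)
qed

lemma row_vec_id: "row_vec mu id = (\<lambda>i. int (row_len mu i))"
  by (auto simp: row_vec_def row_len_def)

text \<open>The inner product is a multiple of a Kostka number. A nonzero value produces a tableau
  of shape \<open>mu\<close> with this content, and the shape dominates the content.\<close>

lemma irr_char_row_vec:
  assumes mu: "mu \<in> partitions n" and nu: "nu \<in> partitions n" and p: "p permutes {..<length nu}"
    and nz: "(\<Sum>w \<in> Sym n. irr_char n mu w * int (fixed_colorings n (row_vec nu p) w)) \<noteq> 0"
  shows "(\<Sum>i<k. row_vec nu p i) \<le> int (\<Sum>i<k. row_len mu i)"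
proof -
  have "row_vec nu p i \<ge> 0" for i
  proof (rule ccontr)
    assume "\<not> row_vec nu p i \<ge> 0"
    then have "fixed_colorings n (row_vec nu p) w = 0" for w
        by (intro fixed_colorings_negative[of _ i]) simp
    then show False using nz by simp
  qed
  then obtain m where m: "mon_int m = row_vec nu p" "int (mdeg m) = (\<Sum>i<length nu. row_vec nu p i)"
    by (rule nonneg_mon[of "row_vec nu p" "length nu"]) (auto simp: row_vec_def)
  then have "mdeg m = n" using sum_row_vec[OF nu p] by simp
  from irr_char_mon[OF mu this] nz have "card (shape_ssyt (row_len mu) m) \<noteq> 0"
    unfolding m(1) by (metis mult_zero_right of_nat_0)
  then obtain T where "T \<in> shape_ssyt (row_len mu) m" by (metis card.empty ex_in_conv)
  from ssyt_dominance[OF row_len_shape[OF mu] this, of k]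
  have "int (\<Sum>x<k. Poly_Mapping.lookup m x) \<le> int (\<Sum>i<k. row_len mu i)" by (rule of_nat_mono)
  then show ?thesis by (simp flip: m(1))
qed

lemma irr_char_product:
  "(\<Sum>w \<in> Sym n. irr_char n mu w * irr_char n nu w) =
    (\<Sum>p | p permutes {..<length nu}. sign p *
        (\<Sum>w \<in> Sym n. irr_char n mu w * int (fixed_colorings n (row_vec nu p) w)))"
proof -
  have "(\<Sum>w \<in> Sym n. irr_char n mu w * irr_char n nu w) =
      (\<Sum>w \<in> Sym n. \<Sum>p | p permutes {..<length nu}.
          sign p * (irr_char n mu w * int (fixed_colorings n (row_vec nu p) w)))"
    unfolding irr_char_def[of n nu] by (simp add: sum_distrib_left mult_ac)
  then show ?thesis by (subst (asm) sum.swap) (simp add: sum_distrib_left)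
qed

text \<open>Every content in the formula for \<open>nu\<close> lies above \<open>nu\<close> in
  dominance, and one that pairs nontrivially with \<open>mu\<close> lies below
  \<open>mu\<close>.\<close>

lemma irr_char_nonzero_dominance:
  assumes mu: "mu \<in> partitions n" and nu: "nu \<in> partitions n"
    and nz: "(\<Sum>w \<in> Sym n. irr_char n mu w * irr_char n nu w) \<noteq> 0"
  shows "(\<Sum>i<k. row_len nu i) \<le> (\<Sum>i<k. row_len mu i)"
proof -
  obtain p where p: "p permutes {..<length nu}"
      "(\<Sum>w \<in> Sym n. irr_char n mu w * int (fixed_colorings n (row_vec nu p) w)) \<noteq> 0"
    using nz unfolding irr_char_product by (metis (mono_tags, lifting) mem_Collect_eq
        mult_zero_right sum.neutral)
  show ?thesis
    using row_vec_dominates[OF nu p(1), of k] irr_char_row_vec[OF mu nu p, of k] by linarith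
qed

text \<open>For equal partitions the terms with \<open>p \<noteq> id\<close> vanish, as their
  content exceeds the shape in some partial sum, and \<open>p = id\<close> counts the single tableau
  with content equal to shape. For different ones the symmetry of the inner product would force
  dominance in both directions.\<close>

theorem irr_char_orthogonal:
  assumes mu: "mu \<in> partitions n" and nu: "nu \<in> partitions n"
  shows "(\<Sum>w \<in> Sym n. irr_char n mu w * irr_char n nu w) =
      (if mu = nu then int (card (Sym n)) else 0)"
proof (cases "mu = nu")
  case True
  have zero: "(\<Sum>w \<in> Sym n. irr_char n mu w * int (fixed_colorings n (row_vec mu p) w)) = 0"
    if p: "p permutes {..<length mu}" "p \<noteq> id" for p
  proof (rule ccontr)
    assume nz: "(\<Sum>w \<in> Sym n. irr_char n mu w * int (fixed_colorings n (row_vec mu p) w)) \<noteq> 0"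
    obtain k where "int (\<Sum>i<k. row_len mu i) < (\<Sum>i<k. row_vec mu p i)"
      using row_vec_dominates_strictly[OF p] .
    with irr_char_row_vec[OF mu mu p(1) nz, of k] show False by simp
  qed
  obtain m where m: "mon_int m = row_vec mu id" "int (mdeg m) = (\<Sum>i<length mu. row_vec mu id i)"
    by (rule nonneg_mon[of "row_vec mu id" "length mu"]) (auto simp: row_vec_def)
  then have deg: "mdeg m = n" using sum_row_vec[OF mu permutes_id] by simp
  have lk: "Poly_Mapping.lookup m = row_len mu"
    using m(1) unfolding row_vec_id by (auto simp: fun_eq_iff)
  have "(\<Sum>w \<in> Sym n. irr_char n mu w * irr_char n mu w) =
      (\<Sum>p | p permutes {..<length mu}. if p =
          id then \<Sum>w \<in> Sym n. irr_char n mu w * int (fixed_colorings n (row_vec mu id) w) else 0)"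
    unfolding irr_char_product by (rule sum.cong) (auto simp: zero)
  also have "\<dots> = (\<Sum>w \<in> Sym n. irr_char n mu w * int (fixed_colorings n (row_vec mu id) w))"
    by (simp add: finite_permutations permutes_id)
  also have "\<dots> = int (card (Sym n)) * int (card (shape_ssyt (row_len mu) m))"
    unfolding m(1)[symmetric] by (rule irr_char_mon[OF mu deg])
  also have "\<dots> = int (card (Sym n))"
    by (simp add: card_ssyt_diagonal[OF row_len_shape[OF mu] lk])
  finally show ?thesis using True by simp
next
  case False
  have "(\<Sum>w \<in> Sym n. irr_char n mu w * irr_char n nu w) = 0"
  proof (rule ccontr)
    assume nz: "(\<Sum>w \<in> Sym n. irr_char n mu w * irr_char n nu w) \<noteq> 0"
    then have nz': "(\<Sum>w \<in> Sym n. irr_char n nu w * irr_char n mu w) \<noteq> 0" by (simp add: mult.commute)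
    have eq: "(\<Sum>i<k. row_len mu i) = (\<Sum>i<k. row_len nu i)" for k
      using irr_char_nonzero_dominance[OF mu nu nz, of k]
          irr_char_nonzero_dominance[OF nu mu nz', of k] by simp
    have "row_len mu i = row_len nu i" for i using eq[of i] eq[of "Suc i"] by simp
    then have "mu = nu" by (intro row_len_inj[OF mu nu]) auto
    then show False using False by simp
  qed
  then show ?thesis using False by simp
qed

lemma irr_char_conj: "v \<in> Sym n \<Longrightarrow> w \<in> Sym n \<Longrightarrow> irr_char n mu (inverse v * w * v) = irr_char n mu w"
  by (simp add: irr_char_def fixed_colorings_conj)

lemma irr_char_inverse: "w \<in> Sym n \<Longrightarrow> irr_char n mu (inverse w) = irr_char n mu w"
  by (simp add: irr_char_def fixed_colorings_inverse)


section \<open>Permutation characters as integer combinations of \<open>irr_char\<close>\<close>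

lemma fixed_colorings_relabel:
  assumes t: "\<And>k. t (t k) = (k :: 'c)" and w: "w \<in> Sym n"
  shows "fixed_colorings n (\<lambda>k. g (t k)) w = fixed_colorings n g w"
proof -
  let ?f = "\<lambda>c. \<lambda>x \<in> {..<n}. t (c x)"
  have map: "?f c \<in> {c \<in> colorings n (\<lambda>k. h (t k)). fixes_coloring n w c}"
    if c: "c \<in> {c \<in> colorings n h. fixes_coloring n w c}" for c and h :: "'c \<Rightarrow> int"
  proof -
    have "{x. x < n \<and> ?f c x = k} = {x. x < n \<and> c x = t k}" for k
      using t by auto
    then show ?thesis using w c by (simp add: colorings_def fixes_coloring_def Sym_less)
  qed
  have inv: "?f (?f c) = c" if "c \<in> {c \<in> colorings n h. fixes_coloring n w c}" for c
      and h :: "'c \<Rightarrow> int"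
  proof -
    have "?f (?f c) = restrict c {..<n}" by (rule restrict_ext) (simp add: t)
    also have "\<dots> = c" using that unfolding colorings_def by (blast intro: PiE_restrict)
    finally show ?thesis .
  qed
  show ?thesis
    unfolding fixed_colorings_def
  proof (rule bij_betw_same_card, rule bij_betw_byWitness[where f = ?f and f' = ?f])
    show "?f ` {c \<in> colorings n (\<lambda>k. g (t k)). fixes_coloring n w c} \<subseteq>
        {c \<in> colorings n g. fixes_coloring n w c}"
      using map[of _ "\<lambda>k. g (t k)"] unfolding t by (rule image_subsetI)
    show "?f ` {c \<in> colorings n g. fixes_coloring n w c} \<subseteq>
        {c \<in> colorings n (\<lambda>k. g (t k)). fixes_coloring n w c}"
      using map[of _ g] by (rule image_subsetI)
  qed (use inv in \<open>blast+\<close>)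
qed

definition mon_weight :: "mon \<Rightarrow> nat" where
  "mon_weight m = (\<Sum>i \<in> Poly_Mapping.keys m. i * Poly_Mapping.lookup m i)"

lemma mon_weight_superset:
  assumes "finite I" "Poly_Mapping.keys m \<subseteq> I"
  shows "mon_weight m = (\<Sum>i \<in> I. i * Poly_Mapping.lookup m i)"
  unfolding mon_weight_def using assms by (intro sum.mono_neutral_left) (auto simp: in_keys_iff)

text \<open>Only the summands at \<open>i\<close> and \<open>i + 1\<close> change, and the larger
  entry receives the smaller factor.\<close>

lemma mon_weight_swap:
  assumes asc: "Poly_Mapping.lookup m i < Poly_Mapping.lookup m (Suc i)"
  shows "mon_weight (mact \<langle>i \<leftrightarrow> Suc i\<rangle> m) < mon_weight m"
proof -
  let ?t = "transpose i (Suc i)" and ?s = "\<langle>i \<leftrightarrow> Suc i\<rangle>"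
  obtain N where N: "Poly_Mapping.keys m \<union> {i, Suc i} \<subseteq> {..<N}"
    using finite_nat_iff_bounded[of "Poly_Mapping.keys m \<union> {i, Suc i}"] by auto
  have tN: "?t permutes {..<N}" using N by (intro permutes_swap_id) auto
  have "Poly_Mapping.keys (mact ?s m) \<subseteq> ?t ` {..<N}"
    unfolding keys_mact apply_swap using N by (intro image_mono) simp
  then have keys: "Poly_Mapping.keys (mact ?s m) \<subseteq> {..<N}" using permutes_image[OF tN] by simp
  have split: "(\<Sum>j<N. g j) = g i + (g (Suc i) + (\<Sum>j \<in> {..<N} - {i} - {Suc i}. g j))"
      for g :: "nat \<Rightarrow> nat"
    using N by (subst sum.remove[of _ i], simp, simp, subst sum.remove[of _ "Suc i"]) auto
  have "mon_weight (mact ?s m) = (\<Sum>k<N. k * Poly_Mapping.lookup m (?t k))"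
    by (simp add: mon_weight_superset[OF _ keys] apply_swap)
  also have "\<dots> = i * Poly_Mapping.lookup m (Suc i) + (Suc i * Poly_Mapping.lookup m i +
      (\<Sum>j \<in> {..<N} - {i} - {Suc i}. j * Poly_Mapping.lookup m j))"
    unfolding split by (simp add: transpose_def)
  also have "\<dots> < i * Poly_Mapping.lookup m i + (Suc i * Poly_Mapping.lookup m (Suc i) +
      (\<Sum>j \<in> {..<N} - {i} - {Suc i}. j * Poly_Mapping.lookup m j))"
    using asc by simp
  also have "\<dots> = mon_weight m"
    using N by (subst mon_weight_superset[of "{..<N}"]) (simp_all add: split)
  finally show ?thesis .
qed

text \<open>The squares of i - p(i) have a positive sum; it is expanded using that the squares of
  the p(i) and of the i have equal sums.\<close>

lemma permutes_sum_less:
  assumes p: "p permutes {..<l}" and ne: "p \<noteq> id"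
  shows "(\<Sum>i<l. int i * int (p i)) < (\<Sum>i<l. int i * int i)"
proof -
  obtain i where i: "p i \<noteq> i" using ne by (auto simp: fun_eq_iff)
  then have il: "i < l" using p by (auto simp: permutes_def)
  have sq: "(\<Sum>i<l. int (p i) * int (p i)) = (\<Sum>i<l. int i * int i)"
    using sum.permute[OF p, of "\<lambda>i. int i * int i"] by (simp add: comp_def)
  have "0 < (\<Sum>i<l. (int i - int (p i)) * (int i - int (p i)))"
    using i il by (intro sum_pos2[of _ i]) (auto simp: zero_less_mult_iff)
  also have "\<dots> = (\<Sum>i<l. int i * int i) + (\<Sum>i<l. int (p i) * int (p i)) - 2 *
      (\<Sum>i<l. int i * int (p i))"
    by (simp add: algebra_simps sum.distrib sum_subtractf sum_distrib_left)
  finally show ?thesis unfolding sq by simp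
qed

lemma mon_weight_row_vec:
  assumes mu: "Poly_Mapping.lookup m = row_len mu" and p: "p permutes {..<length mu}" "p \<noteq> id"
    and m': "mon_int m' = row_vec mu p"
  shows "mon_weight m' < mon_weight m"
proof -
  have k: "Poly_Mapping.keys m \<subseteq> {..<length mu}" using mu
      by (auto simp: in_keys_iff row_len_def split: if_splits)
  have k': "Poly_Mapping.keys m' \<subseteq> {..<length mu}"
  proof
    fix i assume "i \<in> Poly_Mapping.keys m'"
    then have "row_vec mu p i \<noteq> 0" by (simp add: in_keys_iff flip: m')
    then show "i \<in> {..<length mu}" by (auto simp: row_vec_def split: if_splits)
  qed
  have "int (mon_weight m') = (\<Sum>i<length mu. int i * row_vec mu p i)"
    by (simp add: mon_weight_superset[OF _ k'] flip: m')
  also have "\<dots> = (\<Sum>i<length mu. int i * int (row_len mu i)) - (\<Sum>i<length mu. int i * int i) +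
      (\<Sum>i<length mu. int i * int (p i))"
    by (simp add: row_vec_def row_len_def algebra_simps sum.distrib sum_subtractf)
  also have "\<dots> < (\<Sum>i<length mu. int i * int (row_len mu i))"
    using permutes_sum_less[OF p] by simp
  also have "\<dots> = int (mon_weight m)"
    by (simp add: mon_weight_superset[OF _ k] mu)
  finally show ?thesis by simp
qed

lemma decreasing_mon_partition:
  assumes dec: "\<And>i. Poly_Mapping.lookup m (Suc i) \<le> Poly_Mapping.lookup m i"
  obtains mu where "mu \<in> partitions (mdeg m)" "Poly_Mapping.lookup m = row_len mu"
proof -
  have anti: "Poly_Mapping.lookup m j \<le> Poly_Mapping.lookup m i" if "i \<le> j" for i j
    using dec that by (rule lift_Suc_antimono_le)
  have "\<exists>l. Poly_Mapping.lookup m l = 0"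
  proof -
    obtain N where "Poly_Mapping.keys m \<subseteq> {..<N}"
      using finite_nat_iff_bounded[of "Poly_Mapping.keys m"] by auto
    then have "Poly_Mapping.lookup m N = 0" by (auto simp: in_keys_iff subset_iff)
    then show ?thesis ..
  qed
  define l where "l = (LEAST l. Poly_Mapping.lookup m l = 0)"
  have l0: "Poly_Mapping.lookup m l = 0" unfolding l_def by (rule LeastI_ex) fact
  have below: "Poly_Mapping.lookup m i \<noteq> 0" if "i < l" for i
    using not_less_Least that unfolding l_def by blast
  have above: "Poly_Mapping.lookup m i = 0" if "\<not> i < l" for i
    using anti[of l i] l0 that by simp
  let ?mu = "map (Poly_Mapping.lookup m) [0..<l]"
  have rl: "Poly_Mapping.lookup m = row_len ?mu" using above by (auto simp: row_len_def)
  have keys: "Poly_Mapping.keys m \<subseteq> {..<l}" using above by (auto simp: in_keys_iff)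
  have "sum_list ?mu = mdeg m"
    by (simp add: mdeg_superset[OF _ keys] sum_list_sum_nth atLeast0LessThan)
  moreover have "0 \<notin> set ?mu"
  proof
    assume "0 \<in> set ?mu"
    then obtain i where "i < l" "Poly_Mapping.lookup m i = 0" by auto
    with below[of i] show False by simp
  qed
  ultimately have "?mu \<in> partitions (mdeg m)"
    using anti by (auto simp: partitions_def sorted_wrt_iff_nth_less)
  then show ?thesis using rl by (rule that)
qed

text \<open>
  Exchanging two entries of \<open>m\<close> that form an ascent lowers the weight $\sum_i i\, m_i$, and
      if \<open>m\<close> is
  a partition then so does passing to any other term of its determinantal formula.
\<close>
theorem fixed_colorings_irr_char_span:
  assumes "mdeg m = n"
  shows "\<exists>a. \<forall>w \<in> Sym n. int (fixed_colorings n (mon_int m) w) =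
      (\<Sum>nu \<in> partitions n. a nu * irr_char n nu w)"
  using assms
proof (induction "mon_weight m" arbitrary: m rule: less_induct)
  case (less m)
  show ?case
  proof (cases "\<forall>i. Poly_Mapping.lookup m (Suc i) \<le> Poly_Mapping.lookup m i")
    case False
    then obtain i where i: "Poly_Mapping.lookup m i < Poly_Mapping.lookup m (Suc i)"
        by (auto simp: not_le)
    let ?m = "mact \<langle>i \<leftrightarrow> Suc i\<rangle> m"
    have "mdeg ?m = n" using less.prems by simp
    from less.hyps[OF mon_weight_swap[OF i] this] obtain a where
      a: "\<forall>w \<in> Sym n. int (fixed_colorings n (mon_int ?m) w) =
          (\<Sum>nu \<in> partitions n. a nu * irr_char n nu w)" ..
    have "fixed_colorings n (mon_int ?m) w = fixed_colorings n (mon_int m) w" if "w \<in> Sym n" for w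
    proof -
      have "mon_int ?m = (\<lambda>k. mon_int m (transpose i (Suc i) k))" by (simp add: apply_swap)
      then show ?thesis using fixed_colorings_relabel[of "transpose i (Suc i)" w n "mon_int m"]
          that by simp
    qed
    then show ?thesis using a by auto
  next
    case True
    then obtain mu where mu: "mu \<in> partitions n" "Poly_Mapping.lookup m = row_len mu"
      using decreasing_mon_partition[of m] less.prems by auto
    let ?P = "{p. p permutes {..<length mu}}"
    have ex: "\<exists>a. \<forall>w \<in> Sym n. int (fixed_colorings n (row_vec mu p) w) =
        (\<Sum>nu \<in> partitions n. a nu * irr_char n nu w)"
      if p: "p \<in> ?P - {id}" for p
    proof (cases "\<forall>i. row_vec mu p i \<ge> 0")
      case True
      obtain m' where m': "mon_int m' = row_vec mu p"
          "int (mdeg m') = (\<Sum>i<length mu. row_vec mu p i)"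
        by (rule nonneg_mon[of "row_vec mu p" "length mu"]) (use True in \<open>auto simp: row_vec_def\<close>)
      have "mdeg m' = n" using m'(2) sum_row_vec[OF mu(1), of p] p by simp
      moreover have "mon_weight m' < mon_weight m"
        using p by (intro mon_weight_row_vec[OF mu(2) _ _ m'(1)]) auto
      ultimately show ?thesis using less.hyps[of m'] unfolding m'(1) by blast
    next
      case False
      then obtain i where "row_vec mu p i < 0" by (auto simp: not_le)
      then have "fixed_colorings n (row_vec mu p) w = 0" for w by (rule fixed_colorings_negative)
      then show ?thesis by (intro exI[of _ "\<lambda>_. 0"]) simp
    qed
    define a where "a p = (SOME a. \<forall>w \<in> Sym n. int (fixed_colorings n (row_vec mu p) w) =
        (\<Sum>nu \<in> partitions n. a nu * irr_char n nu w))" for p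
    have a: "int (fixed_colorings n (row_vec mu p) w) =
        (\<Sum>nu \<in> partitions n. a p nu * irr_char n nu w)"
      if "p \<in> ?P - {id}" "w \<in> Sym n" for p w
      using someI_ex[OF ex[OF that(1)]] that(2) unfolding a_def by blast
    \<comment> \<open>The determinantal formula for \<open>mu\<close> solved for its term at
      \<open>id\<close>, whose content is that of \<open>m\<close> itself.\<close>
    let ?a = "\<lambda>nu. (if nu = mu then 1 else 0) - (\<Sum>p \<in> ?P - {id}. sign p * a p nu)"
    have "int (fixed_colorings n (mon_int m) w) = (\<Sum>nu \<in> partitions n. ?a nu * irr_char n nu w)"
        if w: "w \<in> Sym n" for w
    proof -
      have "irr_char n mu w = sign id * int (fixed_colorings n (row_vec mu id) w) +
          (\<Sum>p \<in> ?P - {id}. sign p * int (fixed_colorings n (row_vec mu p) w))"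
        using sum.remove[of ?P id "\<lambda>p. sign p * int (fixed_colorings n (row_vec mu p) w)"]
        by (simp add: irr_char_def finite_permutations permutes_id)
      then have "int (fixed_colorings n (mon_int m) w) =
          irr_char n mu w - (\<Sum>p \<in> ?P - {id}. sign p * int (fixed_colorings n (row_vec mu p) w))"
        by (simp add: row_vec_id mu(2) sign_id)
      also have "(\<Sum>p \<in> ?P - {id}. sign p * int (fixed_colorings n (row_vec mu p) w)) =
          (\<Sum>p \<in> ?P - {id}. \<Sum>nu \<in> partitions n. sign p * a p nu * irr_char n nu w)"
        by (rule sum.cong) (simp_all add: a w sum_distrib_left mult.assoc)
      also have "\<dots> = (\<Sum>nu \<in> partitions n. (\<Sum>p \<in> ?P - {id}. sign p * a p nu) * irr_char n nu w)"
        by (subst sum.swap) (simp add: sum_distrib_right)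
      also have "irr_char n mu w = (\<Sum>nu \<in> partitions n.
          (if nu = mu then 1 else 0) * irr_char n nu w)"
        using mu(1) by (subst sum.mono_neutral_right[of _ "{mu}"]) (auto simp: finite_partitions)
      finally show ?thesis by (simp only: left_diff_distrib sum_subtractf)
    qed
    then show ?thesis by (intro exI[of _ ?a] ballI)
  qed
qed

text \<open>The content with \<open>n\<close> colours used once each: only the identity fixes such a
  colouring, and there are as many colourings as group elements, so the permutation character is the
  regular one.\<close>

lemma regular_irr_char_span:
  "\<exists>a. \<forall>w \<in> Sym n. (\<Sum>nu \<in> partitions n. a nu * irr_char n nu w) =
      (if w = 1 then int (card (Sym n)) else 0)"
proof -
  define m :: mon where "m = (\<Sum>i<n. Poly_Mapping.single i 1)"
  have lk: "Poly_Mapping.lookup m k = (if k < n then 1 else 0)" for k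
    by (simp add: m_def lookup_sum lookup_single when_def)
  have keys: "Poly_Mapping.keys m \<subseteq> {..<n}" by (auto simp: in_keys_iff lk split: if_splits)
  have deg: "mdeg m = n" by (simp add: mdeg_superset[OF _ keys] lk)
  have id: "restrict (\<lambda>x. x) {..<n} \<in> colorings n (mon_int m)"
  proof -
    have "{x. x < n \<and> restrict (\<lambda>x. x) {..<n} x = k} = (if k < n then {k} else {})" for k by auto
    then show ?thesis by (simp add: colorings_def lk)
  qed
  have inj: "x = y" if c: "c \<in> colorings n (mon_int m)" and xy: "x < n" "y < n" "c x = c y"
      for c x y
  proof -
    have "int (card {z. z < n \<and> c z = c x}) \<le> 1" using c by (auto simp: colorings_def lk)
    then have "card {z. z < n \<and> c z = c x} \<le> Suc 0" by simp
    then have "\<forall>a \<in> {z. z < n \<and> c z = c x}. \<forall>b \<in> {z. z < n \<and> c z = c x}. a = b"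
      by (rule card_le_Suc0_iff_eq[THEN iffD1, rotated]) simp
    from bspec[OF bspec[OF this, of x], of y] xy show ?thesis by simp
  qed
  have zero: "fixed_colorings n (mon_int m) w = 0" if w: "w \<in> Sym n" "w \<noteq> 1" for w
  proof -
    obtain x where x: "x < n" "w \<langle>$\<rangle> x \<noteq> x"
      using Sym_eqI[OF w(1) Sym_one] w(2) by auto
    have "\<not> fixes_coloring n w c" if "c \<in> colorings n (mon_int m)" for c
      using inj[OF that, of "w \<langle>$\<rangle> x" x] x Sym_less[OF w(1)] by (auto simp: fixes_coloring_def)
    then show ?thesis by (simp add: fixed_colorings_def)
  qed
  have "(\<Sum>w \<in> Sym n. fixed_colorings n (mon_int m) w) = card (Sym n)"
    using id by (intro sum_fixed_colorings) auto
  also have "(\<Sum>w \<in> Sym n. fixed_colorings n (mon_int m) w) = fixed_colorings n (mon_int m) 1"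
    using zero by (subst sum.mono_neutral_right[of _ "{1}"]) (auto simp: finite_Sym Sym_one)
  finally have one: "fixed_colorings n (mon_int m) 1 = card (Sym n)" .
  obtain a where a: "\<forall>w \<in> Sym n. int (fixed_colorings n (mon_int m) w) =
      (\<Sum>nu \<in> partitions n. a nu * irr_char n nu w)"
    using fixed_colorings_irr_char_span[OF deg] ..
  show ?thesis
  proof (intro exI[of _ a] ballI)
    fix w assume w: "w \<in> Sym n"
    show "(\<Sum>nu \<in> partitions n. a nu * irr_char n nu w) = (if w = 1 then int (card (Sym n)) else 0)"
      using bspec[OF a w, symmetric] zero[OF w] one by simp
  qed
qed


section \<open>Young symmetrizers\<close>

definition cf :: "alg \<Rightarrow> nat perm \<Rightarrow> complex" where
  "cf x w = Poly_Mapping.lookup x (XW 0 w)"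

lemma lookup_scal [simp]: "Poly_Mapping.lookup (scal c * f) k = c * Poly_Mapping.lookup f k"
proof -
  have "scal c * f = Poly_Mapping.map ((*) c) f" unfolding scal_def
      by (rule mult_map_scale_conv_mult[symmetric])
  then show ?thesis by (simp add: Poly_Mapping.map.rep_eq when_def)
qed

lemma scal_mult: "scal a * scal b = scal (a * b)"
  by (simp add: scal_def mult_single)

lemma scal_one [simp]: "scal 1 = 1"
  by (simp add: scal_def)

lemma scal_add: "scal (a + b) = scal a + scal b"
  by (simp add: scal_def single_add)

lemma scal_zero [simp]: "scal 0 = 0"
  by (simp add: scal_def)

lemma scal_left_commute: "x * (scal c * y) = scal c * (x * y)"
  by (metis mult.assoc scal_commute)

lemma scal_gperm: "scal c * gperm w = Poly_Mapping.single (XW 0 w) c"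
  by (simp add: scal_def gperm_def mult_single)

lemma gperm_one [simp]: "gperm 1 = 1"
  by (metis gperm_def single_one zero_xw_def)

lemma cf_scal [simp]: "cf (scal c * x) w = c * cf x w"
  by (simp add: cf_def)

lemma cf_add [simp]: "cf (x + y) w = cf x w + cf y w"
  by (simp add: cf_def lookup_add)

lemma cf_sum: "cf (sum f I) w = (\<Sum>i \<in> I. cf (f i) w)"
  by (simp add: cf_def lookup_sum)

lemma cf_zero [simp]: "cf 0 w = 0"
  by (simp add: cf_def)

lemma cf_gperm [simp]: "cf (gperm v) w = (if v = w then 1 else 0)"
  by (simp add: cf_def gperm_def lookup_single when_def)

lemma CSn_zero [simp]: "0 \<in> CSn n"
  by (simp add: CSn_def)

lemma CSn_add: "x \<in> CSn n \<Longrightarrow> y \<in> CSn n \<Longrightarrow> x + y \<in> CSn n"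
  using Poly_Mapping.keys_add[of x y] by (auto simp: CSn_def)

lemma CSn_sum: "(\<And>i. i \<in> I \<Longrightarrow> f i \<in> CSn n) \<Longrightarrow> sum f I \<in> CSn n"
  by (induction I rule: infinite_finite_induct) (auto intro: CSn_add)

lemma CSn_mult: "x \<in> CSn n \<Longrightarrow> y \<in> CSn n \<Longrightarrow> x * y \<in> CSn n"
  unfolding CSn_def by (auto elim!: keys_xw_mult simp: plus_xw_def Sym_mult)

lemma CSn_gperm: "w \<in> Sym n \<Longrightarrow> gperm w \<in> CSn n"
  by (simp add: CSn_def gperm_def)

lemma CSn_scal: "scal c \<in> CSn n"
  by (simp add: CSn_def scal_def zero_xw_def Sym_one)

lemma CSn_one: "1 \<in> CSn n"
  using CSn_scal[of 1] by simp

lemma cf_outside: "x \<in> CSn n \<Longrightarrow> w \<notin> Sym n \<Longrightarrow> cf x w = 0"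
  by (auto simp: cf_def CSn_def in_keys_iff dest!: bspec[of _ _ "XW 0 w"])

lemma CSn_expand:
  assumes "x \<in> CSn n"
  shows "x = (\<Sum>w \<in> Sym n. scal (cf x w) * gperm w)"
proof (rule poly_mapping_eqI)
  fix b
  obtain m w where b: "b = XW m w" by (cases b)
  have "Poly_Mapping.lookup (\<Sum>w \<in> Sym n. scal (cf x w) * gperm w) b =
      (\<Sum>v \<in> Sym n. if v = w then (if m = 0 then cf x w else 0) else 0)"
    unfolding lookup_sum scal_gperm by (rule sum.cong) (auto simp: lookup_single when_def b)
  also have "\<dots> = (if w \<in> Sym n \<and> m = 0 then cf x w else 0)" by (simp add: finite_Sym)
  also have "\<dots> = Poly_Mapping.lookup x b"
    using assms by (auto simp: b cf_def CSn_def in_keys_iff dest!: bspec[of _ _ b])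
  finally show "Poly_Mapping.lookup x b = Poly_Mapping.lookup
      (\<Sum>w \<in> Sym n. scal (cf x w) * gperm w) b" ..
qed

lemma CSn_eqI:
  assumes "x \<in> CSn n" "y \<in> CSn n" "\<And>w. w \<in> Sym n \<Longrightarrow> cf x w = cf y w"
  shows "x = y"
  by (subst CSn_expand[OF assms(1)], subst CSn_expand[OF assms(2)]) (simp add: assms(3))

lemma perm_eq_cancel: "u * v = w \<longleftrightarrow> v = inverse u * (w :: 'a perm)"
  by (metis perm_cancel)

lemma perm_eq_cancel_right: "u * v = w \<longleftrightarrow> u = w * inverse (v :: 'a perm)"
  by (metis mult.assoc mult.right_neutral perm.left_inverse perm.right_inverse)

lemma cf_gperm_left:
  assumes x: "x \<in> CSn n" and u: "u \<in> Sym n" shows "cf (gperm u * x) w = cf x (inverse u * w)"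
proof (cases "w \<in> Sym n")
  case True
  have "gperm u * x = (\<Sum>v \<in> Sym n. scal (cf x v) * gperm (u * v))"
    by (subst CSn_expand[OF x]) (simp add: sum_distrib_left scal_left_commute gperm_mult)
  then have "cf (gperm u * x) w = (\<Sum>v \<in> Sym n. if v = inverse u * w then cf x v else 0)"
    by (simp add: cf_sum perm_eq_cancel if_distrib cong: if_cong)
  also have "\<dots> = cf x (inverse u * w)" using True u by (simp add: finite_Sym Sym_mult Sym_inverse)
  finally show ?thesis .
next
  case False
  then have "inverse u * w \<notin> Sym n" using u Sym_mult[of u n "inverse u * w"] by auto
  then show ?thesis
    using False cf_outside x cf_outside[OF CSn_mult[OF CSn_gperm[OF u] x]] by simp
qed

lemma cf_gperm_right:
  assumes x: "x \<in> CSn n" and u: "u \<in> Sym n" shows "cf (x * gperm u) w = cf x (w * inverse u)"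
proof (cases "w \<in> Sym n")
  case True
  have "x * gperm u = (\<Sum>v \<in> Sym n. scal (cf x v) * gperm (v * u))"
    by (subst CSn_expand[OF x]) (simp add: sum_distrib_right mult.assoc gperm_mult)
  then have "cf (x * gperm u) w = (\<Sum>v \<in> Sym n. if v = w * inverse u then cf x v else 0)"
    by (simp add: cf_sum perm_eq_cancel_right if_distrib cong: if_cong)
  also have "\<dots> = cf x (w * inverse u)" using True u by (simp add: finite_Sym Sym_mult Sym_inverse)
  finally show ?thesis .
next
  case False
  then have "w * inverse u \<notin> Sym n" using u Sym_mult[of "w * inverse u" n u]
      by (auto simp: mult.assoc)
  then show ?thesis
    using False cf_outside x cf_outside[OF CSn_mult[OF x CSn_gperm[OF u]]] by simp
qed

lemma cf_mult:
  assumes "x \<in> CSn n" "y \<in> CSn n"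
  shows "cf (x * y) w = (\<Sum>u \<in> Sym n. cf x u * cf y (inverse u * w))"
proof -
  have "x * y = (\<Sum>u \<in> Sym n. scal (cf x u) * (gperm u * y))"
    by (subst CSn_expand[OF assms(1)]) (simp add: sum_distrib_right mult.assoc)
  then show ?thesis using assms(2) by (simp add: cf_sum cf_gperm_left)
qed

lemma cf_mult_right:
  assumes "x \<in> CSn n" "y \<in> CSn n"
  shows "cf (x * y) w = (\<Sum>u \<in> Sym n. cf x (w * inverse u) * cf y u)"
proof -
  have "x * y = (\<Sum>u \<in> Sym n. scal (cf y u) * (x * gperm u))"
    by (subst CSn_expand[OF assms(2)]) (simp add: sum_distrib_left scal_left_commute)
  then show ?thesis using assms(1) by (simp add: cf_sum cf_gperm_right mult.commute)
qed

text \<open>The value at \<open>w\<close> of the character of the left ideal generated by an idempotent \<open>x\<close>.\<close>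
definition class_sum :: "nat \<Rightarrow> alg \<Rightarrow> nat perm \<Rightarrow> complex" where
  "class_sum n x w = (\<Sum>v \<in> Sym n. cf x (inverse v * inverse w * v))"

lemma class_sum_scal: "class_sum n (scal c * x) w = c * class_sum n x w"
  by (simp add: class_sum_def sum_distrib_left)

text \<open>The trace property, later used to compare idempotents of the form x y and y x. After
  replacing \<open>v\<close> by \<open>v * u\<close> the two convolution sums coincide.\<close>

lemma class_sum_commute:
  assumes x: "x \<in> CSn n" and y: "y \<in> CSn n" and w: "w \<in> Sym n"
  shows "class_sum n (x * y) w = class_sum n (y * x) w"
proof -
  have "class_sum n (x * y) w =
      (\<Sum>v \<in> Sym n. \<Sum>u \<in> Sym n. cf x (inverse v * inverse w * v * inverse u) * cf y u)"
    by (simp add: class_sum_def cf_mult_right[OF x y])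
  also have "\<dots> = (\<Sum>u \<in> Sym n. \<Sum>v \<in> Sym n. cf x (inverse v * inverse w * v * inverse u) * cf y u)"
    by (rule sum.swap)
  also have "\<dots> = (\<Sum>u \<in> Sym n. \<Sum>v \<in> Sym n. cf y u * cf x (inverse u * (inverse v * inverse w * v)))"
  proof (rule sum.cong[OF refl])
    fix u assume u: "u \<in> Sym n"
    have "(\<Sum>v \<in> Sym n. cf x (inverse v * inverse w * v * inverse u) * cf y u) =
        (\<Sum>v \<in> Sym n. cf x (inverse (v * u) * inverse w * (v * u) * inverse u) * cf y u)"
      using sum_Sym_right[OF u, of "\<lambda>v. cf x (inverse v * inverse w * v * inverse u) * cf y u"]
          by simp
    also have "\<dots> = (\<Sum>v \<in> Sym n. cf y u * cf x (inverse u * (inverse v * inverse w * v)))"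
      by (simp add: mult.assoc mult.commute[of _ "cf y u"])
    finally show "(\<Sum>v \<in> Sym n. cf x (inverse v * inverse w * v * inverse u) * cf y u) =
        (\<Sum>v \<in> Sym n. cf y u * cf x (inverse u * (inverse v * inverse w * v)))" .
  qed
  also have "\<dots> = (\<Sum>v \<in> Sym n. \<Sum>u \<in> Sym n. cf y u * cf x (inverse u * (inverse v * inverse w * v)))"
    by (rule sum.swap)
  also have "\<dots> = class_sum n (y * x) w"
    by (simp add: class_sum_def cf_mult[OF y x])
  finally show ?thesis .
qed

text \<open>Each conjugation in \<open>class_sum\<close> can be moved onto the class function
  \<open>f\<close>, where it disappears, so every \<open>v\<close> gives the same sum. Invariance of
  \<open>f\<close> under inversion absorbs the \<open>inverse w\<close> in
  \<open>class_sum\<close>.\<close>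

lemma sum_class_sum:
  assumes f: "\<And>v w. v \<in> Sym n \<Longrightarrow> w \<in> Sym n \<Longrightarrow> f (inverse v * w * v) = f w"
    and f': "\<And>w. w \<in> Sym n \<Longrightarrow> f (inverse w) = f w"
  shows "(\<Sum>w \<in> Sym n. class_sum n x w * f w) = of_nat (card (Sym n)) * (\<Sum>w \<in> Sym n. cf x w * f w)"
proof -
  have conj: "(\<Sum>w \<in> Sym n. cf x (inverse v * inverse w * v) * f w) = (\<Sum>w \<in> Sym n. cf x w * f w)"
    if v: "v \<in> Sym n" for v
  proof -
    have "(\<Sum>w \<in> Sym n. cf x (inverse v * inverse w * v) * f w) =
        (\<Sum>w \<in> Sym n. cf x (inverse v * inverse w * v) * f (inverse v * inverse w * v))"
      using v by (intro sum.cong refl) (simp add: f f' Sym_inverse)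
    also have "\<dots> = (\<Sum>w \<in> Sym n. cf x w * f w)"
      by (rule sum.reindex_bij_witness[where j = "\<lambda>w. inverse v * inverse w * v" and i =
          "\<lambda>w. v * inverse w * inverse v"])
        (use v in \<open>auto simp: Sym_mult Sym_inverse mult.assoc\<close>)
    finally show ?thesis .
  qed
  have "(\<Sum>w \<in> Sym n. class_sum n x w * f w) =
      (\<Sum>v \<in> Sym n. \<Sum>w \<in> Sym n. cf x (inverse v * inverse w * v) * f w)"
    unfolding class_sum_def sum_distrib_right by (rule sum.swap)
  then show ?thesis by (simp add: conj)
qed


section \<open>Signed sums over stabilizers and the combinatorics of a tableau\<close>

definition stab :: "nat \<Rightarrow> (nat \<Rightarrow> 'c) \<Rightarrow> nat perm set" where
  "stab n f = {w \<in> Sym n. fixes_coloring n w f}"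

text \<open>Linear characters with values 1 and -1. The trivial one gives the row sum and the sign
  the column sum, so that both are treated together.\<close>

definition sq_char :: "(nat perm \<Rightarrow> complex) \<Rightarrow> bool" where
  "sq_char ch \<longleftrightarrow> (\<forall>v w. ch (v * w) = ch v * ch w) \<and> (\<forall>v. ch v * ch v = 1)"

definition char_sum :: "nat perm set \<Rightarrow> (nat perm \<Rightarrow> complex) \<Rightarrow> alg" where
  "char_sum S ch = (\<Sum>w \<in> S. scal (ch w) * gperm w)"

lemma stab_Sym: "w \<in> stab n f \<Longrightarrow> w \<in> Sym n"
  by (simp add: stab_def)

lemma finite_stab [simp]: "finite (stab n f)"
  using finite_Sym[of n] by (simp add: stab_def)

lemma stab_mult: "v \<in> stab n f \<Longrightarrow> w \<in> stab n f \<Longrightarrow> v * w \<in> stab n f"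
  by (simp add: stab_def fixes_coloring_def Sym_mult apply_times Sym_less)

lemma stab_inverse: "w \<in> stab n f \<Longrightarrow> inverse w \<in> stab n f"
  by (simp add: stab_def fixes_coloring_inverse Sym_inverse)

lemma stab_one: "1 \<in> stab n f"
  by (simp add: stab_def fixes_coloring_def Sym_one)

lemma stab_mult_left_iff: "v \<in> stab n f \<Longrightarrow> v * w \<in> stab n f \<longleftrightarrow> w \<in> stab n f"
  by (metis perm_cancel(1) stab_inverse stab_mult)

lemma stab_mult_right_iff: "v \<in> stab n f \<Longrightarrow> w * v \<in> stab n f \<longleftrightarrow> w \<in> stab n f"
  by (metis mult.assoc mult.right_neutral perm.right_inverse stab_inverse stab_mult)

lemma swap_stab:
  assumes "x < n" "y < n" "f x = f y" shows "\<langle>x \<leftrightarrow> y\<rangle> \<in> stab n f"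
  using assms by (auto simp: stab_def swap_Sym fixes_coloring_def apply_swap transpose_def)

lemma sq_char_mult: "sq_char ch \<Longrightarrow> ch (v * w) = ch v * ch w"
  and sq_char_sq: "sq_char ch \<Longrightarrow> ch v * ch v = 1"
  by (simp_all add: sq_char_def)

lemma sq_char_one: "sq_char ch \<Longrightarrow> ch 1 = 1"
  using sq_char_mult[of ch 1 1] sq_char_sq[of ch 1] by simp

lemma sq_char_inverse:
  assumes "sq_char ch" shows "ch (inverse v) = ch v"
proof -
  have "ch (inverse v) = ch (inverse v) * (ch v * ch v)" by (simp add: sq_char_sq assms)
  also have "\<dots> = ch (inverse v * v) * ch v" by (simp only: sq_char_mult[OF assms] mult.assoc)
  finally show ?thesis by (simp add: sq_char_one assms)
qed

lemma sq_char_trivial: "sq_char (\<lambda>_. 1)"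
  by (simp add: sq_char_def)

lemma sq_char_sign: "sq_char (\<lambda>w. of_int (sign (apply w)))"
  by (simp add: sq_char_def sign_mult flip: of_int_mult)

lemma char_sum_CSn [simp]: "char_sum (stab n f) ch \<in> CSn n"
  unfolding char_sum_def by (auto intro!: CSn_sum CSn_mult CSn_scal CSn_gperm stab_Sym)

lemma cf_char_sum: "cf (char_sum (stab n f) ch) w = (if w \<in> stab n f then ch w else 0)"
proof -
  have "cf (char_sum (stab n f) ch) w = (\<Sum>v \<in> stab n f. if v = w then ch w else 0)"
    unfolding char_sum_def cf_sum by (rule sum.cong) auto
  then show ?thesis by simp
qed

lemma char_sum_gperm:
  assumes ch: "sq_char ch" and v: "v \<in> stab n f"
  shows "gperm v * char_sum (stab n f) ch = scal (ch v) * char_sum (stab n f) ch"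
    and "char_sum (stab n f) ch * gperm v = scal (ch v) * char_sum (stab n f) ch"
proof -
  note mem = CSn_mult CSn_gperm CSn_scal stab_Sym[OF v] char_sum_CSn
  show "gperm v * char_sum (stab n f) ch = scal (ch v) * char_sum (stab n f) ch"
    by (rule CSn_eqI[of _ n]) (simp_all add: mem cf_gperm_left[of _ n] cf_char_sum
        stab_mult_left_iff[OF stab_inverse[OF v]] sq_char_mult[OF ch] sq_char_inverse[OF ch])
  show "char_sum (stab n f) ch * gperm v = scal (ch v) * char_sum (stab n f) ch"
    by (rule CSn_eqI[of _ n]) (simp_all add: mem cf_gperm_right[of _ n] cf_char_sum
        stab_mult_right_iff[OF stab_inverse[OF v]] sq_char_mult[OF ch] sq_char_inverse[OF ch])
qed

lemma scal_sum: "scal (\<Sum>i \<in> I. f i) = (\<Sum>i \<in> I. scal (f i))"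
  by (induction I rule: infinite_finite_induct) (simp_all add: scal_add)

lemma char_sum_sq:
  assumes ch: "sq_char ch"
  shows "char_sum (stab n f) ch * char_sum (stab n f) ch =
      scal (of_nat (card (stab n f))) * char_sum (stab n f) ch"
proof -
  let ?S = "char_sum (stab n f) ch"
  have "?S * ?S = (\<Sum>w \<in> stab n f. scal (ch w) * (gperm w * ?S))"
    by (subst (1) char_sum_def) (simp add: sum_distrib_right mult.assoc)
  also have "\<dots> = (\<Sum>w \<in> stab n f. scal 1 * ?S)"
    by (rule sum.cong) (simp_all add: char_sum_gperm[OF ch] scal_mult sq_char_sq[OF ch] del:
        scal_one flip: mult.assoc)
  also have "\<dots> = scal (of_nat (card (stab n f))) * ?S"
    using scal_sum[of "\<lambda>_. 1" "stab n f"] by (simp add: sum_distrib_right[symmetric] del: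
        sum_constant) simp
  finally show ?thesis .
qed

text \<open>\<open>r x\<close> and \<open>c x\<close> are the row and the column of the box numbered \<open>x\<close>.\<close>
locale tableau =
  fixes n :: nat and r c :: "nat \<Rightarrow> nat"
  assumes box_inj: "x < n \<Longrightarrow> y < n \<Longrightarrow> r x = r y \<Longrightarrow> c x = c y \<Longrightarrow> x = y"
    and box_down: "x < n \<Longrightarrow> i < r x \<Longrightarrow> \<exists>y < n. c y = c x \<and> r y = i"
begin

abbreviation "sgn_of w \<equiv> complex_of_int (sign (apply w))"

definition rsum :: alg where "rsum = char_sum (stab n r) (\<lambda>_. 1)"
definition csum :: alg where "csum = char_sum (stab n c) (\<lambda>w. sgn_of w)"
definition ysym :: alg where "ysym = rsum * csum"

lemma rsum_CSn [simp]: "rsum \<in> CSn n" and csum_CSn [simp]: "csum \<in> CSn n"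
    and ysym_CSn [simp]: "ysym \<in> CSn n"
  unfolding ysym_def rsum_def csum_def by (intro CSn_mult char_sum_CSn)+

lemma stab_disjoint:
  assumes "w \<in> stab n r" "w \<in> stab n c" shows "w = 1"
proof (rule Sym_eqI[of _ n])
  fix x assume x: "x < n"
  have "w \<langle>$\<rangle> x = x"
  proof (rule box_inj)
    have w: "w \<in> Sym n" "fixes_coloring n w r" "fixes_coloring n w c" using assms
        by (simp_all add: stab_def)
    show "w \<langle>$\<rangle> x < n" using w(1) x by (rule Sym_less)
    show "r (w \<langle>$\<rangle> x) = r x" "c (w \<langle>$\<rangle> x) = c x" using w(2,3) x
        by (simp_all add: fixes_coloring_def)
  qed (rule x)
  then show "w \<langle>$\<rangle> x = 1 \<langle>$\<rangle> x" by simp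
qed (use assms in \<open>simp_all add: stab_def Sym_one\<close>)

text \<open>
  In each column the \<open>r\<close>-values form an initial segment of the natural numbers, so among all
  labellings that are injective on columns \<open>r\<close> has the most labels below any given bound.
\<close>
definition column_injective :: "(nat \<Rightarrow> nat) \<Rightarrow> bool" where
  "column_injective d \<longleftrightarrow> (\<forall>x y. x < n \<and> y < n \<and> c x = c y \<and> d x = d y \<longrightarrow> x = y)"

lemma column_injectiveD:
  "column_injective d \<Longrightarrow> x < n \<Longrightarrow> y < n \<Longrightarrow> c x = c y \<Longrightarrow> d x = d y \<Longrightarrow> x = y"
  unfolding column_injective_def by blast

text \<open>If column \<open>j\<close> has a box in row \<open>k\<close> or lower, it contains the
  rows 0, ..., k-1, so the right side is at least \<open>k\<close>, while \<open>d\<close> is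
  injective on the column and has at most \<open>k\<close> values to use. Otherwise the right side
  counts the whole column.\<close>

lemma column_count:
  assumes d: "column_injective d"
  shows "card {x. x < n \<and> c x = j \<and> d x < k} \<le> card {x. x < n \<and> c x = j \<and> r x < k}"
proof (cases "\<exists>z < n. c z = j \<and> k \<le> r z")
  case True
  then obtain z where z: "z < n" "c z = j" "k \<le> r z" by auto
  have "{..<k} \<subseteq> r ` {x. x < n \<and> c x = j \<and> r x < k}"
  proof
    fix i assume "i \<in> {..<k}"
    then have "i < k" by simp
    then obtain y where "y < n" "c y = j" "r y = i" using box_down[OF z(1), of i] z by auto
    then show "i \<in> r ` {x. x < n \<and> c x = j \<and> r x < k}" using \<open>i < k\<close> by auto
  qed
  then have "card {..<k} \<le> card {x. x < n \<and> c x = j \<and> r x < k}"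
    by (rule surj_card_le[rotated]) simp
  then have "k \<le> card {x. x < n \<and> c x = j \<and> r x < k}" by simp
  moreover have "card {x. x < n \<and> c x = j \<and> d x < k} \<le> card {..<k}"
  proof (rule card_inj_on_le)
    show "inj_on d {x. x < n \<and> c x = j \<and> d x < k}"
    proof (rule inj_onI)
      fix x y assume "x \<in> {x. x < n \<and> c x = j \<and> d x < k}" "y \<in> {x. x < n \<and> c x = j \<and> d x < k}"
          "d x = d y"
      then show "x = y" using column_injectiveD[OF d, of x y] by simp
    qed
  qed auto
  ultimately show ?thesis by simp
next
  case False
  then have "{x. x < n \<and> c x = j \<and> d x < k} \<subseteq> {x. x < n \<and> c x = j \<and> r x < k}" by (auto simp: not_le)
  then show ?thesis by (rule card_mono[rotated]) simp
qed

lemma card_by_column: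
  "card {x. x < n \<and> d x < k} = (\<Sum>j \<in> c ` {..<n}. card {x. x < n \<and> c x = j \<and> d x < (k :: nat)})"
proof -
  have "(\<Sum>j \<in> c ` {..<n}. sum (\<lambda>_. 1 :: nat) {x \<in> {x. x < n \<and> d x < k}. c x = j}) =
      sum (\<lambda>_. 1) {x. x < n \<and> d x < k}"
    by (intro sum.group) auto
  moreover have "{x \<in> {x. x < n \<and> d x < k}. c x = j} = {x. x < n \<and> c x = j \<and> d x < k}" for j by auto
  ultimately show ?thesis by simp
qed

lemma column_injective_dominance:
  assumes "column_injective d" shows "card {x. x < n \<and> d x < k} \<le> card {x. x < n \<and> r x < k}"
  unfolding card_by_column by (intro sum_mono column_count assms)

text \<open>The equality case of the dominance: termwise inequalities with equal sums are
  equalities, so \<open>d\<close> and \<open>r\<close> use the same labels in every column. The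
  colourings by pairs \<open>(d, c)\<close> and \<open>(r, c)\<close> then have one content, and a
  permutation relating them preserves columns.\<close>

lemma column_injective_stab:
  assumes d: "column_injective d" and cnt: "\<And>k. card {x. x < n \<and> d x < k} =
      card {x. x < n \<and> r x < k}"
  obtains s where "s \<in> stab n c" "\<And>x. x < n \<Longrightarrow> d x = r (s \<langle>$\<rangle> x)"
proof -
  have eq: "card {x. x < n \<and> c x = j \<and> d x < k} = card {x. x < n \<and> c x = j \<and> r x < k}"
    if "j \<in> c ` {..<n}" for j k
    using sum_mono_inv[OF _ column_count[OF d], of "\<lambda>j. j" "\<lambda>_. k" "c ` {..<n}" j] that cnt[of k]
    unfolding card_by_column by simp
  have diff: "card {x. x < n \<and> g x = (i, j)} =
      card {x. x < n \<and> snd (g x) = j \<and> fst (g x) < Suc i} - card {x. x < n \<and> snd (g x) = j \<and>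
          fst (g x) < i}"
    for g :: "nat \<Rightarrow> nat \<times> nat" and i j
  proof -
    have e: "{x. x < n \<and> g x = (i, j)} = {x. x < n \<and> snd (g x) = j \<and>
        fst (g x) < Suc i} - {x. x < n \<and> snd (g x) = j \<and> fst (g x) < i}"
      by (auto simp: prod_eq_iff)
    show ?thesis unfolding e by (rule card_Diff_subset) auto
  qed
  have cc: "col_content n (\<lambda>x. (d x, c x)) (i, j) = col_content n (\<lambda>x. (r x, c x)) (i, j)" for i j
  proof (cases "j \<in> c ` {..<n}")
    case True
    have "card {x. x < n \<and> (d x, c x) = (i, j)} = card {x. x < n \<and> (r x, c x) = (i, j)}"
      by (simp only: diff[of "\<lambda>x. (d x, c x)" i j] diff[of "\<lambda>x. (r x, c x)" i j] fst_conv snd_conv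
          eq[OF True])
    then show ?thesis by (simp only: col_content_def)
  next
    case False
    then have "{x. x < n \<and> (d x, c x) = (i, j)} = {}" "{x. x < n \<and> (r x, c x) = (i, j)} = {}"
        by auto
    then show ?thesis unfolding col_content_def by (simp only:)
  qed
  let ?D = "\<lambda>x \<in> {..<n}. (d x, c x)" and ?R = "\<lambda>x \<in> {..<n}. (r x, c x)"
  have D: "?D \<in> colorings n (col_content n (\<lambda>x. (d x, c x)))"
      and R: "?R \<in> colorings n (col_content n (\<lambda>x. (r x, c x)))"
    by (auto simp: colorings_content intro!: content_cong)
  have "col_content n (\<lambda>x. (d x, c x)) = col_content n (\<lambda>x. (r x, c x))"
    using cc by (intro ext) (metis surj_pair)
  with D have D': "?D \<in> colorings n (col_content n (\<lambda>x. (r x, c x)))" by (simp only:)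
  obtain s where s: "s \<in> Sym n" "\<And>x. x < n \<Longrightarrow> ?D x = ?R (s \<langle>$\<rangle> x)"
    by (rule colorings_transitive[OF D' R], rule that)
  have "d x = r (s \<langle>$\<rangle> x)" "c x = c (s \<langle>$\<rangle> x)" if "x < n" for x
    using s(2)[OF that] that Sym_less[OF s(1) that] by simp_all
  moreover from this have "s \<in> stab n c" using s(1) by (simp add: stab_def fixes_coloring_def)
  ultimately show ?thesis by (intro that)
qed

end


lemma sum_real_squares_zero:
  fixes f :: "'i \<Rightarrow> complex"
  assumes "finite I" "\<And>i. i \<in> I \<Longrightarrow> f i \<in> \<real>" "(\<Sum>i \<in> I. f i * f i) = 0" "i \<in> I"
  shows "f i = 0"
proof -
  have re: "f j = complex_of_real (Re (f j))" if "j \<in> I" for j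
    using assms(2)[OF that] by (simp add: complex_is_Real_iff complex_eq_iff)
  have "(\<Sum>j \<in> I. f j * f j) = (\<Sum>j \<in> I. complex_of_real (Re (f j) * Re (f j)))"
    by (rule sum.cong[OF refl]) (metis of_real_mult re)
  then have "complex_of_real (\<Sum>j \<in> I. Re (f j) * Re (f j)) = 0" using assms(3) by simp
  then have "(\<Sum>j \<in> I. Re (f j) * Re (f j)) = 0" by (simp only: of_real_eq_0_iff)
  then have "Re (f i) * Re (f i) = 0"
    using sum_nonneg_eq_0_iff[of I "\<lambda>j. Re (f j) * Re (f j)"] assms(1,4) by simp
  then show ?thesis using re[OF assms(4)] by simp
qed

lemma cf_mult_one:
  assumes "x \<in> CSn n" "y \<in> CSn n"
  shows "cf (x * y) 1 = (\<Sum>u \<in> Sym n. cf x u * cf y (inverse u))"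
  using cf_mult[OF assms, of 1] by simp

text \<open>Inversion of group elements extends to an anti-automorphism of the group algebra, so it
  reverses products.\<close>

lemma cf_mult_inverse:
  assumes "x \<in> CSn n" "y \<in> CSn n" "x' \<in> CSn n" "y' \<in> CSn n"
    and "\<And>w. cf x (inverse w) = cf x' w" "\<And>w. cf y (inverse w) = cf y' w"
  shows "cf (x * y) (inverse w) = cf (y' * x') w"
proof -
  have "cf (x * y) (inverse w) = (\<Sum>u \<in> Sym n.
      cf x (inverse u) * cf y (inverse (inverse u) * inverse w))"
    unfolding cf_mult[OF assms(1,2)] by (rule sum_Sym_inverse[symmetric])
  also have "\<dots> = (\<Sum>u \<in> Sym n. cf y' (w * inverse u) * cf x' u)"
  proof (rule sum.cong[OF refl])
    fix u
    have "inverse (inverse u) * inverse w = inverse (w * inverse u)" by simp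
    then show "cf x (inverse u) * cf y (inverse (inverse u) * inverse w) =
        cf y' (w * inverse u) * cf x' u"
      using assms(5)[of u] assms(6)[of "w * inverse u"] by (simp only: mult.commute)
  qed
  also have "\<dots> = cf (y' * x') w" by (rule cf_mult_right[OF assms(4,3), symmetric])
  finally show ?thesis .
qed

lemma cf_mult_real:
  assumes "x \<in> CSn n" "y \<in> CSn n" "\<And>w. cf x w \<in> \<real>" "\<And>w. cf y w \<in> \<real>"
  shows "cf (x * y) w \<in> \<real>"
  unfolding cf_mult[OF assms(1,2)] by (intro sum_in_Reals Reals_mult assms(3,4))

lemma class_sum_conj:
  assumes "v \<in> Sym n" shows "class_sum n x (inverse v * w * v) = class_sum n x w"
proof -
  have "class_sum n x (inverse v * w * v) = (\<Sum>u \<in> Sym n.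
      cf x (inverse (v * u) * inverse w * (v * u)))"
    by (simp add: class_sum_def mult.assoc)
  then show ?thesis
    using sum_Sym_left[OF assms, of "\<lambda>u. cf x (inverse u * inverse w * u)"]
        by (simp add: class_sum_def)
qed

section \<open>The Young symmetrizer as a quasi-idempotent, and its character\<close>

context tableau
begin

lemma rsum_gperm: "v \<in> stab n r \<Longrightarrow> gperm v * rsum = rsum" "v \<in> stab n r \<Longrightarrow> rsum * gperm v = rsum"
  using char_sum_gperm[OF sq_char_trivial] by (simp_all add: rsum_def)

lemma csum_gperm: "v \<in> stab n c \<Longrightarrow> gperm v * csum = scal (sgn_of v) * csum"
  "v \<in> stab n c \<Longrightarrow> csum * gperm v = scal (sgn_of v) * csum"
  using char_sum_gperm[OF sq_char_sign] by (simp_all add: csum_def)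

text \<open>The symmetry that \<open>ysym\<close> has by construction. The space of such elements
  turns out to be one-dimensional, which is the source of the scalars below.\<close>

definition young_type :: "alg \<Rightarrow> bool" where
  "young_type x \<longleftrightarrow> x \<in> CSn n \<and> (\<forall>v \<in> stab n r. gperm v * x = x) \<and>
      (\<forall>v \<in> stab n c. x * gperm v = scal (sgn_of v) * x)"

lemma young_type_left: "young_type x \<Longrightarrow> v \<in> stab n r \<Longrightarrow> cf x (inverse v * w) = cf x w"
  using cf_gperm_left[of x n v w] by (simp add: young_type_def stab_Sym)

lemma young_type_right: "young_type x \<Longrightarrow> v \<in> stab n c \<Longrightarrow> cf x (w * inverse v) = sgn_of v * cf x w"
  using cf_gperm_right[of x n v w] by (simp add: young_type_def stab_Sym)

text \<open>If \<open>w\<close> takes two boxes of a column into one row, transposing them before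
  \<open>w\<close> agrees with transposing their images after it, and the coefficient equals its own
  negative. Otherwise the equality case of the dominance factors \<open>w\<close> into a row
  permutation times a column permutation \<open>s\<close>, and the coefficient is the sign of
  \<open>s\<close> times that at 1. In both cases \<open>e\<close> is independent of the
  element.\<close>

lemma young_type_proportional:
  assumes w: "w \<in> Sym n"
  shows "\<exists>e. \<forall>x. young_type x \<longrightarrow> cf x w = e * cf x 1"
proof (cases "column_injective (\<lambda>x. r (w \<langle>$\<rangle> x))")
  case True
  have cnt: "card {x. x < n \<and> r (w \<langle>$\<rangle> x) < k} = card {x. x < n \<and> r x < k}" for k
  proof (rule bij_betw_same_card)
    show "bij_betw (apply w) {x. x < n \<and> r (w \<langle>$\<rangle> x) < k} {x. x < n \<and> r x < k}"
      by (rule bij_betw_byWitness[where f' = "apply (inverse w)"])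
        (use w in \<open>auto simp: Sym_less_iff Sym_inverse\<close>)
  qed
  obtain s where s: "s \<in> stab n c" "\<And>x. x < n \<Longrightarrow> r (w \<langle>$\<rangle> x) = r (s \<langle>$\<rangle> x)"
    by (rule column_injective_stab[OF True cnt], rule that)
  have sS: "s \<in> Sym n" using s(1) by (rule stab_Sym)
  let ?u = "w * inverse s"
  have "r (w \<langle>$\<rangle> (inverse s \<langle>$\<rangle> x)) = r x" if "x < n" for x
    using s(2)[of "inverse s \<langle>$\<rangle> x"] that Sym_less[OF Sym_inverse[OF sS] that] by simp
  then have u: "?u \<in> stab n r"
    using w sS by (simp add: stab_def fixes_coloring_def Sym_mult Sym_inverse apply_times)
  have "cf x w = sgn_of s * cf x 1" if x: "young_type x" for x
  proof -
    have "cf x (inverse ?u * w) = cf x w" by (rule young_type_left[OF x u])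
    moreover have "inverse ?u * w = s" by (simp add: mult.assoc)
    moreover have "cf x (1 * inverse (inverse s)) = sgn_of (inverse s) * cf x 1"
      by (rule young_type_right[OF x stab_inverse[OF s(1)]])
    ultimately show ?thesis by (simp add: sign_inverse_perm)
  qed
  then show ?thesis by blast
next
  case False
  then obtain x y where xy: "x < n" "y < n" "c x = c y" "r (w \<langle>$\<rangle> x) = r (w \<langle>$\<rangle> y)" "x \<noteq> y"
    unfolding column_injective_def by blast
  let ?t = "\<langle>x \<leftrightarrow> y\<rangle>" and ?u = "\<langle>w \<langle>$\<rangle> x \<leftrightarrow> w \<langle>$\<rangle> y\<rangle>"
  have t: "?t \<in> stab n c" using xy by (intro swap_stab)
  have u: "?u \<in> stab n r" using xy Sym_less[OF w] by (intro swap_stab)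
  have comm: "?u * w = w * ?t"
    by (rule perm_eqI) (auto simp: apply_times apply_swap transpose_def apply_inj)
  have "cf z w = 0 * cf z 1" if z: "young_type z" for z
  proof -
    have "cf z (?u * w) = cf z w" using young_type_left[OF z u] by simp
    moreover have "cf z (w * ?t) = - cf z w"
      using young_type_right[OF z t, of w] xy(5) by (simp add: apply_swap sign_swap_id)
    ultimately show ?thesis by (simp add: comm)
  qed
  then show ?thesis by blast
qed

lemma young_type_ysym: "young_type ysym"
proof -
  have "gperm v * ysym = ysym" if "v \<in> stab n r" for v
    unfolding ysym_def by (simp add: rsum_gperm[OF that] flip: mult.assoc)
  moreover have "ysym * gperm v = scal (sgn_of v) * ysym" if "v \<in> stab n c" for v
    unfolding ysym_def by (simp add: csum_gperm[OF that] mult.assoc scal_left_commute)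
  ultimately show ?thesis by (simp add: young_type_def)
qed

text \<open>The row and column groups meet only in 1, so a single term of the convolution
  survives.\<close>

lemma cf_ysym_one: "cf ysym 1 = 1"
proof -
  have "cf ysym 1 = (\<Sum>u \<in> Sym n. cf rsum u * cf csum (inverse u))"
    unfolding ysym_def by (rule cf_mult_one) simp_all
  also have "\<dots> = (\<Sum>u \<in> Sym n. if u = 1 then 1 else 0)"
  proof (rule sum.cong[OF refl])
    fix u
    have "u = 1" if "u \<in> stab n r" "inverse u \<in> stab n c"
      using stab_disjoint[OF that(1)] stab_inverse[OF that(2)] by simp
    moreover have "sgn_of (1 :: nat perm) = 1" using sq_char_one[OF sq_char_sign] .
    ultimately show "cf rsum u * cf csum (inverse u) = (if u = 1 then 1 else 0)"
      by (auto simp: rsum_def csum_def cf_char_sum stab_one)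
  qed
  finally show ?thesis by (simp add: finite_Sym Sym_one)
qed

lemma young_type_eq:
  assumes x: "young_type x" shows "x = scal (cf x 1) * ysym"
proof (rule CSn_eqI[of _ n])
  fix w assume "w \<in> Sym n"
  then obtain e where e: "\<And>x. young_type x \<Longrightarrow> cf x w = e * cf x 1"
    using young_type_proportional by blast
  show "cf x w = cf (scal (cf x 1) * ysym) w"
    using e[OF x] e[OF young_type_ysym] by (simp add: cf_ysym_one)
qed (use x in \<open>simp_all add: young_type_def CSn_mult CSn_scal\<close>)

text \<open>\<open>ysym * x * ysym\<close> inherits the row symmetry on the left and the column
  symmetry on the right. This takes the place of Schur's lemma.\<close>

lemma ysym_sandwich:
  assumes "x \<in> CSn n" shows "ysym * x * ysym = scal (cf (ysym * x * ysym) 1) * ysym"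
proof (rule young_type_eq)
  have "gperm v * (ysym * x * ysym) = ysym * x * ysym" if "v \<in> stab n r" for v
    using young_type_ysym that by (simp add: young_type_def flip: mult.assoc)
  moreover have "ysym * x * ysym * gperm v = scal (sgn_of v) * (ysym * x * ysym)"
      if "v \<in> stab n c" for v
    using young_type_ysym that by (simp add: young_type_def mult.assoc scal_left_commute)
  ultimately show "young_type (ysym * x * ysym)"
    using assms by (simp add: young_type_def CSn_mult)
qed

text \<open>The scalar in \<open>ysym * ysym = scal hook * ysym\<close>, read off at 1, where
  \<open>ysym\<close> has coefficient 1. Classically it is the product of the hook lengths.\<close>

definition hook :: complex where "hook = cf (ysym * ysym) 1"

lemma ysym_sq: "ysym * ysym = scal hook * ysym"
  using ysym_sandwich[OF CSn_one] by (simp add: hook_def)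

lemma rsum_real: "cf rsum w \<in> \<real>" and csum_real: "cf csum w \<in> \<real>"
  by (simp_all add: rsum_def csum_def cf_char_sum)

lemma ysym_real: "cf ysym w \<in> \<real>"
  unfolding ysym_def by (rule cf_mult_real[OF rsum_CSn csum_CSn rsum_real csum_real])

lemma hook_real: "hook \<in> \<real>"
  unfolding hook_def by (rule cf_mult_real[OF ysym_CSn ysym_CSn ysym_real ysym_real])

lemma stab_inverse_iff: "inverse w \<in> stab n f \<longleftrightarrow> w \<in> stab n f"
  using stab_inverse[of w n f] stab_inverse[of "inverse w" n f] by auto

lemma rsum_inverse: "cf rsum (inverse w) = cf rsum w"
    and csum_inverse: "cf csum (inverse w) = cf csum w"
  by (simp_all add: rsum_def csum_def cf_char_sum stab_inverse_iff sign_inverse_perm)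

lemma ysym_inverse: "cf ysym (inverse w) = cf (csum * rsum) w"
  unfolding ysym_def by (rule cf_mult_inverse[of _ n]) (simp_all add: rsum_inverse csum_inverse)

text \<open>
  The element \<open>rsum * csum * rsum\<close> is self-adjoint, so its square has a positive coefficient at \<open>1\<close>;
  if \<open>hook\<close> were zero, that square would vanish.
\<close>
lemma hook_nonzero: "hook \<noteq> 0"
proof
  assume h: "hook = 0"
  let ?p = "ysym * rsum"
  have p: "?p \<in> CSn n" by (simp add: CSn_mult)
  have csq: "csum * csum = scal (of_nat (card (stab n c))) * csum"
    unfolding csum_def by (rule char_sum_sq[OF sq_char_sign])
  have rsq: "rsum * rsum = scal (of_nat (card (stab n r))) * rsum"
    unfolding rsum_def by (rule char_sum_sq[OF sq_char_trivial])
  \<comment> \<open>Since \<open>csum * rsum\<close> is the adjoint of \<open>ysym\<close>, this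
    product has the sum of the squared coefficients of \<open>ysym\<close> at 1. Hence
    \<open>?p\<close> itself has a nonzero coefficient there.\<close>
  have "ysym * (csum * rsum) = rsum * (csum * csum) * rsum" by (simp add: ysym_def mult.assoc)
  also have "\<dots> = scal (of_nat (card (stab n c))) * ?p"
    by (simp add: csq ysym_def mult.assoc scal_left_commute)
  finally have "of_nat (card (stab n c)) * cf ?p 1 = cf (ysym * (csum * rsum)) 1" by simp
  also have "\<dots> = (\<Sum>u \<in> Sym n. cf ysym u * cf ysym u)"
    by (subst cf_mult_one[of _ n]) (simp_all add: CSn_mult flip: ysym_inverse)
  finally have eq: "of_nat (card (stab n c)) * cf ?p 1 = (\<Sum>u \<in> Sym n. cf ysym u * cf ysym u)" .
  have p1: "cf ?p 1 \<noteq> 0"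
  proof
    assume "cf ?p 1 = 0"
    then have "(\<Sum>u \<in> Sym n. cf ysym u * cf ysym u) = 0" using eq by simp
    from sum_real_squares_zero[OF finite_Sym ysym_real this Sym_one] show False
        by (simp add: cf_ysym_one)
  qed
  have pinv: "cf ?p (inverse w) = cf ?p w" for w
  proof -
    have "cf ?p (inverse w) = cf (rsum * (csum * rsum)) w"
      by (rule cf_mult_inverse[of _ n]) (simp_all add: CSn_mult ysym_inverse rsum_inverse)
    then show ?thesis by (simp add: ysym_def mult.assoc)
  qed
  have "?p * ?p = scal (of_nat (card (stab n r))) * (ysym * ysym * rsum)"
  proof -
    have "?p * ?p = ysym * (rsum * rsum) * csum * rsum" by (simp add: ysym_def mult.assoc)
    also have "\<dots> = scal (of_nat (card (stab n r))) * (ysym * ysym * rsum)"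
      unfolding rsq by (simp add: ysym_def mult.assoc scal_left_commute)
    finally show ?thesis .
  qed
  then have "?p * ?p = 0" by (simp add: ysym_sq h)
  then have "(\<Sum>u \<in> Sym n. cf ?p u * cf ?p u) = 0"
    using cf_mult_one[OF p p] by (simp add: pinv)
  moreover have "cf ?p w \<in> \<real>" for w
    by (rule cf_mult_real[OF ysym_CSn rsum_CSn ysym_real rsum_real])
  ultimately have "cf ?p 1 = 0" using sum_real_squares_zero[OF finite_Sym _ _ Sym_one, of n "cf
      ?p"] by simp
  with p1 show False ..
qed

text \<open>The trace of \<open>ysym\<close> on the permutation module of the colourings of content
  \<open>g\<close>.\<close>

definition coloring_trace :: "(nat \<Rightarrow> int) \<Rightarrow> complex" where
  "coloring_trace g = (\<Sum>u \<in> Sym n. cf ysym u * of_nat (fixed_colorings n g u))"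

lemma coloring_trace_stab: "coloring_trace g = (\<Sum>d \<in> colorings n g. \<Sum>u \<in> stab n d. cf ysym u)"
proof -
  have "coloring_trace g = (\<Sum>u \<in> Sym n. \<Sum>d | d \<in> colorings n g \<and> fixes_coloring n u d. cf ysym u)"
    by (simp add: coloring_trace_def fixed_colorings_def mult.commute)
  also have "\<dots> = (\<Sum>d \<in> colorings n g. \<Sum>u | u \<in> Sym n \<and> fixes_coloring n u d. cf ysym u)"
    by (rule sum_swap_dep) (simp_all add: finite_Sym)
  finally show ?thesis by (simp add: stab_def)
qed

text \<open>The transposition of two boxes with the same column and the same label lies in the
  stabilizer of \<open>d\<close> and changes the sign of \<open>ysym\<close> on the right.\<close>

lemma stab_sum_not_injective:
  assumes "\<not> column_injective d" shows "(\<Sum>u \<in> stab n d. cf ysym u) = 0"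
proof -
  obtain x y where xy: "x < n" "y < n" "c x = c y" "d x = d y" "x \<noteq> y"
    using assms unfolding column_injective_def by blast
  let ?t = "\<langle>x \<leftrightarrow> y\<rangle>"
  have t: "?t \<in> stab n c" "?t \<in> stab n d" using xy by (auto intro!: swap_stab)
  have "(\<Sum>u \<in> stab n d. cf ysym u) = (\<Sum>u \<in> stab n d. cf ysym (u * ?t))"
    by (rule sum.reindex_bij_witness[where i = "\<lambda>u. u * ?t" and j = "\<lambda>u. u * ?t"])
      (simp_all add: mult.assoc stab_mult t)
  also have "\<dots> = - (\<Sum>u \<in> stab n d. cf ysym u)"
    using young_type_right[OF young_type_ysym t(1)] xy(5)
        by (simp add: apply_swap sign_swap_id sum_negf)
  finally show ?thesis by simp
qed

lemma coloring_trace_zero: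
  assumes "\<And>d. d \<in> colorings n g \<Longrightarrow> \<not> column_injective d" shows "coloring_trace g = 0"
  unfolding coloring_trace_stab using assms by (simp add: stab_sum_not_injective)

text \<open>Conjugation by \<open>s\<close> carries the stabilizer of the relabelled rows to that of
  \<open>r\<close>, and absorbing \<open>s\<close> into \<open>ysym\<close> on the right costs its
  sign.\<close>

lemma stab_sum_column:
  assumes s: "s \<in> stab n c"
  shows "(\<Sum>u \<in> stab n (\<lambda>x. r (s \<langle>$\<rangle> x)). cf ysym u) =
      (\<Sum>v \<in> stab n r. sgn_of s * cf (gperm s * ysym) v)"
proof (rule sum.reindex_bij_witness[where i = "\<lambda>v. inverse s * v * s" and j =
    "\<lambda>u. s * u * inverse s"])
  have sS: "s \<in> Sym n" using s by (rule stab_Sym)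
  fix u assume u: "u \<in> stab n (\<lambda>x. r (s \<langle>$\<rangle> x))"
  have "r (s \<langle>$\<rangle> (u \<langle>$\<rangle> (inverse s \<langle>$\<rangle> x))) = r x" if "x < n" for x
    using u Sym_less[OF Sym_inverse[OF sS] that] by (simp add: stab_def fixes_coloring_def)
  then show "s * u * inverse s \<in> stab n r"
    using u sS by (simp add: stab_def fixes_coloring_def Sym_mult Sym_inverse apply_times)
  have "cf ysym (u * inverse s) = sgn_of s * cf ysym u"
      by (rule young_type_right[OF young_type_ysym s])
  moreover have "cf (gperm s * ysym) (s * u * inverse s) = cf ysym (u * inverse s)"
    using cf_gperm_left[OF ysym_CSn sS] by (simp add: mult.assoc)
  ultimately show "sgn_of s * cf (gperm s * ysym) (s * u * inverse s) = cf ysym u"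
    using sq_char_sq[OF sq_char_sign, of s] by (simp flip: mult.assoc)
next
  have sS: "s \<in> Sym n" using s by (rule stab_Sym)
  fix v assume v: "v \<in> stab n r"
  then show "inverse s * v * s \<in> stab n (\<lambda>x. r (s \<langle>$\<rangle> x))"
    using sS by (auto simp: stab_def fixes_coloring_def Sym_mult Sym_inverse apply_times Sym_less)
qed (simp_all add: mult.assoc)

text \<open>By the equality case of the dominance, the column-injective colourings with the content
  of \<open>r\<close> are \<open>r\<close> composed with the column permutations \<open>s\<close>,
  each arising once. Summed over \<open>s\<close>, their stabilizer sums build the coefficient at 1
  of \<open>rsum * csum * ysym\<close>, which is \<open>ysym * ysym\<close>.\<close>

lemma coloring_trace_content:
  "coloring_trace (col_content n r) = hook"
proof -
  let ?d = "\<lambda>s. \<lambda>x \<in> {..<n}. r (s \<langle>$\<rangle> x)"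
  have stab_d: "stab n (?d s) = stab n (\<lambda>x. r (s \<langle>$\<rangle> x))" if "s \<in> stab n c" for s
    by (auto simp: stab_def fixes_coloring_def Sym_less)
  have d_mem: "?d s \<in> {d \<in> colorings n (col_content n r). column_injective d}"
      if s: "s \<in> stab n c" for s
  proof -
    have sS: "s \<in> Sym n" using s by (rule stab_Sym)
    have "restrict r {..<n} \<in> colorings n (col_content n r)"
      by (auto simp: colorings_content intro!: content_cong)
    from act_coloring_colorings[OF this sS] have
        "act_coloring n s (restrict r {..<n}) \<in> colorings n (col_content n r)" .
    moreover have "act_coloring n s (restrict r {..<n}) = ?d s"
      unfolding act_coloring_def using Sym_less[OF sS] by (intro restrict_ext) simp
    ultimately have "?d s \<in> colorings n (col_content n r)" by simp
    moreover have "column_injective (?d s)"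
      unfolding column_injective_def
    proof (intro allI impI)
      fix x y assume a: "x < n \<and> y < n \<and> c x = c y \<and> ?d s x = ?d s y"
      then have xy: "x < n" "y < n" "c x = c y" by blast+
      from a have "?d s x = ?d s y" by blast
      then have rxy: "r (s \<langle>$\<rangle> x) = r (s \<langle>$\<rangle> y)" using xy by simp
      have "s \<langle>$\<rangle> x = s \<langle>$\<rangle> y"
      proof (rule box_inj)
        show "c (s \<langle>$\<rangle> x) = c (s \<langle>$\<rangle> y)" using s xy by (simp add: stab_def fixes_coloring_def)
      qed (use xy rxy Sym_less[OF sS] in simp_all)
      then show "x = y" by (simp add: apply_inj)
    qed
    ultimately show ?thesis by simp
  qed
  have inj: "inj_on ?d (stab n c)"
  proof (rule inj_onI)
    fix s t assume s: "s \<in> stab n c" and t: "t \<in> stab n c" and eq: "?d s = ?d t"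
    show "s = t"
    proof (rule Sym_eqI[of _ n])
      fix x assume x: "x < n"
      show "s \<langle>$\<rangle> x = t \<langle>$\<rangle> x"
      proof (rule box_inj)
        show "r (s \<langle>$\<rangle> x) = r (t \<langle>$\<rangle> x)" using fun_cong[OF eq, of x] x by simp
        show "c (s \<langle>$\<rangle> x) = c (t \<langle>$\<rangle> x)" using s t x by (simp add: stab_def fixes_coloring_def)
        show "s \<langle>$\<rangle> x < n" "t \<langle>$\<rangle> x < n" using Sym_less[OF stab_Sym[OF s] x]
            Sym_less[OF stab_Sym[OF t] x] .
      qed
    qed (use s t in \<open>simp_all add: stab_Sym\<close>)
  qed
  have img: "?d ` stab n c = {d \<in> colorings n (col_content n r). column_injective d}"
  proof (rule Set.set_eqI, rule iffI)
    fix d assume d: "d \<in> {d \<in> colorings n (col_content n r). column_injective d}"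
    have cnt: "card {x. x < n \<and> g x < k} = (\<Sum>i<k. nat (col_content n g i))" for g :: "nat \<Rightarrow> nat"
        and k
    proof -
      have "{x. x < n \<and> g x < k} = (\<Union>i<k. {x. x < n \<and> g x = i})" by auto
      moreover have "card (\<Union>i<k. {x. x < n \<and> g x = i}) = (\<Sum>i<k. card {x. x < n \<and> g x = i})"
        by (rule card_UN_disjoint) auto
      ultimately show ?thesis by (simp add: col_content_def)
    qed
    have dd: "col_content n d = col_content n r" "column_injective d" "d \<in> {..<n} \<rightarrow>\<^sub>E UNIV"
      using d by (simp_all add: colorings_content)
    have cnt': "card {x. x < n \<and> d x < k} = card {x. x < n \<and> r x < k}" for k
      by (simp only: cnt dd(1))
    obtain s where s: "s \<in> stab n c" "\<And>x. x < n \<Longrightarrow> d x = r (s \<langle>$\<rangle> x)"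
      by (rule column_injective_stab[OF dd(2) cnt'], rule that)
    have "restrict d {..<n} = d" using dd(3) by (rule PiE_restrict)
    moreover have "restrict d {..<n} = ?d s" using s(2) by (intro restrict_ext) simp
    ultimately have "d = ?d s" by simp
    then show "d \<in> ?d ` stab n c" using s(1) by (rule image_eqI)
  next
    fix d assume "d \<in> ?d ` stab n c"
    then obtain s where "s \<in> stab n c" "d = ?d s" by (rule imageE)
    with d_mem show "d \<in> {d \<in> colorings n (col_content n r). column_injective d}" by simp
  qed
  have "coloring_trace (col_content n r) =
      (\<Sum>d \<in> {d \<in> colorings n (col_content n r). column_injective d}. \<Sum>u \<in> stab n d. cf ysym u)"
    unfolding coloring_trace_stab
    by (rule sum.mono_neutral_right) (auto simp: stab_sum_not_injective)
  also have "\<dots> = (\<Sum>s \<in> stab n c. \<Sum>u \<in> stab n (?d s). cf ysym u)"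
    unfolding img[symmetric] by (simp add: sum.reindex[OF inj])
  also have "\<dots> = (\<Sum>s \<in> stab n c. \<Sum>v \<in> stab n r. sgn_of s * cf (gperm s * ysym) v)"
    by (rule sum.cong[OF refl]) (simp only: stab_d stab_sum_column)
  also have "\<dots> = (\<Sum>v \<in> stab n r. cf (csum * ysym) v)"
  proof -
    have "csum * ysym = (\<Sum>s \<in> stab n c. scal (sgn_of s) * (gperm s * ysym))"
      by (simp add: csum_def char_sum_def sum_distrib_right mult.assoc)
    then show ?thesis by (subst sum.swap) (simp add: cf_sum)
  qed
  also have "\<dots> = (\<Sum>v \<in> Sym n. cf rsum v * cf (csum * ysym) (inverse v))"
  proof -
    have "(\<Sum>v \<in> Sym n. cf rsum v * cf (csum * ysym) (inverse v)) =
        (\<Sum>v \<in> Sym n. cf rsum v * cf (csum * ysym) v)"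
      using sum_Sym_inverse[of "\<lambda>v. cf rsum (inverse v) * cf (csum * ysym) v" n]
          by (simp add: rsum_inverse)
    also have "\<dots> = (\<Sum>v \<in> stab n r. cf rsum v * cf (csum * ysym) v)"
      by (rule sum.mono_neutral_right) (auto simp: finite_Sym stab_Sym rsum_def cf_char_sum)
    finally show ?thesis by (simp add: rsum_def cf_char_sum)
  qed
  also have "\<dots> = cf (rsum * (csum * ysym)) 1"
    by (rule cf_mult_one[symmetric]) (simp_all add: CSn_mult)
  also have "\<dots> = hook" by (simp add: hook_def ysym_def mult.assoc)
  finally show ?thesis .
qed

text \<open>Inversion turns \<open>rsum * csum\<close> into \<open>csum * rsum\<close>, and the
  trace property does not distinguish the two.\<close>

lemma class_sum_ysym_inverse:
  assumes w: "w \<in> Sym n" shows "class_sum n ysym (inverse w) = class_sum n ysym w"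
proof -
  have "class_sum n ysym w = class_sum n (csum * rsum) w"
    unfolding ysym_def by (rule class_sum_commute[OF rsum_CSn csum_CSn w])
  also have "\<dots> = (\<Sum>v \<in> Sym n. cf ysym (inverse (inverse v * inverse w * v)))"
    by (simp only: class_sum_def ysym_inverse)
  also have "\<dots> = class_sum n ysym (inverse w)" by (simp add: class_sum_def mult.assoc)
  finally show ?thesis ..
qed

text \<open>The pairing of \<open>ysym\<close> with its class sum is a sum over \<open>v\<close>, in
  which the sandwich property turns each term into \<open>cf ysym v\<close> times the coefficient of
  \<open>ysym * gperm v * ysym\<close> at 1. Summing over \<open>v\<close> reassembles the cube of
  \<open>ysym\<close>, which is \<open>hook\<close> squared times \<open>ysym\<close>.\<close>

lemma class_sum_ysym_norm:
  "(\<Sum>w \<in> Sym n. class_sum n ysym w * class_sum n ysym w) = of_nat (card (Sym n)) * (hook * hook)"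
proof -
  have "(\<Sum>w \<in> Sym n. cf ysym w * class_sum n ysym w) =
      (\<Sum>v \<in> Sym n. \<Sum>w \<in> Sym n. cf ysym w * cf ysym (inverse v * inverse w * v))"
    unfolding class_sum_def sum_distrib_left by (rule sum.swap)
  also have "\<dots> = (\<Sum>v \<in> Sym n. cf (scal (cf ysym v) * (ysym * gperm v * ysym)) 1)"
  proof (rule sum.cong[OF refl])
    fix v assume v: "v \<in> Sym n"
    let ?z = "gperm v * (ysym * gperm (inverse v))"
    have z: "?z \<in> CSn n" using v by (simp add: CSn_mult CSn_gperm Sym_inverse)
    have "cf ?z w = cf ysym (inverse v * w * v)" for w
      using v by (simp add: cf_gperm_left[of _ n] cf_gperm_right[of _ n] CSn_mult CSn_gperm
          Sym_inverse)
    then have "(\<Sum>w \<in> Sym n. cf ysym w * cf ysym (inverse v * inverse w * v)) = cf (ysym * ?z) 1"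
      by (simp add: cf_mult_one[OF ysym_CSn z])
    also have "ysym * ?z = (ysym * gperm v * ysym) * gperm (inverse v)" by (simp add: mult.assoc)
    also have "cf \<dots> 1 = cf (ysym * gperm v * ysym) v"
      using v by (subst cf_gperm_right[of _ n]) (simp_all add: CSn_mult CSn_gperm Sym_inverse)
    also have "\<dots> = cf (ysym * gperm v * ysym) 1 * cf ysym v"
      by (subst ysym_sandwich[OF CSn_gperm[OF v]]) simp
    finally show "(\<Sum>w \<in> Sym n. cf ysym w * cf ysym (inverse v * inverse w * v)) =
        cf (scal (cf ysym v) * (ysym * gperm v * ysym)) 1" by simp
  qed
  also have "\<dots> = cf (ysym * (\<Sum>v \<in> Sym n. scal (cf ysym v) * gperm v) * ysym) 1"
    by (simp add: sum_distrib_left sum_distrib_right cf_sum scal_left_commute mult.assoc)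
  also have "(\<Sum>v \<in> Sym n. scal (cf ysym v) * gperm v) = ysym"
    by (rule CSn_expand[OF ysym_CSn, symmetric])
  also have "ysym * ysym * ysym = scal hook * (scal hook * ysym)"
    by (simp only: ysym_sq mult.assoc)
  also have "cf \<dots> 1 = hook * hook" by (simp add: cf_ysym_one)
  finally have *: "(\<Sum>w \<in> Sym n. cf ysym w * class_sum n ysym w) = hook * hook" .
  show ?thesis
    by (subst sum_class_sum) (simp_all add: class_sum_conj class_sum_ysym_inverse *)
qed

text \<open>
  The two sides have the same norm and the inner product attains the Cauchy--Schwarz bound.
\<close>
lemma class_sum_ysym_eq:
  fixes f :: "nat perm \<Rightarrow> int"
  assumes conj: "\<And>v w. v \<in> Sym n \<Longrightarrow> w \<in> Sym n \<Longrightarrow> f (inverse v * w * v) = f w"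
    and inv: "\<And>w. w \<in> Sym n \<Longrightarrow> f (inverse w) = f w"
    and norm: "(\<Sum>w \<in> Sym n. f w * f w) = int (card (Sym n))"
    and ip: "(\<Sum>w \<in> Sym n. cf ysym w * of_int (f w)) = hook"
    and w: "w \<in> Sym n"
  shows "class_sum n ysym w = hook * of_int (f w)"
proof -
  let ?X = "class_sum n ysym" and ?g = "of_nat (card (Sym n)) :: complex"
  let ?D = "\<lambda>w. ?X w - hook * of_int (f w)"
  have norm': "(\<Sum>w \<in> Sym n. of_int (f w) * of_int (f w)) = ?g"
    using arg_cong[OF norm, of "of_int :: int \<Rightarrow> complex"] by simp
  have ip': "(\<Sum>w \<in> Sym n. ?X w * of_int (f w)) = ?g * hook"
    unfolding ip[symmetric] by (rule sum_class_sum) (simp_all add: conj inv)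
  have "(\<Sum>w \<in> Sym n. ?D w * ?D w) = (\<Sum>w \<in> Sym n. ?X w * ?X w)
      - 2 * hook * (\<Sum>w \<in> Sym n. ?X w * of_int (f w)) +
          hook * hook * (\<Sum>w \<in> Sym n. of_int (f w) * of_int (f w))"
    by (simp add: algebra_simps sum.distrib sum_subtractf sum_distrib_left)
  also have "\<dots> = 0" unfolding class_sum_ysym_norm ip' norm' by (simp add: algebra_simps)
  finally have "(\<Sum>w \<in> Sym n. ?D w * ?D w) = 0" .
  moreover have "?D w \<in> \<real>" for w
    unfolding class_sum_def by (intro Reals_diff sum_in_Reals ysym_real Reals_mult hook_real
        Reals_of_int)
  ultimately have "?D w = 0" using sum_real_squares_zero[OF finite_Sym _ _ w, of ?D] by blast
  then show ?thesis by simp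
qed

end


section \<open>The Young symmetrizer of a partition\<close>

fun box_of :: "nat list \<Rightarrow> nat \<Rightarrow> nat \<times> nat" where
  "box_of [] x = (0, 0)"
| "box_of (a # l) x = (if x < a then (0, x) else map_prod Suc id (box_of l (x - a)))"

lemma box_of_iff:
  assumes "x < sum_list la"
  shows "box_of la x = (i, j) \<longleftrightarrow> i < length la \<and> j < la ! i \<and> x = sum_list (take i la) + j"
  using assms
proof (induction la arbitrary: x i)
  case (Cons a l)
  show ?case
  proof (cases "x < a")
    case True
    then show ?thesis by (cases i) auto
  next
    case False
    then have "x - a < sum_list l" using Cons.prems by simp
    note IH = Cons.IH[OF this]
    obtain i' j' where b: "box_of l (x - a) = (i', j')" by (metis surj_pair)
    show ?thesis
    proof (cases i)
      case 0
      then show ?thesis using False by (simp add: b)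
    next
      case (Suc k)
      have "box_of (a # l) x = (i, j) \<longleftrightarrow> box_of l (x - a) = (k, j)"
        using False by (simp add: Suc b)
      also have "\<dots> \<longleftrightarrow> k < length l \<and> j < l ! k \<and> x - a = sum_list (take k l) + j" by (rule IH)
      also have "\<dots> \<longleftrightarrow> i < length (a # l) \<and> j < (a # l) ! i \<and> x = sum_list (take i (a # l)) + j"
        using False by (auto simp: Suc)
      finally show ?thesis .
    qed
  qed
qed simp

lemma box_pos_less: "i < length la \<Longrightarrow> j < la ! i \<Longrightarrow> sum_list (take i la) +
    j < sum_list (la :: nat list)"
proof (induction la arbitrary: i)
  case (Cons a l)
  then show ?case by (cases i) (auto simp: trans_less_add1)
qed simp

lemma tab_row_eq: "tab_row la i = {x. x < sum_list la \<and> fst (box_of la x) = i}"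
proof (intro Set.set_eqI iffI)
  fix x assume "x \<in> tab_row la i"
  then obtain j where j: "i < length la" "j < la ! i" "x = sum_list (take i la) + j"
      by (auto simp: tab_row_def)
  then have x: "x < sum_list la" using box_pos_less by simp
  then have "box_of la x = (i, j)" using j by (simp add: box_of_iff)
  then show "x \<in> {x. x < sum_list la \<and> fst (box_of la x) = i}" using x by simp
next
  fix x assume "x \<in> {x. x < sum_list la \<and> fst (box_of la x) = i}"
  then have x: "x < sum_list la" "box_of la x = (i, snd (box_of la x))" by (auto simp: prod_eq_iff)
  then show "x \<in> tab_row la i" using box_of_iff[OF x(1)] by (auto simp: tab_row_def)
qed

lemma tab_col_eq: "tab_col la j = {x. x < sum_list la \<and> snd (box_of la x) = j}"
proof (intro Set.set_eqI iffI)
  fix x assume "x \<in> tab_col la j"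
  then obtain i where j: "i < length la" "j < la ! i" "x = sum_list (take i la) + j"
      by (auto simp: tab_col_def)
  then have x: "x < sum_list la" using box_pos_less by simp
  then have "box_of la x = (i, j)" using j by (simp add: box_of_iff)
  then show "x \<in> {x. x < sum_list la \<and> snd (box_of la x) = j}" using x by simp
next
  fix x assume "x \<in> {x. x < sum_list la \<and> snd (box_of la x) = j}"
  then have x: "x < sum_list la" "box_of la x = (fst (box_of la x), j)" by (auto simp: prod_eq_iff)
  then show "x \<in> tab_col la j" using box_of_iff[OF x(1)] by (auto simp: tab_col_def)
qed

lemma stab_fibres:
  "{w \<in> Sym n. \<forall>i. apply w ` {x. x < n \<and> f x = i} = {x. x < n \<and> f x = i}} = stab n f"
proof (intro Set.set_eqI iffI)
  fix w assume w: "w \<in> {w \<in> Sym n. \<forall>i. apply w ` {x. x < n \<and> f x = i} = {x. x < n \<and> f x = i}}"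
  have "f (w \<langle>$\<rangle> x) = f x" if "x < n" for x
  proof -
    have "w \<langle>$\<rangle> x \<in> apply w ` {y. y < n \<and> f y = f x}" using that by blast
    also have "\<dots> = {y. y < n \<and> f y = f x}" using w by blast
    finally show ?thesis by simp
  qed
  then show "w \<in> stab n f" using w by (simp add: stab_def fixes_coloring_def)
next
  fix w assume w: "w \<in> stab n f"
  have wi: "inverse w \<in> stab n f" using w by (rule stab_inverse)
  have "apply w ` {x. x < n \<and> f x = i} = {x. x < n \<and> f x = i}" for i
  proof
    show "apply w ` {x. x < n \<and> f x = i} \<subseteq> {x. x < n \<and> f x = i}"
      using w by (auto simp: stab_def fixes_coloring_def Sym_less)
    show "{x. x < n \<and> f x = i} \<subseteq> apply w ` {x. x < n \<and> f x = i}"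
    proof
      fix x assume "x \<in> {x. x < n \<and> f x = i}"
      then have "inverse w \<langle>$\<rangle> x \<in> {x. x < n \<and> f x = i}"
        using wi by (auto simp: stab_def fixes_coloring_def Sym_less)
      then show "x \<in> apply w ` {x. x < n \<and> f x = i}"
        by (intro image_eqI[of _ _ "inverse w \<langle>$\<rangle> x"]) simp_all
    qed
  qed
  then show "w \<in> {w \<in> Sym n. \<forall>i. apply w ` {x. x < n \<and> f x = i} = {x. x < n \<and> f x = i}}"
    using w by (simp add: stab_def)
qed

abbreviation box_row :: "nat list \<Rightarrow> nat \<Rightarrow> nat" where "box_row la x \<equiv> fst (box_of la x)"
abbreviation box_col :: "nat list \<Rightarrow> nat \<Rightarrow> nat" where "box_col la x \<equiv> snd (box_of la x)"

lemma tableau_partition: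
  assumes la: "la \<in> partitions n" shows "tableau n (box_row la) (box_col la)"
proof
  have n: "sum_list la = n" using la by (simp add: partitions_def)
  show "x = y" if "x < n" "y < n" "box_row la x = box_row la y" "box_col la x = box_col la y"
      for x y
    using box_of_iff[of x la "box_row la x" "box_col la x"]
        box_of_iff[of y la "box_row la x" "box_col la x"] that n
    by (simp add: prod_eq_iff)
  show "\<exists>y<n. box_col la y = box_col la x \<and> box_row la y = i" if x: "x < n"
      and i: "i < box_row la x" for x i
  proof -
    let ?j = "box_col la x"
    have b: "box_row la x < length la" "?j < la ! box_row la x"
      using box_of_iff[of x la "box_row la x" ?j] x n by simp_all
    have "la ! box_row la x \<le> la ! i"
      using la i b(1) by (simp add: partitions_def sorted_wrt_iff_nth_less)
    then have ij: "i < length la" "?j < la ! i" using b i by simp_all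
    let ?y = "sum_list (take i la) + ?j"
    have y: "?y < sum_list la" by (rule box_pos_less[OF ij])
    then have "box_of la ?y = (i, ?j)" using ij by (simp add: box_of_iff)
    then show ?thesis using y n by (intro exI[of _ ?y]) simp
  qed
qed

lemma content_box_row:
  assumes la: "la \<in> partitions n" shows "col_content n (box_row la) = row_vec la id"
proof
  fix i
  have n: "sum_list la = n" using la by (simp add: partitions_def)
  have "{x. x < n \<and> box_row la x = i} = (\<lambda>j. sum_list (take i la) + j) ` {..<row_len la i}"
    using tab_row_eq[of la i] unfolding n tab_row_def by (auto simp: row_len_def)
  then have "card {x. x < n \<and> box_row la x = i} = row_len la i"
    by (simp add: card_image)
  then show "col_content n (box_row la) i = row_vec la id i"
    by (simp add: col_content_def row_vec_id)
qed

lemma young_symmetrizer_eq: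
  assumes la: "la \<in> partitions n"
  shows "young_symmetrizer la = tableau.ysym n (box_row la) (box_col la)"
proof -
  interpret tableau n "box_row la" "box_col la" by (rule tableau_partition[OF la])
  have n: "sum_list la = n" using la by (simp add: partitions_def)
  have "row_group la = stab n (box_row la)" "col_group la = stab n (box_col la)"
    unfolding row_group_def col_group_def tab_row_eq tab_col_eq n by (rule stab_fibres)+
  then show ?thesis
    by (simp add: young_symmetrizer_def ysym_def rsum_def csum_def char_sum_def)
qed

lemma card_less_content: "int (card {x. x < n \<and> g x < (k :: nat)}) = (\<Sum>i<k. col_content n g i)"
proof -
  have "{x. x < n \<and> g x < k} = (\<Union>i<k. {x. x < n \<and> g x = i})" by auto
  moreover have "card (\<Union>i<k. {x. x < n \<and> g x = i}) = (\<Sum>i<k. card {x. x < n \<and> g x = i})"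
    by (rule card_UN_disjoint) auto
  ultimately show ?thesis by (simp add: col_content_def)
qed

text \<open>The pairing of \<open>ysym\<close> with the determinantal formula is computed term by
  term. For \<open>p \<noteq> id\<close> a column-injective colouring would have more small labels
  than \<open>column_injective_dominance\<close> allows, so the trace vanishes; the term at
  \<open>id\<close> has the content of the rows and gives \<open>hook\<close>.\<close>

theorem young_symmetrizer_facts:
  assumes la: "la \<in> partitions n"
  obtains h where "h \<noteq> 0" "young_symmetrizer la \<in> CSn n"
    "young_symmetrizer la * young_symmetrizer la = scal h * young_symmetrizer la"
    "\<And>x. x \<in> CSn n \<Longrightarrow> \<exists>g. young_symmetrizer la * x * young_symmetrizer la =
        scal g * young_symmetrizer la"
    "\<And>w. w \<in> Sym n \<Longrightarrow> class_sum n (young_symmetrizer la) w = h * of_int (irr_char n la w)"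
proof -
  interpret tableau n "box_row la" "box_col la" by (rule tableau_partition[OF la])
  note y = young_symmetrizer_eq[OF la]
  have zero: "coloring_trace (row_vec la p) = 0" if p: "p permutes {..<length la}" "p \<noteq> id" for p
  proof (rule coloring_trace_zero, rule notI)
    fix d assume d: "d \<in> colorings n (row_vec la p)" and inj: "column_injective d"
    obtain k where k: "int (\<Sum>i<k. row_len la i) < (\<Sum>i<k. row_vec la p i)"
      using row_vec_dominates_strictly[OF p] .
    have "(\<Sum>i<k. row_vec la p i) = int (card {x. x < n \<and> d x < k})"
      using d by (simp add: card_less_content colorings_content)
    also have "\<dots> \<le> int (card {x. x < n \<and> box_row la x < k})"
      using column_injective_dominance[OF inj, of k] by simp
    also have "\<dots> = int (\<Sum>i<k. row_len la i)"
      by (simp add: card_less_content content_box_row[OF la] row_vec_id)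
    finally show False using k by simp
  qed
  have "(\<Sum>w \<in> Sym n. cf ysym w * of_int (irr_char n la w)) =
      (\<Sum>w \<in> Sym n. \<Sum>p | p permutes {..<length la}.
          of_int (sign p) * (cf ysym w * of_nat (fixed_colorings n (row_vec la p) w)))"
    by (simp add: irr_char_def sum_distrib_left mult_ac)
  also have "\<dots> = (\<Sum>p | p permutes {..<length la}. of_int (sign p) * coloring_trace (row_vec la p))"
    unfolding coloring_trace_def sum_distrib_left by (rule sum.swap)
  also have "\<dots> = (\<Sum>p | p permutes {..<length la}. if p = id then hook else 0)"
    using coloring_trace_content unfolding content_box_row[OF la]
    by (intro sum.cong refl) (simp add: zero)
  also have "\<dots> = hook" by (simp add: finite_permutations permutes_id)
  finally have ip: "(\<Sum>w \<in> Sym n. cf ysym w * of_int (irr_char n la w)) = hook" .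
  have cs: "class_sum n ysym w = hook * of_int (irr_char n la w)" if "w \<in> Sym n" for w
    by (rule class_sum_ysym_eq) (simp_all add: irr_char_conj irr_char_inverse
        irr_char_orthogonal[OF la la] ip that)
  show ?thesis
    by (rule that[of hook]) (use hook_nonzero ysym_sq ysym_sandwich cs in \<open>auto simp: y\<close>)
qed

section \<open>Expansion of class functions, and characters of isomorphic ideals\<close>

lemma central_commutes:
  assumes x: "x \<in> CSn n" and z: "\<And>v. v \<in> Sym n \<Longrightarrow> gperm v * z = z * gperm v"
  shows "x * z = z * x"
proof -
  have "x * z = (\<Sum>v \<in> Sym n. scal (cf x v) * (gperm v * z))"
    by (subst CSn_expand[OF x]) (simp add: sum_distrib_right mult.assoc)
  also have "\<dots> = z * (\<Sum>v \<in> Sym n. scal (cf x v) * gperm v)"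
    unfolding sum_distrib_left by (rule sum.cong[OF refl]) (simp add: z scal_left_commute)
  finally show ?thesis using CSn_expand[OF x] by simp
qed

text \<open>The element \<open>z\<close> with coefficients from \<open>f\<close> is central, so
  \<open>y * y * z = y * z * y\<close>, a multiple of \<open>y\<close> by the sandwich property.
  Right multiplication by \<open>z\<close> therefore scales \<open>y\<close>, and convolution with
  \<open>f\<close> scales the class sum of \<open>y\<close> accordingly.\<close>

lemma class_convolution:
  fixes f :: "nat perm \<Rightarrow> int"
  assumes mu: "mu \<in> partitions n"
    and f: "\<And>v w. v \<in> Sym n \<Longrightarrow> w \<in> Sym n \<Longrightarrow> f (inverse v * w * v) = f w"
  shows "\<exists>e :: complex. \<forall>w \<in> Sym n. (\<Sum>u \<in> Sym n.
      of_int (f u) * of_int (irr_char n mu (inverse u * w))) = e * of_int (irr_char n mu w)"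
proof -
  define y where "y = young_symmetrizer mu"
  obtain h where h: "h \<noteq> 0" "y \<in> CSn n" "y * y = scal h * y"
    "\<And>x. x \<in> CSn n \<Longrightarrow> \<exists>g. y * x * y = scal g * y"
    "\<And>w. w \<in> Sym n \<Longrightarrow> class_sum n y w = h * of_int (irr_char n mu w)"
    unfolding y_def using young_symmetrizer_facts[OF mu] by blast
  define z where "z = (\<Sum>u \<in> Sym n. scal (of_int (f u)) * gperm (inverse u))"
  have zC: "z \<in> CSn n" unfolding z_def by (intro CSn_sum CSn_mult CSn_scal CSn_gperm Sym_inverse)
  have zc: "gperm v * z = z * gperm v" if v: "v \<in> Sym n" for v
  proof -
    have "gperm v * z = (\<Sum>u \<in> Sym n. scal (of_int (f u)) * gperm (v * inverse u))"
      unfolding z_def sum_distrib_left by (simp add: scal_left_commute gperm_mult)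
    also have "\<dots> = (\<Sum>u \<in> Sym n. scal (of_int (f u)) * gperm (inverse u * v))"
      by (rule sum.reindex_bij_witness[where j = "\<lambda>u. v * u * inverse v" and i =
          "\<lambda>u. inverse v * u * v"])
        (use v f[of v] f[OF Sym_inverse[OF v]] in \<open>simp_all add: Sym_mult Sym_inverse mult.assoc\<close>)
    also have "\<dots> = z * gperm v"
      unfolding z_def sum_distrib_right by (simp add: mult.assoc gperm_mult)
    finally show ?thesis .
  qed
  obtain g where g: "y * z * y = scal g * y" using h(4)[OF zC] ..
  have "scal h * (y * z) = y * y * z" by (simp add: h(3) mult.assoc)
  also have "\<dots> = y * (z * y)"
    unfolding mult.assoc by (rule arg_cong[OF central_commutes[OF h(2) zc]])
  also have "\<dots> = y * z * y" by (simp only: mult.assoc)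
  finally have yz: "scal h * (y * z) = scal g * y" by (simp add: g)
  have cyz: "(\<Sum>u \<in> Sym n. of_int (f u) * cf y (x * u)) = g / h * cf y x" for x
  proof -
    have "y * z = (\<Sum>u \<in> Sym n. scal (of_int (f u)) * (y * gperm (inverse u)))"
      unfolding z_def sum_distrib_left by (simp add: scal_left_commute)
    then have "cf (y * z) x = (\<Sum>u \<in> Sym n. of_int (f u) * cf y (x * u))"
      by (simp add: cf_sum cf_gperm_right[OF h(2)] Sym_inverse)
    moreover have "h * cf (y * z) x = g * cf y x"
      using arg_cong[OF yz, of "\<lambda>t. cf t x"] by simp
    ultimately show ?thesis using h(1) by (simp add: field_simps)
  qed
  have "(\<Sum>u \<in> Sym n. of_int (f u) * of_int (irr_char n mu (inverse u * w))) =
      g / h * of_int (irr_char n mu w)"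
    if w: "w \<in> Sym n" for w
  proof -
    have "h * (\<Sum>u \<in> Sym n. of_int (f u) * of_int (irr_char n mu (inverse u * w))) =
        (\<Sum>u \<in> Sym n. of_int (f u) * class_sum n y (inverse u * w))"
      using w by (simp add: sum_distrib_left h(5) Sym_mult Sym_inverse mult_ac)
    also have "\<dots> = (\<Sum>v \<in> Sym n. \<Sum>u \<in> Sym n. of_int (f u) * cf y (inverse v * inverse w * u * v))"
      unfolding class_sum_def sum_distrib_left by (subst sum.swap) (simp add: mult.assoc)
    also have "\<dots> = (\<Sum>v \<in> Sym n. \<Sum>u \<in> Sym n. of_int (f u) * cf y (inverse v * inverse w * v * u))"
    proof (rule sum.cong[OF refl])
      fix v assume v: "v \<in> Sym n"
      show "(\<Sum>u \<in> Sym n. of_int (f u) * cf y (inverse v * inverse w * u * v)) =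
          (\<Sum>u \<in> Sym n. of_int (f u) * cf y (inverse v * inverse w * v * u))"
        by (rule sum.reindex_bij_witness[where j = "\<lambda>u. inverse v * u * v" and i =
            "\<lambda>u. v * u * inverse v"])
          (use v f[OF v] in \<open>simp_all add: Sym_mult Sym_inverse mult.assoc\<close>)
    qed
    also have "\<dots> = g / h * class_sum n y w"
      by (simp only: cyz class_sum_def sum_distrib_left)
    also have "\<dots> = h * (g / h * of_int (irr_char n mu w))" using w h(1) by (simp add: h(5))
    finally show ?thesis by (simp only: mult_left_cancel[OF h(1)])
  qed
  then show ?thesis by blast
qed

text \<open>Convolving \<open>f\<close> with the regular character returns a multiple of
  \<open>f\<close>. The regular character is a combination of irreducible ones, each only scaled by
  the convolution, so \<open>f\<close> is such a combination too; orthogonality then identifies the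
  coefficients.\<close>

theorem class_function_expansion:
  fixes f :: "nat perm \<Rightarrow> int"
  assumes f: "\<And>v w. v \<in> Sym n \<Longrightarrow> w \<in> Sym n \<Longrightarrow> f (inverse v * w * v) = f w" and w: "w \<in> Sym n"
  shows "int (card (Sym n)) * f w = (\<Sum>mu \<in> partitions n.
      (\<Sum>u \<in> Sym n. f u * irr_char n mu u) * irr_char n mu w)"
proof -
  let ?N = "of_nat (card (Sym n)) :: complex"
  let ?irr_char = "\<lambda>mu w. of_int (irr_char n mu w) :: complex"
  obtain a where a: "\<And>w. w \<in> Sym n \<Longrightarrow> (\<Sum>nu \<in> partitions n. a nu * irr_char n nu w) =
      (if w = 1 then int (card (Sym n)) else 0)"
    using regular_irr_char_span[of n] by blast
  have "\<forall>mu. \<exists>e :: complex. mu \<in> partitions n \<longrightarrow>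
      (\<forall>w \<in> Sym n. (\<Sum>u \<in> Sym n. of_int (f u) * ?irr_char mu (inverse u * w)) = e * ?irr_char mu w)"
    using class_convolution[OF _ f] by blast
  then obtain e :: "nat list \<Rightarrow> complex" where e: "\<And>mu w. mu \<in> partitions n \<Longrightarrow> w \<in> Sym n \<Longrightarrow>
      (\<Sum>u \<in> Sym n. of_int (f u) * ?irr_char mu (inverse u * w)) = e mu * ?irr_char mu w"
    by metis
  define b where "b mu = of_int (a mu) * e mu" for mu
  have expand: "?N * of_int (f w) = (\<Sum>nu \<in> partitions n. b nu * ?irr_char nu w)" if w: "w \<in> Sym n"
      for w
  proof -
    have "?N * of_int (f w) = (\<Sum>u \<in> Sym n. of_int (f u) * (if u = w then ?N else 0))"
      using w by (simp add: finite_Sym if_distrib cong: if_cong)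
    also have "\<dots> = (\<Sum>u \<in> Sym n. of_int (f u) *
        (\<Sum>nu \<in> partitions n. of_int (a nu) * ?irr_char nu (inverse u * w)))"
    proof (rule sum.cong[OF refl])
      fix u assume u: "u \<in> Sym n"
      have "inverse u * w = 1 \<longleftrightarrow> u = w" by (metis perm_cancel(2) mult.right_neutral
          perm.left_inverse)
      then have "(if u = w then ?N else 0) = of_int (if inverse u * w =
          1 then int (card (Sym n)) else 0)" by simp
      also have "\<dots> = of_int (\<Sum>nu \<in> partitions n. a nu * irr_char n nu (inverse u * w))"
        using u w by (subst a) (simp_all add: Sym_mult Sym_inverse)
      finally show "of_int (f u) * (if u = w then ?N else 0) =
          of_int (f u) * (\<Sum>nu \<in> partitions n. of_int (a nu) * ?irr_char nu (inverse u * w))" by simp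
    qed
    also have "\<dots> = (\<Sum>nu \<in> partitions n. of_int (a nu) *
        (\<Sum>u \<in> Sym n. of_int (f u) * ?irr_char nu (inverse u * w)))"
      unfolding sum_distrib_left by (subst sum.swap) (simp add: mult_ac)
    also have "\<dots> = (\<Sum>nu \<in> partitions n. b nu * ?irr_char nu w)"
      using w by (intro sum.cong refl) (simp add: e b_def)
    finally show ?thesis .
  qed
  have b: "b mu = of_int (\<Sum>u \<in> Sym n. f u * irr_char n mu u)" if mu: "mu \<in> partitions n" for mu
  proof -
    have orth: "(\<Sum>u \<in> Sym n. ?irr_char nu u * ?irr_char mu u) = (if nu = mu then ?N else 0)"
        if "nu \<in> partitions n" for nu
      using arg_cong[OF irr_char_orthogonal[OF that mu], of "of_int :: int \<Rightarrow> complex"] by simp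
    have "?N * of_int (\<Sum>u \<in> Sym n. f u * irr_char n mu u) =
        (\<Sum>u \<in> Sym n. (\<Sum>nu \<in> partitions n. b nu * ?irr_char nu u) * ?irr_char mu u)"
      by (simp add: sum_distrib_left expand flip: mult.assoc)
    also have "\<dots> = (\<Sum>nu \<in> partitions n. b nu * (\<Sum>u \<in> Sym n. ?irr_char nu u * ?irr_char mu u))"
      unfolding sum_distrib_left sum_distrib_right by (subst sum.swap) (simp add: mult_ac)
    also have "\<dots> = (\<Sum>nu \<in> partitions n. if nu = mu then b nu * ?N else 0)"
      by (rule sum.cong) (simp_all add: orth)
    also have "\<dots> = ?N * b mu" using mu by (simp add: finite_partitions)
    finally show ?thesis using card_Sym_pos[of n] by simp
  qed
  have "of_int (int (card (Sym n)) * f w) = (of_int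
      (\<Sum>mu \<in> partitions n. (\<Sum>u \<in> Sym n. f u * irr_char n mu u) * irr_char n mu w) :: complex)"
    using expand[OF w] by (simp add: b)
  then show ?thesis by (simp only: of_int_eq_iff)
qed

text \<open>
  An isomorphism of the left ideals is right multiplication by an element \<open>p\<close>, its inverse by \<open>q\<close>,
  and then \<open>p * q\<close> and \<open>q * p\<close> are the two idempotents, which have the same character.
\<close>
theorem class_sum_iso:
  assumes la: "la \<in> partitions n" and e: "e \<in> CSn n" "e * e = e"
    and iso: "iso_Sn n (Lirr la) (left_ideal (CSn n) e)" and w: "w \<in> Sym n"
  shows "class_sum n e w = of_int (irr_char n la w)"
proof -
  define y where "y = young_symmetrizer la"
  obtain h where h: "h \<noteq> 0" "y \<in> CSn n" "y * y = scal h * y"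
    "\<And>w. w \<in> Sym n \<Longrightarrow> class_sum n y w = h * of_int (irr_char n la w)"
    unfolding y_def using young_symmetrizer_facts[OF la] by blast
  have n: "sum_list la = n" using la by (simp add: partitions_def)
  define E where "E = scal (1 / h) * y"
  have EC: "E \<in> CSn n" unfolding E_def by (intro CSn_mult CSn_scal h(2))
  have Ey: "y = scal h * E" using h(1) by (simp add: E_def scal_mult flip: mult.assoc)
  have EE: "E * E = E"
  proof -
    have "E * E = scal (1 / h) * (scal (1 / h) * (y * y))"
        by (simp add: E_def mult.assoc scal_left_commute[of y])
    also have "\<dots> = E" using h(1) by (simp add: E_def h(3) scal_mult flip: mult.assoc)
    finally show ?thesis .
  qed
  have L: "Lirr la = left_ideal (CSn n) E"
  proof
    show "Lirr la \<subseteq> left_ideal (CSn n) E"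
    proof
      fix x assume "x \<in> Lirr la"
      then obtain a where "a \<in> CSn n" "x = a * y" by (auto simp: Lirr_def left_ideal_def n y_def)
      then have "scal h * a \<in> CSn n" "x = (scal h * a) * E"
        using Ey by (simp_all add: CSn_mult CSn_scal mult.assoc scal_left_commute[of a])
      then show "x \<in> left_ideal (CSn n) E" by (auto simp: left_ideal_def)
    qed
    show "left_ideal (CSn n) E \<subseteq> Lirr la"
    proof
      fix x assume "x \<in> left_ideal (CSn n) E"
      then obtain a where "a \<in> CSn n" "x = a * E" by (auto simp: left_ideal_def)
      then have "scal (1 / h) * a \<in> CSn n" "x = (scal (1 / h) * a) * y"
        by (simp_all add: E_def CSn_mult CSn_scal mult.assoc scal_left_commute[of a])
      then show "x \<in> Lirr la" by (auto simp: Lirr_def left_ideal_def n y_def)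
    qed
  qed
  obtain f where f: "f \<in> Hom_Sn n (*) (Lirr la) (left_ideal (CSn n) e)"
    and bij: "bij_betw f (Lirr la) (left_ideal (CSn n) e)"
    using iso by (auto simp: iso_Sn_def)
  have fmult: "f (a * x) = a * f x" if "a \<in> CSn n" "x \<in> Lirr la" for a x
    using f that by (auto simp: Hom_Sn_def)
  have fin: "f x \<in> left_ideal (CSn n) e" if "x \<in> Lirr la" for x
    using f that by (auto simp: Hom_Sn_def)
  have EL: "E \<in> Lirr la" unfolding L left_ideal_def using EC EE by (intro CollectI exI[of _ E]) simp
  have ee: "e \<in> left_ideal (CSn n) e" unfolding left_ideal_def using e
      by (intro CollectI exI[of _ e]) simp
  have right_e: "x * e = x" "x \<in> CSn n" if "x \<in> left_ideal (CSn n) e" for x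
    using that e by (auto simp: left_ideal_def mult.assoc CSn_mult)
  have right_E: "x * E = x" "x \<in> CSn n" if "x \<in> Lirr la" for x
    using that EC EE unfolding L by (auto simp: left_ideal_def mult.assoc CSn_mult)
  define p where "p = f E"
  obtain q where q: "q \<in> Lirr la" "f q = e" using bij ee by (metis bij_betw_imp_surj_on imageE)
  have pC: "p \<in> CSn n" and qC: "q \<in> CSn n"
    using right_e(2)[OF fin[OF EL]] right_E(2)[OF q(1)] by (simp_all add: p_def)
  have "q * p = f (q * E)" unfolding p_def using fmult[OF qC EL] by simp
  then have qp: "q * p = e" using right_E(1)[OF q(1)] q(2) by simp
  have pqL: "p * q \<in> Lirr la"
  proof -
    obtain a where "a \<in> CSn n" "q = a * E" using q(1) unfolding L by (auto simp: left_ideal_def)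
    then have "p * a \<in> CSn n" "p * q = (p * a) * E" using pC by (simp_all add: CSn_mult mult.assoc)
    then show ?thesis unfolding L left_ideal_def by blast
  qed
  have "f (p * q) = p * e" using fmult[OF pC q(1)] q(2) by simp
  also have "\<dots> = f E" using right_e(1)[OF fin[OF EL]] by (simp add: p_def)
  finally have pq: "p * q = E"
    using bij pqL EL by (auto simp: bij_betw_def inj_on_def)
  have "class_sum n e w = class_sum n E w"
    unfolding qp[symmetric] pq[symmetric] by (rule class_sum_commute[OF qC pC w])
  also have "\<dots> = of_int (irr_char n la w)"
    using h(1) h(4)[OF w] by (simp add: E_def class_sum_scal)
  finally show ?thesis .
qed


section \<open>Graded multiplicities\<close>

interpretation alg_vs: vector_space "\<lambda>c (f :: alg). scal c * f"
  by standard (simp_all add: distrib_left distrib_right scal_add scal_mult flip: mult.assoc)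

text \<open>The scalar multiplication that \<open>graded_mult\<close> uses on maps, so that
  \<open>map_vs.dim\<close> is the dimension appearing there.\<close>

interpretation map_vs: vector_space "\<lambda>c (f :: alg \<Rightarrow> alg) x. scal c * f x"
  by standard (auto simp: fun_eq_iff distrib_left distrib_right scal_add scal_mult simp flip:
      mult.assoc)

interpretation alg_map: vector_space_pair "\<lambda>c (f :: alg). scal c * f"
    "\<lambda>c (f :: alg \<Rightarrow> alg) x. scal c * f x"
  by standard

lemma dim_linear_image:
  assumes lin: "Vector_Spaces.linear (\<lambda>c (f :: alg). scal c * f)
      (\<lambda>c (f :: alg \<Rightarrow> alg) x. scal c * f x) g"
    and sub: "alg_vs.subspace E" and inj: "inj_on g E"
  shows "map_vs.dim (g ` E) = alg_vs.dim E"
proof -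
  have E: "alg_vs.span E = E" using sub by (rule alg_vs.span_eq_iff[THEN iffD2])
  obtain B where B: "B \<subseteq> E" "alg_vs.independent B" "E \<subseteq> alg_vs.span B" "card B = alg_vs.dim E"
    by (rule alg_vs.basis_exists)
  have span: "alg_vs.span B = E" using B(3) alg_vs.span_mono[OF B(1)] E by auto
  have "map_vs.independent (g ` B)"
    using alg_map.linear_independent_injective_image[OF lin B(2)] inj span by simp
  moreover have "map_vs.span (g ` B) = g ` E"
    using alg_map.linear_span_image[OF lin, of B] span by simp
  ultimately have "map_vs.dim (g ` E) = card (g ` B)"
    by (metis map_vs.dim_span_eq_card_independent)
  also have "\<dots> = card B" by (rule card_image[OF inj_on_subset[OF inj B(1)]])
  finally show ?thesis by (simp add: B(4))
qed

lemma single_scal: "scal c * Poly_Mapping.single b 1 = (Poly_Mapping.single b c :: alg)"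
  by (simp add: scal_def mult_single)

lemma alg_expand:
  assumes "finite X" "Poly_Mapping.keys (f :: alg) \<subseteq> X"
  shows "f = (\<Sum>b \<in> X. scal (Poly_Mapping.lookup f b) * Poly_Mapping.single b 1)"
proof (rule poly_mapping_eqI)
  fix b
  show "Poly_Mapping.lookup f b = Poly_Mapping.lookup
      (\<Sum>b \<in> X. scal (Poly_Mapping.lookup f b) * Poly_Mapping.single b 1) b"
    using assms by (auto simp: lookup_sum single_scal lookup_single when_def in_keys_iff simp del:
        lookup_scal)
qed

text \<open>A projection has trace equal to its rank. In coordinates for a basis \<open>B\<close> of
  \<open>E\<close>, the trace becomes a double sum over \<open>X\<close> and \<open>B\<close>, whose
  part at each \<open>v\<close> in \<open>B\<close> is the coordinate 1 of
  \<open>T v = v\<close>.\<close>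

lemma trace_projection:
  fixes T :: "alg \<Rightarrow> alg"
  assumes X: "finite X" and V: "\<And>v. v \<in> E \<Longrightarrow> Poly_Mapping.keys v \<subseteq> X"
    and T_add: "\<And>f g. T (f + g) = T f + T g" and T_scal: "\<And>c f. T (scal c * f) = scal c * T f"
    and T_mem: "\<And>b. b \<in> X \<Longrightarrow> T (Poly_Mapping.single b 1) \<in> E" and T_id: "\<And>v. v \<in> E \<Longrightarrow> T v = v"
  shows "of_nat (alg_vs.dim E) = (\<Sum>b \<in> X. Poly_Mapping.lookup (T (Poly_Mapping.single b 1)) b)"
proof -
  let ?s = "\<lambda>b. Poly_Mapping.single b 1 :: alg"
  obtain B where B: "B \<subseteq> E" "alg_vs.independent B" "E \<subseteq> alg_vs.span B" "card B = alg_vs.dim E"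
    by (rule alg_vs.basis_exists)
  have "B \<subseteq> alg_vs.span (?s ` X)"
  proof
    fix v assume "v \<in> B"
    then have "Poly_Mapping.keys v \<subseteq> X" using B(1) V by auto
    then have "v = (\<Sum>b \<in> X. scal (Poly_Mapping.lookup v b) * ?s b)" by (rule alg_expand[OF X])
    also have "\<dots> \<in> alg_vs.span (?s ` X)"
      by (intro alg_vs.span_sum alg_vs.span_scale alg_vs.span_base imageI)
    finally show "v \<in> alg_vs.span (?s ` X)" .
  qed
  then have finB: "finite B"
    using alg_vs.independent_span_bound[OF finite_imageI[OF X] B(2)] by blast
  let ?R = "alg_vs.representation B"
  have T_sum: "T (sum f I) = (\<Sum>i \<in> I. T (f i))" if "finite I" for f and I :: "xw set"
    using that
  proof (induction I rule: finite_induct)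
    case empty
    have "T (scal 0 * 0) = scal 0 * T 0" by (rule T_scal)
    then show ?case by simp
  qed (simp add: T_add)
  have Tspan: "T (?s b) \<in> alg_vs.span B" if "b \<in> X" for b using T_mem[OF that] B(3) by auto
  have diag: "(\<Sum>b \<in> X. Poly_Mapping.lookup v b * ?R (T (?s b)) v) = 1" if v: "v \<in> B" for v
  proof -
    have vE: "v \<in> E" using v B(1) by auto
    have "v = T v" by (simp add: T_id[OF vE])
    also have "\<dots> = T (\<Sum>b \<in> X. scal (Poly_Mapping.lookup v b) * ?s b)"
      by (rule arg_cong[OF alg_expand[OF X V[OF vE]]])
    also have "\<dots> = (\<Sum>b \<in> X. scal (Poly_Mapping.lookup v b) * T (?s b))"
      by (simp add: T_sum[OF X] T_scal)
    finally have eq: "v = (\<Sum>b \<in> X. scal (Poly_Mapping.lookup v b) * T (?s b))" .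
    have rep: "?R (\<Sum>b \<in> X. scal (Poly_Mapping.lookup v b) * T (?s b)) =
        (\<lambda>v'. \<Sum>b \<in> X. ?R (scal (Poly_Mapping.lookup v b) * T (?s b)) v')"
      by (rule alg_vs.representation_sum[OF B(2)]) (rule alg_vs.span_scale[OF Tspan])
    have "1 = ?R v v" using alg_vs.representation_basis[OF B(2) v] by simp
    also have "?R v v = ?R (\<Sum>b \<in> X. scal (Poly_Mapping.lookup v b) * T (?s b)) v"
      by (rule arg_cong[where f = "\<lambda>t. ?R t v", OF eq])
    also have "\<dots> = (\<Sum>b \<in> X. ?R (scal (Poly_Mapping.lookup v b) * T (?s b)) v)"
      by (simp only: rep)
    also have "\<dots> = (\<Sum>b \<in> X. Poly_Mapping.lookup v b * ?R (T (?s b)) v)"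
      by (rule sum.cong[OF refl]) (simp add: alg_vs.representation_scale[OF B(2) Tspan])
    finally show ?thesis by simp
  qed
  have "(\<Sum>b \<in> X. Poly_Mapping.lookup (T (?s b)) b) =
      (\<Sum>b \<in> X. \<Sum>v \<in> B. ?R (T (?s b)) v * Poly_Mapping.lookup v b)"
  proof (rule sum.cong[OF refl])
    fix b assume b: "b \<in> X"
    have "(\<Sum>v \<in> B. scal (?R (T (?s b)) v) * v) = T (?s b)"
      by (rule alg_vs.sum_representation_eq[OF B(2) Tspan[OF b] finB]) simp
    from arg_cong[OF this, of "\<lambda>f. Poly_Mapping.lookup f b"]
    show "Poly_Mapping.lookup (T (?s b)) b = (\<Sum>v \<in> B. ?R (T (?s b)) v * Poly_Mapping.lookup v b)"
      by (simp add: lookup_sum)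
  qed
  also have "\<dots> = (\<Sum>v \<in> B. \<Sum>b \<in> X. Poly_Mapping.lookup v b * ?R (T (?s b)) v)"
    by (subst sum.swap) (simp add: mult.commute)
  also have "\<dots> = of_nat (card B)" by (simp add: diag)
  finally show ?thesis by (simp add: B(4))
qed

text \<open>A map out of the left ideal of \<open>y\<close> is determined by its value
  \<open>v\<close> at \<open>y\<close>, and \<open>y * y = scal h * y\<close> forces
  \<open>y * v = scal h * v\<close>. Conversely such a \<open>v\<close> yields the map taking
  \<open>x\<close> to \<open>x * v\<close> divided by \<open>h\<close>, which sends \<open>y\<close>
  back to \<open>v\<close>.\<close>

lemma dim_Hom:
  assumes y: "y \<in> CSn n" and h: "h \<noteq> 0" and yy: "y * y = scal h * y"
    and N0: "0 \<in> N" and N_add: "\<And>v w. v \<in> N \<Longrightarrow> w \<in> N \<Longrightarrow> v + w \<in> N"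
        and N_mult: "\<And>a v. a \<in> CSn n \<Longrightarrow> v \<in> N \<Longrightarrow> a * v \<in> N"
  shows "map_vs.dim (Hom_Sn n (*) (left_ideal (CSn n) y) N) =
      alg_vs.dim {v \<in> N. y * v = scal h * v}"
proof -
  let ?L = "left_ideal (CSn n) y" and ?E = "{v \<in> N. y * v = scal h * v}"
  define g where "g v = (\<lambda>x. if x \<in> ?L then scal (1 / h) * (x * v) else 0)" for v :: alg
  have yL: "y \<in> ?L" unfolding left_ideal_def using CSn_one[of n]
      by (intro CollectI exI[of _ 1]) simp
  have L_mult: "a * x \<in> ?L" if "a \<in> CSn n" "x \<in> ?L" for a x
  proof -
    from that(2) obtain b where "b \<in> CSn n" "x = b * y" by (auto simp: left_ideal_def)
    then have "a * b \<in> CSn n" "a * x = (a * b) * y" using that(1)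
        by (simp_all add: CSn_mult mult.assoc)
    then show ?thesis unfolding left_ideal_def by blast
  qed
  have L_add: "x + x' \<in> ?L" if "x \<in> ?L" "x' \<in> ?L" for x x'
  proof -
    from that obtain b b' where "b \<in> CSn n" "x = b * y" "b' \<in> CSn n" "x' = b' * y"
        by (auto simp: left_ideal_def)
    then have "b + b' \<in> CSn n" "x + x' = (b + b') * y" by (simp_all add: CSn_add distrib_right)
    then show ?thesis unfolding left_ideal_def by blast
  qed
  have L_CSn: "x \<in> CSn n" if "x \<in> ?L" for x using that y by (auto simp: left_ideal_def CSn_mult)
  have lin: "Vector_Spaces.linear (\<lambda>c (f :: alg). scal c * f)
      (\<lambda>c (f :: alg \<Rightarrow> alg) x. scal c * f x) g"
  proof unfold_locales
    show "g (v + w) = g v + g w" for v w by (auto simp: g_def fun_eq_iff distrib_left)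
    show "g (scal c * v) = (\<lambda>x. scal c * g v x)" for c v
    proof
      fix x
      have "scal (1 / h) * (x * (scal c * v)) = scal c * (scal (1 / h) * (x * v))"
        by (simp only: scal_left_commute[of x] scal_left_commute[of "scal (1 / h)"])
      then show "g (scal c * v) x = scal c * g v x" by (simp add: g_def)
    qed
  qed
  have gy: "g v y = v" if "v \<in> ?E" for v
  proof -
    have "g v y = scal (1 / h) * (scal h * v)" using that yL by (simp add: g_def)
    then show ?thesis using h by (simp add: scal_mult flip: mult.assoc)
  qed
  have inj: "inj_on g ?E" by (rule inj_onI) (metis gy)
  have sub: "alg_vs.subspace ?E"
  proof (rule alg_vs.subspaceI)
    show "0 \<in> ?E" using N0 by simp
    show "v + w \<in> ?E" if "v \<in> ?E" "w \<in> ?E" for v w using that N_add by (simp add: distrib_left)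
    show "scal c * v \<in> ?E" if "v \<in> ?E" for c v
    proof -
      have "y * (scal c * v) = scal h * (scal c * v)"
        using that by (simp add: scal_left_commute[of y])
      then show ?thesis using that N_mult[OF CSn_scal] by simp
    qed
  qed
  have "g ` ?E = Hom_Sn n (*) ?L N"
  proof (intro Set.set_eqI iffI)
    fix F assume "F \<in> g ` ?E"
    then obtain v where v: "v \<in> ?E" "F = g v" by auto
    have "g v x \<in> N" if "x \<in> ?L" for x
      using v that N_mult[OF CSn_scal N_mult[OF L_CSn[OF that]]] by (simp add: g_def)
    moreover have "g v (x + x') = g v x + g v x'" if "x \<in> ?L" "x' \<in> ?L" for x x'
      using that L_add[OF that] by (simp add: g_def distrib_left distrib_right)
    moreover have "g v (a * x) = a * g v x" if "a \<in> CSn n" "x \<in> ?L" for a x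
      using that(2) L_mult[OF that] by (simp add: g_def mult.assoc scal_left_commute[of a])
    moreover have "g v x = 0" if "x \<notin> ?L" for x using that by (simp add: g_def)
    ultimately show "F \<in> Hom_Sn n (*) ?L N" unfolding v(2) Hom_Sn_def by blast
  next
    fix F assume F: "F \<in> Hom_Sn n (*) ?L N"
    have Fm: "F (a * x) = a * F x" if "a \<in> CSn n" "x \<in> ?L" for a x using F that
        by (simp add: Hom_Sn_def)
    have F0: "F x = 0" if "x \<notin> ?L" for x using F that by (simp add: Hom_Sn_def)
    have "y * F y = F (y * y)" using Fm[OF y yL] by simp
    also have "\<dots> = scal h * F y" unfolding yy by (rule Fm[OF CSn_scal yL])
    finally have Fy: "y * F y = scal h * F y" .
    have "F y \<in> N" using F yL by (simp add: Hom_Sn_def)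
    then have FE: "F y \<in> ?E" using Fy by simp
    have "F = g (F y)"
    proof
      fix x
      show "F x = g (F y) x"
      proof (cases "x \<in> ?L")
        case True
        then obtain a where a: "a \<in> CSn n" "x = a * y" by (auto simp: left_ideal_def)
        have "scal (1 / h) * (x * F y) = scal (1 / h) * (scal h * (a * F y))"
          using Fy by (simp add: a(2) mult.assoc scal_left_commute[of a])
        also have "\<dots> = a * F y" using h by (simp add: scal_mult flip: mult.assoc)
        also have "\<dots> = F x" using Fm[OF a(1) yL] a(2) by simp
        finally show ?thesis using True by (simp add: g_def)
      qed (simp add: g_def F0)
    qed
    then show "F \<in> g ` ?E" using FE by blast
  qed
  then show ?thesis using dim_linear_image[OF lin sub inj] by simp
qed


section \<open>Traces on the graded components\<close>

lemma card_inv_mons_conj: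
  assumes v: "v \<in> Sym n" shows "card (inv_mons n (inverse v * w * v) d) = card (inv_mons n w d)"
proof (rule bij_betw_same_card, rule bij_betw_byWitness[where f = "mact v" and f' =
    "mact (inverse v)"])
  have keys: "Poly_Mapping.keys (mact u m) \<subseteq> {..<n}" if "u \<in> Sym n" "Poly_Mapping.keys m \<subseteq> {..<n}"
      for u m
    using that by (auto simp: keys_mact Sym_less)
  show "mact v ` inv_mons n (inverse v * w * v) d \<subseteq> inv_mons n w d"
  proof (rule image_subsetI)
    fix m assume m: "m \<in> inv_mons n (inverse v * w * v) d"
    then have "mact v (mact (inverse v * w * v) m) = mact v m" by (simp add: inv_mons_def)
    then have "mact w (mact v m) = mact v m" by (simp add: mult.assoc flip: mact_mult)
    then show "mact v m \<in> inv_mons n w d" using m keys[OF v] by (simp add: inv_mons_def)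
  qed
  show "mact (inverse v) ` inv_mons n w d \<subseteq> inv_mons n (inverse v * w * v) d"
  proof (rule image_subsetI)
    fix m assume m: "m \<in> inv_mons n w d"
    then have "mact (inverse v) (mact w m) = mact (inverse v) m" by (simp add: inv_mons_def)
    then have "mact (inverse v * w * v) (mact (inverse v) m) = mact (inverse v) m"
        by (simp add: mult.assoc flip: mact_mult)
    then show "mact (inverse v) m \<in> inv_mons n (inverse v * w * v) d"
      using m keys[OF Sym_inverse[OF v]] by (simp add: inv_mons_def)
  qed
qed (simp_all flip: mact_mult)

lemma inv_mons_inverse: "inv_mons n (inverse w) d = inv_mons n w d"
proof -
  have "mact (inverse w) m = m \<longleftrightarrow> mact w m = m" for m
    by (metis mact_mult mact_one perm.left_inverse perm.right_inverse)
  then show ?thesis by (simp add: inv_mons_def)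
qed

definition graded_basis :: "nat \<Rightarrow> nat \<Rightarrow> xw set" where
  "graded_basis n d = (\<lambda>(m, w). XW m w) ` ({m. Poly_Mapping.keys m \<subseteq> {..<n} \<and> mdeg m = d} \<times> Sym n)"

lemma finite_graded_basis [simp]: "finite (graded_basis n d)"
  unfolding graded_basis_def using finite_mons finite_Sym by blast

lemma in_graded_basis:
  "b \<in> graded_basis n d \<longleftrightarrow> Poly_Mapping.keys (expo b) \<subseteq> {..<n} \<and> mdeg (expo b) = d \<and> wpart b \<in> Sym n"
  by (cases b) (auto simp: graded_basis_def)

lemma An_deg_keys: "f \<in> An_deg n (int d) \<longleftrightarrow> Poly_Mapping.keys f \<subseteq> graded_basis n d"
  unfolding subset_eq[of "Poly_Mapping.keys f"] in_graded_basis by (auto simp: An_deg_def An_def)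

lemma CSn_An_deg: "x \<in> CSn n \<Longrightarrow> x \<in> An_deg n 0"
  by (auto simp: CSn_def An_deg_def An_def mdeg_def)

text \<open>Multiplication by \<open>u\<close> on the left and \<open>v\<close> on the right sends
  the basis element X^m w to X^(u m) u w v. This is X^m w again only if \<open>u\<close> fixes
  \<open>m\<close> and \<open>v\<close> is the conjugate of the inverse of \<open>u\<close> by
  \<open>w\<close>.\<close>

lemma sandwich_coefficient:
  assumes y: "y \<in> CSn n" and e: "e \<in> CSn n" and w: "w \<in> Sym n"
  shows "Poly_Mapping.lookup (y * (Poly_Mapping.single (XW m w) 1 * e)) (XW m w) =
    (\<Sum>u \<in> Sym n. if mact u m = m then cf y u * cf e (inverse w * inverse u * w) else 0)"
proof -
  let ?b = "Poly_Mapping.single (XW m w) 1 :: alg"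
  have bv: "gperm u * (?b * gperm v) = Poly_Mapping.single (XW (mact u m) (u * w * v)) 1" for u v
    by (simp add: gperm_def mult_single plus_xw_def mult.assoc)
  have "y * (?b * e) = (\<Sum>u \<in> Sym n. \<Sum>v \<in> Sym n.
      scal (cf y u * cf e v) * (gperm u * (?b * gperm v)))"
  proof -
    have "y * (?b * e) = (\<Sum>u \<in> Sym n. scal (cf y u) * gperm u) *
        (?b * (\<Sum>v \<in> Sym n. scal (cf e v) * gperm v))"
      using CSn_expand[OF y] CSn_expand[OF e] by simp
    also have "\<dots> = (\<Sum>u \<in> Sym n. \<Sum>v \<in> Sym n. scal (cf y u) * gperm u *
        (?b * (scal (cf e v) * gperm v)))"
      by (simp only: sum_distrib_left sum_distrib_right) (rule sum.swap)
    also have "\<dots> = (\<Sum>u \<in> Sym n. \<Sum>v \<in> Sym n. scal (cf y u * cf e v) * (gperm u * (?b * gperm v)))"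
    proof (intro sum.cong refl)
      fix u v
      have "scal (cf y u) * gperm u * (?b * (scal (cf e v) * gperm v)) =
          scal (cf y u) * (gperm u * (scal (cf e v) * (?b * gperm v)))"
        by (simp only: scal_left_commute[of ?b] mult.assoc)
      also have "\<dots> = scal (cf y u) * (scal (cf e v) * (gperm u * (?b * gperm v)))"
        by (simp only: scal_left_commute[of "gperm u"])
      finally show "scal (cf y u) * gperm u * (?b * (scal (cf e v) * gperm v)) =
          scal (cf y u * cf e v) * (gperm u * (?b * gperm v))"
        by (simp add: mult.assoc[symmetric] scal_mult)
    qed
    finally show ?thesis .
  qed
  then have "Poly_Mapping.lookup (y * (?b * e)) (XW m w) = (\<Sum>u \<in> Sym n. \<Sum>v \<in> Sym n.
      cf y u * cf e v * (if XW (mact u m) (u * w * v) = XW m w then 1 else 0))"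
    by (simp only: bv lookup_sum lookup_scal lookup_single when_def)
  also have "\<dots> = (\<Sum>u \<in> Sym n. \<Sum>v \<in> Sym n.
      if v = inverse w * inverse u * w then (if mact u m = m then cf y u * cf e v else 0) else 0)"
  proof (intro sum.cong refl)
    fix u v
    have "u * w * v = w \<longleftrightarrow> v = inverse w * inverse u * w"
      using perm_eq_cancel[of "u * w" v w] by (simp add: mult.assoc)
    then show "cf y u * cf e v * (if XW (mact u m) (u * w * v) = XW m w then 1 else 0) =
        (if v = inverse w * inverse u * w then (if mact u m =
            m then cf y u * cf e v else 0) else 0)" by simp
  qed
  also have "\<dots> = (\<Sum>u \<in> Sym n. if mact u m = m then cf y u * cf e (inverse w * inverse u * w) else
      0)"
    using w by (intro sum.cong refl) (simp add: finite_Sym Sym_mult Sym_inverse)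
  finally show ?thesis .
qed

text \<open>Summed over \<open>m\<close>, the diagonal entries count the monomials fixed by
  \<open>u\<close>; summed over \<open>w\<close>, they give the class sum of \<open>e\<close>.
  Together this is the character of a tensor product, paired with \<open>y\<close>.\<close>

lemma trace_sandwich:
  assumes y: "y \<in> CSn n" and e: "e \<in> CSn n"
  shows "(\<Sum>b \<in> graded_basis n d. Poly_Mapping.lookup (y * (Poly_Mapping.single b 1 * e)) b) =
    (\<Sum>u \<in> Sym n. cf y u * (of_nat (card (inv_mons n u d)) * class_sum n e u))"
proof -
  let ?M = "{m. Poly_Mapping.keys m \<subseteq> {..<n} \<and> mdeg m = d}"
  have inj: "inj_on (\<lambda>(m, w). XW m w) (?M \<times> Sym n)" by (auto simp: inj_on_def)
  have "(\<Sum>b \<in> graded_basis n d. Poly_Mapping.lookup (y * (Poly_Mapping.single b 1 * e)) b) =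
      (\<Sum>m \<in> ?M. \<Sum>w \<in> Sym n. Poly_Mapping.lookup (y * (Poly_Mapping.single (XW m w) 1 * e))
          (XW m w))"
    unfolding graded_basis_def sum.reindex[OF inj]
        by (simp add: sum.cartesian_product case_prod_unfold)
  also have "\<dots> = (\<Sum>m \<in> ?M. \<Sum>w \<in> Sym n. \<Sum>u \<in> Sym n. if mact u m =
      m then cf y u * cf e (inverse w * inverse u * w) else 0)"
    by (intro sum.cong refl sandwich_coefficient[OF y e])
  also have "\<dots> = (\<Sum>m \<in> ?M. \<Sum>u \<in> Sym n. if mact u m = m then cf y u * class_sum n e u else 0)"
    by (rule sum.cong[OF refl], subst sum.swap, rule sum.cong[OF refl])
        (simp add: class_sum_def sum_distrib_left)
  also have "\<dots> = (\<Sum>u \<in> Sym n. \<Sum>m \<in> ?M. if mact u m = m then cf y u * class_sum n e u else 0)"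
    by (rule sum.swap)
  also have "\<dots> = (\<Sum>u \<in> Sym n. cf y u * (of_nat (card (inv_mons n u d)) * class_sum n e u))"
  proof (rule sum.cong[OF refl])
    fix u
    have "(\<Sum>m \<in> ?M. if mact u m = m then cf y u * class_sum n e u else 0) =
        (\<Sum>m \<in> {m \<in> ?M. mact u m = m}. cf y u * class_sum n e u)"
      using finite_mons[of n d] by (simp add: sum.If_cases Int_def)
    also have "{m \<in> ?M. mact u m = m} = inv_mons n u d" by (auto simp: inv_mons_def)
    finally show "(\<Sum>m \<in> ?M. if mact u m = m then cf y u * class_sum n e u else 0) =
        cf y u * (of_nat (card (inv_mons n u d)) * class_sum n e u)" by simp
  qed
  finally show ?thesis .
qed

text \<open>The map taking \<open>x\<close> to \<open>y * x * e\<close> divided by \<open>h\<close>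
  projects the degree-\<open>d\<close> part of the algebra onto the vectors that
  \<open>dim_Hom\<close> counts, so its trace is the dimension. Pairing with a class function allows
  the coefficients of \<open>y\<close> to be replaced by its class sum, and \<open>h\<close>
  cancels.\<close>

theorem dim_Hom_Pmod:
  assumes mu: "mu \<in> partitions n" and la: "la \<in> partitions n" and e: "e \<in> CSn n" "e * e = e"
    and iso: "iso_Sn n (Lirr la) (left_ideal (CSn n) e)"
  shows "int (card (Sym n)) * int (map_vs.dim (Hom_Sn n (*) (Lirr mu) (Pmod n e (int d)))) =
    (\<Sum>u \<in> Sym n. irr_char n mu u * (int (card (inv_mons n u d)) * irr_char n la u))"
proof -
  define y where "y = young_symmetrizer mu"
  obtain h where h: "h \<noteq> 0" "y \<in> CSn n" "y * y = scal h * y"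
    "\<And>w. w \<in> Sym n \<Longrightarrow> class_sum n y w = h * of_int (irr_char n mu w)"
    unfolding y_def using young_symmetrizer_facts[OF mu] by blast
  have L: "Lirr mu = left_ideal (CSn n) y" using mu by (simp add: Lirr_def y_def partitions_def)
  let ?N = "Pmod n e (int d)" and ?E = "{v \<in> Pmod n e (int d). y * v = scal h * v}"
  interpret P: fg_graded_module n "(*)" "Pmod n e" by (rule fg_graded_module_Pmod[OF e(1)])
  have N_mult: "a * v \<in> ?N" if "a \<in> CSn n" "v \<in> ?N" for a v
    using P.act_mem[OF CSn_An_deg[OF that(1)] that(2)] by simp
  have dimE: "map_vs.dim (Hom_Sn n (*) (Lirr mu) ?N) = alg_vs.dim ?E"
    unfolding L by (rule dim_Hom[OF h(2,1,3) P.zero_mem P.add_mem N_mult])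
  define T where "T x = scal (1 / h) * (y * (x * e))" for x
  have "of_nat (alg_vs.dim ?E) = (\<Sum>b \<in> graded_basis n d.
      Poly_Mapping.lookup (T (Poly_Mapping.single b 1)) b)"
  proof (rule trace_projection)
    show "Poly_Mapping.keys v \<subseteq> graded_basis n d" if "v \<in> ?E" for v
      using that by (simp add: Pmod_def flip: An_deg_keys)
    show "T (f + g) = T f + T g" for f g by (simp add: T_def distrib_left distrib_right)
    show "T (scal c * f) = scal c * T f" for c f
    proof -
      have "y * (scal c * f * e) = scal c * (y * (f * e))"
          by (simp only: mult.assoc scal_left_commute[of y])
      then show ?thesis by (simp only: T_def scal_left_commute[of "scal (1 / h)"])
    qed
    show "T (Poly_Mapping.single b 1) \<in> ?E" if b: "b \<in> graded_basis n d" for b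
    proof -
      let ?b = "Poly_Mapping.single b 1 :: alg"
      have bA: "?b \<in> An_deg n (int d)" using b by (simp add: An_deg_keys)
      have "?b * e \<in> left_ideal (An n) e" using bA by (auto simp: left_ideal_def An_deg_def)
      moreover have "?b * e \<in> An_deg n (int d)" using An_deg_mult[OF bA CSn_An_deg[OF e(1)]] by simp
      ultimately have bN: "?b * e \<in> ?N" by (simp add: Pmod_def)
      have "T ?b \<in> ?N" unfolding T_def by (rule N_mult[OF CSn_scal N_mult[OF h(2) bN]])
      moreover have "y * T ?b = scal h * T ?b"
      proof -
        have "y * T ?b = scal (1 / h) * (y * y * (?b * e))"
          by (simp only: T_def scal_left_commute[of y] mult.assoc)
        also have "\<dots> = scal (1 / h) * (scal h * (y * (?b * e)))" by (simp only: h(3) mult.assoc)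
        also have "\<dots> = scal h * T ?b" unfolding T_def by (rule scal_left_commute)
        finally show ?thesis .
      qed
      ultimately show ?thesis by simp
    qed
    show "T v = v" if "v \<in> ?E" for v
    proof -
      have v: "y * v = scal h * v" "v \<in> left_ideal (An n) e" using that by (simp_all add: Pmod_def)
      then have "v * e = v" using e(2) by (auto simp: left_ideal_def mult.assoc)
      then have "T v = scal (1 / h) * (scal h * v)" by (simp add: T_def v(1))
      then show ?thesis using h(1) by (simp add: scal_mult flip: mult.assoc)
    qed
  qed simp
  also have "\<dots> = 1 / h * (\<Sum>u \<in> Sym n. cf y u * (of_nat (card (inv_mons n u d)) * class_sum n e u))"
    unfolding trace_sandwich[OF h(2) e(1), symmetric] by (simp add: T_def sum_distrib_left)
  also have "\<dots> = 1 / h * (\<Sum>u \<in> Sym n. cf y u *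
      (of_nat (card (inv_mons n u d)) * of_int (irr_char n la u)))"
    by (simp add: class_sum_iso[OF la e iso])
  finally have dim: "of_nat (alg_vs.dim ?E) =
      1 / h * (\<Sum>u \<in> Sym n. cf y u * (of_nat (card (inv_mons n u d)) * of_int (irr_char n la u)))" .
  let ?f = "\<lambda>u. of_nat (card (inv_mons n u d)) * of_int (irr_char n la u) :: complex"
  have "of_nat (card (Sym n)) * (\<Sum>u \<in> Sym n. cf y u * ?f u) = (\<Sum>u \<in> Sym n. class_sum n y u * ?f u)"
    by (rule sum_class_sum[symmetric]) (simp_all add: card_inv_mons_conj inv_mons_inverse
        irr_char_conj irr_char_inverse)
  also have "\<dots> = h * (\<Sum>u \<in> Sym n. of_int (irr_char n mu u) * ?f u)"
    by (simp add: h(4) sum_distrib_left mult.assoc)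
  finally have "of_nat (card (Sym n)) * of_nat (alg_vs.dim ?E) =
      (\<Sum>u \<in> Sym n. of_int (irr_char n mu u) * ?f u)"
    unfolding dim using h(1) by simp
  then have "(of_int (int (card (Sym n)) * int (alg_vs.dim ?E)) :: complex) =
      of_int (\<Sum>u \<in> Sym n. irr_char n mu u * (int (card (inv_mons n u d)) * irr_char n la u))"
          by simp
  then show ?thesis unfolding dimE by (simp only: of_int_eq_iff)
qed

lemma dim_Hom_Pmod_negative:
  assumes mu: "mu \<in> partitions n" and e: "e \<in> CSn n" and i: "i < 0"
  shows "map_vs.dim (Hom_Sn n (*) (Lirr mu) (Pmod n e i)) = 0"
proof -
  have "v = 0" if v: "v \<in> Pmod n e i" for v
  proof -
    have "Poly_Mapping.keys v = {}" using v i by (fastforce simp: Pmod_def An_deg_def)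
    then show ?thesis by simp
  qed
  then have "f x = 0" if "f \<in> Hom_Sn n (*) (Lirr mu) (Pmod n e i)" for f x
    using that by (cases "x \<in> Lirr mu") (auto simp: Hom_Sn_def)
  then have "Hom_Sn n (*) (Lirr mu) (Pmod n e i) \<subseteq> map_vs.span {}"
    by (auto simp: fun_eq_iff)
  from map_vs.dim_le_card[OF this] show ?thesis by simp
qed

text \<open>The dimensions vanish in negative degrees, which both justifies \<open>Abs_fls\<close>
  and makes the series a power series.\<close>

lemma graded_mult_Pmod:
  assumes mu: "mu \<in> partitions n" and e: "e \<in> CSn n"
  shows "graded_mult n (*) (Pmod n e) mu =
    fps_to_fls (Abs_fps (\<lambda>d. of_nat (map_vs.dim (Hom_Sn n (*) (Lirr mu) (Pmod n e (int d))))))"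
proof (rule fls_eqI)
  fix i
  let ?f = "\<lambda>i. of_nat (map_vs.dim (Hom_Sn n (*) (Lirr mu) (Pmod n e i))) :: rat"
  have neg: "?f i = 0" if "i < 0" for i using dim_Hom_Pmod_negative[OF mu e that] by simp
  have "fls_nth (graded_mult n (*) (Pmod n e) mu) i = ?f i"
    unfolding graded_mult_def by (rule nth_Abs_fls_ex_lower_bound) (use neg in blast)
  then show "fls_nth (graded_mult n (*) (Pmod n e) mu) i =
      fls_nth (fps_to_fls (Abs_fps (\<lambda>d. ?f (int d)))) i"
    using neg[of i] by (cases "i < 0") simp_all
qed


section \<open>Coefficients of the big Schur functions\<close>

definition mon_decs :: "nat \<Rightarrow> mon \<Rightarrow> (nat \<Rightarrow> mon) set" where
  "mon_decs l m = {A \<in> {..<l} \<rightarrow>\<^sub>E UNIV. (\<Sum>i<l. A i) = m}"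

lemma mcoeff_prod:
  "finite (mon_decs l m) \<and> mcoeff (\<Prod>i<l. f i) m = (\<Sum>A \<in> mon_decs l m. \<Prod>i<l. mcoeff (f i) (A i))"
proof (induction l arbitrary: m)
  case 0
  have "mon_decs 0 m = (if m = 0 then {\<lambda>_. undefined} else {})" by (auto simp: mon_decs_def)
  then show ?case by (simp add: one_mps_def)
next
  case (Suc l)
  let ?S = "SIGMA p:splits m. mon_decs l (fst p)"
  have fin: "finite ?S" using Suc by (intro finite_SigmaI) simp_all
  have bij: "bij_betw (\<lambda>(p, A). A(l := snd p)) ?S (mon_decs (Suc l) m)"
  proof (rule bij_betw_byWitness[where f' = "\<lambda>A. ((\<Sum>i<l. A i, A l), restrict A {..<l})"])
    show "\<forall>x \<in> ?S. (\<lambda>A. ((\<Sum>i<l. A i, A l), restrict A {..<l})) ((\<lambda>(p, A). A(l := snd p)) x) = x"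
    proof
      fix x assume "x \<in> ?S"
      then obtain a b A where x: "x = ((a, b), A)" and A: "A \<in> {..<l} \<rightarrow>\<^sub>E UNIV" "(\<Sum>i<l. A i) = a"
        by (auto simp: mon_decs_def)
      have "restrict (A(l := b)) {..<l} = restrict A {..<l}" by (rule restrict_ext) simp
      also have "\<dots> = A" using A(1) by (rule PiE_restrict)
      finally show "(\<lambda>A. ((\<Sum>i<l. A i, A l), restrict A {..<l})) ((\<lambda>(p, A). A(l := snd p)) x) = x"
        using A(2) by (simp add: x)
    qed
    show "\<forall>A \<in> mon_decs (Suc l) m. (\<lambda>(p, A). A(l := snd p)) ((\<Sum>i<l. A i, A l), restrict A {..<l})
        = A"
    proof
      fix A assume "A \<in> mon_decs (Suc l) m"
      then have "A \<in> {..<Suc l} \<rightarrow>\<^sub>E UNIV" by (simp add: mon_decs_def)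
      then have out: "A i = undefined" if "\<not> i < Suc l" for i using that by (auto intro: PiE_arb)
      show "(\<lambda>(p, A). A(l := snd p)) ((\<Sum>i<l. A i, A l), restrict A {..<l}) = A"
        using out by (auto simp: fun_eq_iff)
    qed
    show "(\<lambda>(p, A). A(l := snd p)) ` ?S \<subseteq> mon_decs (Suc l) m"
      by (auto simp: mon_decs_def splits_def PiE_def extensional_def)
    show "(\<lambda>A. ((\<Sum>i<l. A i, A l), restrict A {..<l})) ` mon_decs (Suc l) m \<subseteq> ?S"
    proof (rule image_subsetI)
      fix A assume "A \<in> mon_decs (Suc l) m"
      then have "(\<Sum>i<l. A i) + A l = m" by (simp add: mon_decs_def)
      then show "((\<Sum>i<l. A i, A l), restrict A {..<l}) \<in> ?S" by (simp add: mon_decs_def splits_def)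
    qed
  qed
  have "mcoeff (\<Prod>i<Suc l. f i) m = (\<Sum>p \<in> splits m.
      mcoeff (\<Prod>i<l. f i) (fst p) * mcoeff (f l) (snd p))"
    by (simp add: times_mps_def case_prod_unfold)
  also have "\<dots> = (\<Sum>p \<in> splits m. \<Sum>A \<in> mon_decs l (fst p).
      (\<Prod>i<l. mcoeff (f i) (A i)) * mcoeff (f l) (snd p))"
    using Suc by (simp add: sum_distrib_right)
  also have "\<dots> = (\<Sum>x \<in> ?S. (\<Prod>i<l. mcoeff (f i) (snd x i)) * mcoeff (f l) (snd (fst x)))"
    using Suc by (subst sum.Sigma) (simp_all add: case_prod_unfold)
  also have "\<dots> = (\<Sum>x \<in> ?S. \<Prod>i<Suc l. mcoeff (f i) (((\<lambda>(p, A). A(l := snd p)) x) i))"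
    by (rule sum.cong) (simp_all add: case_prod_unfold)
  also have "\<dots> = (\<Sum>A \<in> mon_decs (Suc l) m. \<Prod>i<Suc l. mcoeff (f i) (A i))"
    by (rule sum.reindex_bij_betw[OF bij])
  finally show ?case using bij_betw_finite[OF bij] fin by simp
qed

lemma mcoeff_hl_q:
  "mcoeff (hl_q r) m = (if int (mdeg m) = r then (1 - fls_X) ^ card (Poly_Mapping.keys m) else 0)"
proof -
  have "(\<Prod>i \<in> Poly_Mapping.keys m. fps_nth hl_factor (Poly_Mapping.lookup m i)) =
      (\<Prod>i \<in> Poly_Mapping.keys m. 1 - fls_X)"
    by (rule prod.cong) (simp_all add: hl_factor_nth in_keys_iff)
  then show ?thesis by (simp add: hl_q_def)
qed

text \<open>Each nonzero exponent contributes 1 - q, so this is the weighted count of matrices from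
  \<open>sum_fixed_colorings_product_ext_char\<close>.\<close>

lemma mcoeff_prod_hl_q:
  "mcoeff (\<Prod>i<l. hl_q (b i)) m = (\<Sum>A \<in> row_decs l b m. \<Prod>i<l.
      (1 - fls_X) ^ card (Poly_Mapping.keys (A i)))"
proof -
  have fin: "finite (mon_decs l m)" using mcoeff_prod by blast
  have "mcoeff (\<Prod>i<l. hl_q (b i)) m = (\<Sum>A \<in> mon_decs l m. \<Prod>i<l. mcoeff (hl_q (b i)) (A i))"
    using mcoeff_prod by blast
  also have "\<dots> = (\<Sum>A \<in> row_decs l b m. \<Prod>i<l. mcoeff (hl_q (b i)) (A i))"
  proof (rule sum.mono_neutral_right[OF fin])
    show "row_decs l b m \<subseteq> mon_decs l m" by (auto simp: row_decs_def mon_decs_def)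
    show "\<forall>A \<in> mon_decs l m - row_decs l b m. (\<Prod>i<l. mcoeff (hl_q (b i)) (A i)) = 0"
    proof
      fix A assume "A \<in> mon_decs l m - row_decs l b m"
      then obtain i where "i < l" "int (mdeg (A i)) \<noteq> b i" by (auto simp: mon_decs_def row_decs_def)
      then show "(\<Prod>i<l. mcoeff (hl_q (b i)) (A i)) = 0"
        by (intro prod_zero) (auto simp: mcoeff_hl_q)
    qed
  qed
  also have "\<dots> = (\<Sum>A \<in> row_decs l b m. \<Prod>i<l. (1 - fls_X) ^ card (Poly_Mapping.keys (A i)))"
    by (intro sum.cong prod.cong refl) (auto simp: row_decs_def mcoeff_hl_q)
  finally show ?thesis .
qed

lemma mcoeff_mconst_mult: "mcoeff (mconst c * f) m = c * mcoeff f m"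
  \<comment> \<open>The instance with exponent 0, where the power of the variable is 1.\<close>
  using mcoeff_mult_var[of f c 0 0 m] by (simp add: mult.commute)

lemma mcoeff_of_int_mult: "mcoeff (of_int k * f) m = of_int k * mcoeff f m"
proof -
  have "(of_int k :: 'a mps) = mconst (of_int k)"
  proof (induction k rule: int_induct[where k = 0])
    case base
    show ?case by (auto intro!: mps_eqI simp: mconst_def zero_mps_def)
  next
    case (step1 i)
    then show ?case by (auto intro!: mps_eqI simp: mconst_def plus_mps_def one_mps_def)
  next
    case (step2 i)
    then show ?case by (auto intro!: mps_eqI simp: mconst_def minus_mps_def one_mps_def)
  qed
  then show ?thesis by (simp add: mcoeff_mconst_mult)
qed

lemma mcoeff_big_schur:
  "mcoeff (big_schur mu) m = (\<Sum>p | p permutes {..<length mu}. of_int (sign p) *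
    (\<Sum>A \<in> row_decs (length mu) (row_vec mu p) m. \<Prod>i<length mu.
        (1 - fls_X) ^ card (Poly_Mapping.keys (A i))))"
proof -
  let ?l = "length mu"
  let ?M = "mat ?l ?l (\<lambda>(i, j). hl_q (int (mu ! i) - int i + int j))"
  have "big_schur mu = (\<Sum>p | p permutes {..<?l}. of_int (sign p) * (\<Prod>i<?l. ?M $$ (i, p i)))"
    unfolding big_schur_def by (simp only: det_def dim_row_mat dim_col_mat atLeast0LessThan
        if_True refl)
  also have "\<dots> = (\<Sum>p | p permutes {..<?l}. of_int (sign p) * (\<Prod>i<?l. hl_q (row_vec mu p i)))"
  proof (rule sum.cong[OF refl])
    fix p assume p: "p \<in> {p. p permutes {..<?l}}"
    have "(\<Prod>i<?l. ?M $$ (i, p i)) = (\<Prod>i<?l. hl_q (row_vec mu p i))"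
    proof (rule prod.cong[OF refl])
      fix i assume i: "i \<in> {..<?l}"
      then have "p i < ?l" using p permutes_in_image[of p "{..<?l}" i] by simp
      then show "?M $$ (i, p i) = hl_q (row_vec mu p i)" using i by (simp add: row_vec_def)
    qed
    then show "of_int (sign p) * (\<Prod>i<?l. ?M $$ (i, p i)) =
        of_int (sign p) * (\<Prod>i<?l. hl_q (row_vec mu p i))"
      by (simp only:)
  qed
  finally have "big_schur mu = (\<Sum>p | p permutes {..<?l}.
      of_int (sign p) * (\<Prod>i<?l. hl_q (row_vec mu p i)))" .
  then show ?thesis
    by (simp add: mcoeff_sum mcoeff_of_int_mult mcoeff_prod_hl_q)
qed

lemma fps_to_fls_sum: "fps_to_fls (\<Sum>i \<in> I. f i) = (\<Sum>i \<in> I. fps_to_fls (f i))"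
  by (induction I rule: infinite_finite_induct) simp_all

lemma ext_char_fps_to_fls: "ext_char n fls_X w = fps_to_fls (ext_char n (fps_X :: rat fps) w)"
  by (simp add: ext_char_def fps_to_fls_sum fls_times_fps_to_fls fps_to_fls_power)

definition sym_char :: "nat \<Rightarrow> nat perm \<Rightarrow> rat fps" where
  "sym_char n w = Abs_fps (\<lambda>d. of_nat (card (inv_mons n w d)))"

text \<open>The identity is proved over power series, with q as \<open>fps_X\<close>, and carried by
  the embedding to the Laurent series that the characteristic uses.\<close>

lemma ext_sym_char: "ext_char n fls_X w * fps_to_fls (sym_char n w) = 1"
  unfolding ext_char_fps_to_fls sym_char_def fls_times_fps_to_fls[symmetric] ext_char_sym_char
      by simp

text \<open>The Leibniz expansion of the determinant and the definition of \<open>irr_char\<close>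
  run over the same permutations with the same contents \<open>row_vec mu p\<close>, so the averages
  match term by term.\<close>

lemma mcoeff_big_schur_irr_char:
  assumes m: "mdeg m = n"
  shows "of_nat (card (Sym n)) * mcoeff (big_schur mu) m =
    (\<Sum>w \<in> Sym n. of_int (irr_char n mu w) * (of_nat (fixed_colorings n (mon_int m) w) * ext_char n
        fls_X w))"
proof -
  have "of_nat (card (Sym n)) * mcoeff (big_schur mu) m =
      (\<Sum>p | p permutes {..<length mu}. of_int (sign p) *
    (of_nat (card (Sym n)) * (\<Sum>A \<in> row_decs (length mu) (row_vec mu p) m. \<Prod>i<length mu.
        (1 - fls_X) ^ card (Poly_Mapping.keys (A i)))))"
    by (simp add: mcoeff_big_schur sum_distrib_left mult.left_commute)
  also have "\<dots> = (\<Sum>p | p permutes {..<length mu}. of_int (sign p) *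
    (\<Sum>w \<in> Sym n. of_nat (fixed_colorings n (row_vec mu p) w) * of_nat
        (fixed_colorings n (mon_int m) w) * ext_char n fls_X w))"
    by (subst sum_fixed_colorings_product_ext_char[OF m, where l = "length mu"])
        (simp_all add: row_vec_def)
  also have "\<dots> = (\<Sum>w \<in> Sym n. of_int (irr_char n mu w) *
      (of_nat (fixed_colorings n (mon_int m) w) * ext_char n fls_X w))"
    unfolding sum_distrib_left by (subst sum.swap)
        (simp add: irr_char_def sum_distrib_right mult.assoc)
  finally show ?thesis .
qed

lemma mcoeff_big_schur_degree:
  assumes mu: "mu \<in> partitions n" and m: "mdeg m \<noteq> n"
  shows "mcoeff (big_schur mu) m = 0"
proof -
  have "row_decs (length mu) (row_vec mu p) m = {}" if p: "p permutes {..<length mu}" for p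
  proof (rule equals0I)
    fix A assume A: "A \<in> row_decs (length mu) (row_vec mu p) m"
    then have "int (mdeg m) = (\<Sum>i<length mu. int (mdeg (A i)))"
        by (auto simp: row_decs_def mdeg_sum)
    also have "\<dots> = (\<Sum>i<length mu. row_vec mu p i)" using A
        by (intro sum.cong) (auto simp: row_decs_def)
    also have "\<dots> = int n" by (rule sum_row_vec[OF mu p])
    finally show False using m by simp
  qed
  then show ?thesis by (simp add: mcoeff_big_schur)
qed

lemma cells_row_len: "cells la = shape_cells (row_len la)"
  by (auto simp: cells_def shape_cells_def row_len_def split: if_splits)

lemma mcoeff_schur: "mcoeff (schur la) m = of_nat (card (shape_ssyt (row_len la) m))"
proof -
  have "{T \<in> ssyt la. \<forall>k. card {c \<in> cells la. T c = k} = Poly_Mapping.lookup m k} =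
      shape_ssyt (row_len la) m"
    unfolding ssyt_def shape_ssyt_def cells_row_len
  proof (intro Collect_cong, simp only: mem_Collect_eq conj_assoc, intro conj_cong refl)
    fix T :: "nat \<times> nat \<Rightarrow> nat"
    have "(i, j) \<in> shape_cells (row_len la) \<and> (i, k) \<in> shape_cells (row_len la) \<and> j < k \<longleftrightarrow>
        k < row_len la i \<and> j < k" for i j k
      by (auto simp: shape_cells_def)
    then show "(\<forall>i j k. (i, j) \<in> shape_cells (row_len la) \<and> (i, k) \<in> shape_cells (row_len la) \<and>
        j < k \<longrightarrow> T (i, j) \<le> T (i, k)) =
        (\<forall>i j k. k < row_len la i \<and> j < k \<longrightarrow> T (i, j) \<le> T (i, k))" by simp
    show "(\<forall>i j k. (i, k) \<in> shape_cells (row_len la) \<and> (j, k) \<in> shape_cells (row_len la) \<and> i < j \<longrightarrow>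
        T (i, k) < T (j, k)) =
        (\<forall>i j k. k < row_len la i \<and> k < row_len la j \<and> i < j \<longrightarrow> T (i, k) < T (j, k))"
      by (simp add: shape_cells_def)
  qed
  then show ?thesis by (simp add: schur_def)
qed

lemma mcoeff_schur_degree:
  assumes la: "la \<in> partitions n" and m: "mdeg m \<noteq> n"
  shows "mcoeff (schur la) m = 0"
proof -
  note s = row_len_shape[OF la]
  have "shape_ssyt (row_len la) m = {}"
  proof (rule equals0I)
    fix T assume T: "T \<in> shape_ssyt (row_len la) m"
    obtain N where N: "Poly_Mapping.keys m \<subseteq> {..<N}"
      using finite_nat_iff_bounded[of "Poly_Mapping.keys m"] by auto
    have "{c \<in> shape_cells (row_len la). T c < N} = shape_cells (row_len la)"
      using shape_ssyt_key[OF s T] N by auto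
    then have "mdeg m = card (shape_cells (row_len la))"
      using card_cells_entries[OF s T, of N] mdeg_superset[OF _ N] by simp
    also have "\<dots> = n" using sum_row_len[OF la] by (simp add: shape_cells_Sigma[OF s])
    finally show False using m by simp
  qed
  then show ?thesis by (simp add: mcoeff_schur)
qed

section \<open>The multiplicity series and the final identity\<close>

lemma graded_mult_irr_char:
  assumes mu: "mu \<in> partitions n" and la: "la \<in> partitions n" and e: "e \<in> CSn n" "e * e = e"
    and iso: "iso_Sn n (Lirr la) (left_ideal (CSn n) e)"
  shows "of_nat (card (Sym n)) * graded_mult n (*) (Pmod n e) mu =
    (\<Sum>u \<in> Sym n. of_int (irr_char n mu u * irr_char n la u) * fps_to_fls (sym_char n u))"
proof -
  let ?dim = "\<lambda>d. map_vs.dim (Hom_Sn n (*) (Lirr mu) (Pmod n e (int d)))"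
  have "of_nat (card (Sym n)) * Abs_fps (\<lambda>d. of_nat (?dim d)) =
      (\<Sum>u \<in> Sym n. of_int (irr_char n mu u * irr_char n la u) * sym_char n u)"
  proof (rule fps_ext)
    fix d
    have "(of_int (int (card (Sym n)) * int (?dim d)) :: rat) =
        of_int (\<Sum>u \<in> Sym n. irr_char n mu u * (int (card (inv_mons n u d)) * irr_char n la u))"
      by (simp only: dim_Hom_Pmod[OF mu la e iso])
    then show "fps_nth (of_nat (card (Sym n)) * Abs_fps (\<lambda>d. of_nat (?dim d))) d =
        fps_nth (\<Sum>u \<in> Sym n. of_int (irr_char n mu u * irr_char n la u) * sym_char n u) d"
      by (simp add: fps_of_nat[symmetric] fps_of_int[symmetric] fps_sum_nth sym_char_def mult_ac
          del: of_int_mult)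
        (simp add: mult_ac)
  qed
  then have "fps_to_fls (of_nat (card (Sym n)) * Abs_fps (\<lambda>d. of_nat (?dim d))) =
      fps_to_fls (\<Sum>u \<in> Sym n. of_int (irr_char n mu u * irr_char n la u) * sym_char n u)"
          by (simp only:)
  then show ?thesis
    by (simp add: graded_mult_Pmod[OF mu e(1)] fps_to_fls_sum fls_times_fps_to_fls
        fps_to_fls_of_nat fps_to_fls_of_int del: of_int_mult)
qed

text \<open>The expansion of class functions is stated for integer values, so it is applied in each
  degree to the product of \<open>irr_char n la\<close> with the number of invariant
  monomials.\<close>

lemma sym_char_irr_char_expansion:
  assumes w: "w \<in> Sym n"
  shows "of_nat (card (Sym n)) * (of_int (irr_char n la w) * fps_to_fls (sym_char n w)) =
    (\<Sum>mu \<in> partitions n. (\<Sum>u \<in> Sym n. of_int (irr_char n mu u * irr_char n la u) * fps_to_fls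
        (sym_char n u)) * of_int (irr_char n mu w))"
proof -
  have "of_nat (card (Sym n)) * (of_int (irr_char n la w) * sym_char n w) =
      (\<Sum>mu \<in> partitions n. (\<Sum>u \<in> Sym n. of_int (irr_char n mu u * irr_char n la u) * sym_char n u)
          * of_int (irr_char n mu w))"
  proof (rule fps_ext)
    fix d
    let ?f = "\<lambda>u. irr_char n la u * int (card (inv_mons n u d))"
    have "int (card (Sym n)) * ?f w = (\<Sum>mu \<in> partitions n.
        (\<Sum>u \<in> Sym n. ?f u * irr_char n mu u) * irr_char n mu w)"
      by (rule class_function_expansion[OF _ w]) (simp add: irr_char_conj card_inv_mons_conj)
    from arg_cong[OF this, of "of_int :: int \<Rightarrow> rat"]
    show "fps_nth (of_nat (card (Sym n)) * (of_int (irr_char n la w) * sym_char n w)) d =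
        fps_nth (\<Sum>mu \<in> partitions n. (\<Sum>u \<in> Sym n.
            of_int (irr_char n mu u * irr_char n la u) * sym_char n u) * of_int (irr_char n mu w))
            d"
      by (simp add: fps_of_nat[symmetric] fps_of_int[symmetric] fps_sum_nth sym_char_def mult_ac)
  qed
  then have "fps_to_fls (of_nat (card (Sym n)) * (of_int (irr_char n la w) * sym_char n w)) =
      fps_to_fls (\<Sum>mu \<in> partitions n. (\<Sum>u \<in> Sym n.
          of_int (irr_char n mu u * irr_char n la u) * sym_char n u) * of_int (irr_char n mu w))"
    by (simp only:)
  then show ?thesis
    by (simp add: fps_to_fls_sum fls_times_fps_to_fls fps_to_fls_of_nat fps_to_fls_of_int del:
        of_int_mult)
qed

theorem proposition2p17:
  fixes n :: nat and la :: "nat list" and e :: alg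
  assumes "la \<in> partitions n"
    and "e \<in> CSn n" and "e * e = e"
    and "iso_Sn n (Lirr la) (left_ideal (CSn n) e)"
  shows "Psi n (*) (Pmod n e) = schur la"
proof (rule mps_eqI)
  fix m :: mon
  let ?g = "of_nat (card (Sym n)) :: rat fls"
  let ?gm = "graded_mult n (*) (Pmod n e)"
  have coeff: "mcoeff (Psi n (*) (Pmod n e)) m =
      (\<Sum>mu \<in> partitions n. ?gm mu * mcoeff (big_schur mu) m)"
    by (simp add: Psi_def mcoeff_sum mcoeff_mconst_mult)
  show "mcoeff (Psi n (*) (Pmod n e)) m = mcoeff (schur la) m"
  proof (cases "mdeg m = n")
    case False
    then show ?thesis
      using assms(1) by (simp add: coeff mcoeff_big_schur_degree mcoeff_schur_degree)
  next
    case True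
    let ?h = "\<lambda>w. of_nat (fixed_colorings n (mon_int m) w) * ext_char n fls_X w"
    let ?c = "\<lambda>mu. \<Sum>u \<in> Sym n. of_int (irr_char n mu u * irr_char n la u) * fps_to_fls
        (sym_char n u)"
    \<comment> \<open>Both factors of each summand are averages over the group, so its order is
      needed twice.\<close>
    have "?g * ?g * mcoeff (Psi n (*) (Pmod n e)) m =
        (\<Sum>mu \<in> partitions n. (?g * ?gm mu) * (?g * mcoeff (big_schur mu) m))"
      unfolding coeff sum_distrib_left by (simp only: mult_ac)
    also have "\<dots> = (\<Sum>mu \<in> partitions n. ?c mu * (\<Sum>w \<in> Sym n. of_int (irr_char n mu w) * ?h w))"
      by (intro sum.cong refl) (simp only: graded_mult_irr_char[OF _ assms]
          mcoeff_big_schur_irr_char[OF True])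
    also have "\<dots> = (\<Sum>w \<in> Sym n. (\<Sum>mu \<in> partitions n. ?c mu * of_int (irr_char n mu w)) * ?h w)"
      unfolding sum_distrib_left[of "?c _"] sum_distrib_right[of _ "partitions n"]
      by (subst sum.swap) (simp only: mult.assoc)
    also have "\<dots> = (\<Sum>w \<in> Sym n. ?g * (of_int (irr_char n la w) * fps_to_fls (sym_char n w)) * ?h w)"
      by (intro sum.cong refl) (simp only: sym_char_irr_char_expansion)
    \<comment> \<open>The graded character of the polynomials, coming from the module, cancels
      against the exterior character, coming from the big Schur functions.\<close>
    also have "\<dots> = ?g * (\<Sum>w \<in> Sym n. of_int (irr_char n la w) * of_nat
        (fixed_colorings n (mon_int m) w))"
      unfolding sum_distrib_left
    proof (intro sum.cong refl)
      fix w
      have "?g * (of_int (irr_char n la w) * fps_to_fls (sym_char n w)) * ?h w =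
          ?g * (of_int (irr_char n la w) * of_nat (fixed_colorings n (mon_int m) w)) *
              (ext_char n fls_X w * fps_to_fls (sym_char n w))"
        by (simp only: mult_ac)
      then show "?g * (of_int (irr_char n la w) * fps_to_fls (sym_char n w)) * ?h w =
          ?g * (of_int (irr_char n la w) * of_nat (fixed_colorings n (mon_int m) w))"
        by (simp only: ext_sym_char mult_1_right)
    qed
    also have "(\<Sum>w \<in> Sym n. of_int (irr_char n la w) * of_nat (fixed_colorings n (mon_int m) w)) =
        ?g * mcoeff (schur la) m"
      using arg_cong[OF irr_char_mon[OF assms(1) True], of "of_int :: int \<Rightarrow> rat fls"]
          by (simp add: mcoeff_schur)
    finally have eq: "?g * ?g * mcoeff (Psi n (*) (Pmod n e)) m = ?g * ?g * mcoeff (schur la) m"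
      by (simp only: mult.assoc)
    have "?g * ?g \<noteq> 0" using card_Sym_pos[of n] by simp
    from mult_left_cancel[OF this] eq show ?thesis by blast
  qed
qed

end
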